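(* Let $M$ be the McLain group of a non-empty totally ordered set $(\Lambda,\leq)$ over a ring $R$ with $1\neq0$, and let $F$ be a field such that $R$ admits a right primitive linear character $R^+\to F^*$. Suppose $U=V(D,f)$ and $U'=V(D',f')$ are basic $M$-modules satisfying $$\mathrm{Hom}_M(U,U')\neq0.$$ Then $D=D'$ and $f=f'$.
   Context: Modules are over the field $F$ and may be infinite dimensional; $\mathrm{ind}_H^GW=FG\otimes_{FH}W$. $R$ and $\Lambda$ may be infinite and $R$ need not be commutative. McLain group: $\Phi=\{(\alpha,\beta)\in\Lambda\times\Lambda:\alpha<\beta\}$. $J$ is the free left $R$-module with basis $e_{\alpha\beta}$, $(\alpha,\beta)\in\Phi$, made into a ring by $(re_{\alpha\beta})(se_{\beta\gamma})=rs\,e_{\alpha\gamma}$ and $(re_{\alpha\beta})(se_{\gamma\delta})=0$ if $\beta\neq\gamma$, extended additively. $J$ is nil, and $M=\{1+x:x\in J\}$ is a group under multiplication. $M_{\alpha\beta}=\{1+re_{\alpha\beta}:r\in R\}$. A group homomorphism $R^+\to F^*$ (linear character) is right primitive if the only right ideal of $R$ contained in its kernel is $(0)$. Elementary modules: let $(\alpha,\beta)\in\Phi$ and let $\mu:R^+\to F^*$ be right primitive. Let $L$ be the subgroup generated by all $M_{\gamma\delta}$ with $\alpha\le\gamma<\delta\le\beta$; let $P$ be the subgroup of $L$ generated by all $M_{\gamma\beta}$ with $\alpha\le\gamma<\beta$ and all $M_{\gamma\delta}$ with $\alpha<\gamma<\delta<\beta$. There is a $1$-dimensional $P$-module on which $1+re_{\alpha\beta}$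 acts as $\mu(r)$ and all the other listed generators act trivially; $V(\alpha,\beta,\mu)$ is the $L$-module induced from it, viewed as an $M$-module through $M=N\rtimes L$, where $N$ is the normal subgroup generated by all $M_{\gamma\delta}$ with $\gamma<\alpha$ or $\delta>\beta$, and $N$ acts trivially. Basic modules: a finite non-empty subset $D=\{(\alpha_1,\beta_1),\dots,(\alpha_m,\beta_m)\}$ of $\Phi$ is basic if the $\alpha_i$ are distinct and the $\beta_i$ are distinct. Given a basic $D$ and a function $f$ from $D$ into the set of right primitive linear characters $R^+\to F^*$, $f(\alpha_i,\beta_i)=\lambda_i$, the basic $M$-module is $V(D,f)=V(\alpha_m,\beta_m,\lambda_m)\otimes_F\cdots\otimes_FV(\alpha_1,\beta_1,\lambda_1)$ with diagonal action. *)

theory Defs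
  imports
    Complex_Main
    "HOL-Algebra.Module"
    "HOL-Algebra.Generated_Groups"
    "HOL-Library.Poly_Mapping"
    "HOL-Library.FuncSet"
begin

section \<open>The McLain group\<close>

definition Phi :: "('l::linorder \<times> 'l) set" where
  "Phi = {(\<alpha>, \<beta>). \<alpha> < \<beta>}"

text \<open>
  An element of the free left \<open>R\<close>-module \<open>J\<close> on the basis \<open>e\<^sub>\<alpha>\<^sub>\<beta>\<close>, \<open>(\<alpha>, \<beta>) \<in> Phi\<close>, is the finitely
  supported family of its coordinates; \<open>r e\<^sub>\<alpha>\<^sub>\<beta>\<close> is \<open>Poly_Mapping.single (\<alpha>, \<beta>) r\<close>.
\<close>

definition McLain_J :: "(('l::linorder \<times> 'l) \<Rightarrow>\<^sub>0 'r::ring_1) set" where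
  "McLain_J = {x. Poly_Mapping.keys x \<subseteq> Phi}"

text \<open>The biadditive extension of \<open>(r e\<^sub>\<alpha>\<^sub>\<beta>) (s e\<^sub>\<beta>\<^sub>\<gamma>) = r s e\<^sub>\<alpha>\<^sub>\<gamma>\<close> and
  \<open>(r e\<^sub>\<alpha>\<^sub>\<beta>) (s e\<^sub>\<gamma>\<^sub>\<delta>) = 0\<close> for \<open>\<beta> \<noteq> \<gamma>\<close>.\<close>

definition J_mult ::
    "(('l \<times> 'l) \<Rightarrow>\<^sub>0 'r) \<Rightarrow> (('l \<times> 'l) \<Rightarrow>\<^sub>0 'r) \<Rightarrow> (('l::linorder \<times> 'l) \<Rightarrow>\<^sub>0 'r::ring_1)" where
  "J_mult x y = (\<Sum>(\<alpha>, \<beta>)\<in>Poly_Mapping.keys x. \<Sum>(\<gamma>, \<delta>)\<in>Poly_Mapping.keys y.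
     if \<beta> = \<gamma>
     then Poly_Mapping.single (\<alpha>, \<delta>)
            (Poly_Mapping.lookup x (\<alpha>, \<beta>) * Poly_Mapping.lookup y (\<gamma>, \<delta>))
     else 0)"

text \<open>
  \<open>J\<close> has no identity; the element \<open>1 + x\<close> of \<open>M\<close> is represented by \<open>x \<in> J\<close>. As
  \<open>(1 + x) (1 + y) = 1 + (x + y + x y)\<close>, the multiplication of \<open>M\<close> becomes the circle
  operation on \<open>J\<close>, and the identity of \<open>M\<close> becomes \<open>0\<close>.
\<close>

definition McLain :: "(('l::linorder \<times> 'l) \<Rightarrow>\<^sub>0 'r::ring_1) monoid" where
  "McLain = \<lparr>carrier = McLain_J, mult = (\<lambda>x y. x + y + J_mult x y), one = 0\<rparr>"

definition root_subgroup :: "'l \<Rightarrow> 'l \<Rightarrow> (('l::linorder \<times> 'l) \<Rightarrow>\<^sub>0 'r::ring_1) set" where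
  "root_subgroup \<alpha> \<beta> = range (Poly_Mapping.single (\<alpha>, \<beta>))"


section \<open>Right primitive linear characters\<close>

definition right_ideal :: "'r::ring_1 set \<Rightarrow> bool" where
  "right_ideal I \<longleftrightarrow> 0 \<in> I \<and> (\<forall>a\<in>I. \<forall>b\<in>I. a + b \<in> I) \<and> (\<forall>a\<in>I. \<forall>r. a * r \<in> I)"

definition linear_char :: "('r::ring_1 \<Rightarrow> 'f::field) \<Rightarrow> bool" where
  "linear_char \<mu> \<longleftrightarrow> (\<forall>r. \<mu> r \<noteq> 0) \<and> (\<forall>r s. \<mu> (r + s) = \<mu> r * \<mu> s)"

definition right_primitive :: "('r::ring_1 \<Rightarrow> 'f::field) \<Rightarrow> bool" where
  "right_primitive \<mu> \<longleftrightarrow>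
     linear_char \<mu> \<and> (\<forall>I. right_ideal I \<and> I \<subseteq> {r. \<mu> r = 1} \<longrightarrow> I = {0})"


section \<open>Modules for a group over a field\<close>

text \<open>
  A module over \<open>FG\<close> is an \<open>F\<close>-space with a linear action of \<open>G\<close>. The field \<open>F\<close> is the type
  \<open>'f\<close>. As everywhere in HOL-Algebra, the multiplicative fields of a module record are unused.
\<close>

record ('f, 'g, 'v) gmodule = "('f, 'v) module" +
  act :: "'g \<Rightarrow> 'v \<Rightarrow> 'v"

definition gmodule_hom ::
    "'g monoid \<Rightarrow> ('f, 'g, 'v) gmodule \<Rightarrow> ('f, 'g, 'w) gmodule \<Rightarrow> ('v \<Rightarrow> 'w) set" where
  "gmodule_hom G U W = {\<theta> \<in> carrier U \<rightarrow>\<^sub>E carrier W.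
     (\<forall>u\<in>carrier U. \<forall>v\<in>carrier U. \<theta> (u \<oplus>\<^bsub>U\<^esub> v) = \<theta> u \<oplus>\<^bsub>W\<^esub> \<theta> v) \<and>
     (\<forall>c. \<forall>u\<in>carrier U. \<theta> (c \<odot>\<^bsub>U\<^esub> u) = c \<odot>\<^bsub>W\<^esub> \<theta> u) \<and>
     (\<forall>g\<in>carrier G. \<forall>u\<in>carrier U. \<theta> (act U g u) = act W g (\<theta> u))}"

definition zero_hom :: "('f, 'g, 'v) gmodule \<Rightarrow> ('f, 'g, 'w) gmodule \<Rightarrow> 'v \<Rightarrow> 'w" where
  "zero_hom U W = (\<lambda>u\<in>carrier U. \<zero>\<^bsub>W\<^esub>)"

definition one_dim_gmodule :: "('g \<Rightarrow> 'f) \<Rightarrow> ('f::field, 'g, 'f) gmodule" where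
  "one_dim_gmodule \<chi> = \<lparr>carrier = UNIV, mult = undefined, one = undefined,
     zero = 0, add = (+), smult = (*), act = (\<lambda>g v. \<chi> g * v)\<rparr>"


section \<open>Modules given by generators and relations\<close>

definition scale :: "'f \<Rightarrow> ('x \<Rightarrow>\<^sub>0 'f) \<Rightarrow> ('x \<Rightarrow>\<^sub>0 'f::field)" where
  "scale c = Poly_Mapping.map ((*) c)"

definition basis_vec :: "'x \<Rightarrow> ('x \<Rightarrow>\<^sub>0 'f::field)" where
  "basis_vec x = Poly_Mapping.single x 1"

definition free_space :: "'x set \<Rightarrow> ('x \<Rightarrow>\<^sub>0 'f::field) set" where
  "free_space S = {p. Poly_Mapping.keys p \<subseteq> S}"

text \<open>The linear extension of a map between basis elements.\<close>

definition push :: "('x \<Rightarrow> 'y) \<Rightarrow> ('x \<Rightarrow>\<^sub>0 'f) \<Rightarrow> ('y \<Rightarrow>\<^sub>0 'f::field)" where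
  "push m p = (\<Sum>x\<in>Poly_Mapping.keys p. Poly_Mapping.single (m x) (Poly_Mapping.lookup p x))"

definition coset :: "'a set \<Rightarrow> 'a::ab_group_add \<Rightarrow> 'a set" where
  "coset K p = (\<lambda>k. p + k) ` K"

text \<open>
  The quotient of the free \<open>F\<close>-space on \<open>S\<close> by the subspace spanned by the set \<open>E\<close> of
  relators. A group element \<open>g\<close> acts by the linear map induced by \<open>m g\<close>; this
  is meant for \<open>m g\<close> that map \<open>S\<close> to \<open>S\<close> and preserve the relations. The unions below run
  over the representatives of the cosets, and all representatives give the same coset.
\<close>

definition presented_gmodule ::
    "'x set \<Rightarrow> ('x \<Rightarrow>\<^sub>0 'f) set \<Rightarrow> ('g \<Rightarrow> 'x \<Rightarrow> 'x) \<Rightarrow> ('f::field, 'g, ('x \<Rightarrow>\<^sub>0 'f) set) gmodule"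
  where
  "presented_gmodule S E m = (let K = module.span scale E in
     \<lparr>carrier = coset K ` free_space S, mult = undefined, one = undefined,
      zero = K,
      add = (\<lambda>X Y. \<Union>x\<in>X. \<Union>y\<in>Y. coset K (x + y)),
      smult = (\<lambda>c X. \<Union>x\<in>X. coset K (scale c x)),
      act = (\<lambda>g X. \<Union>x\<in>X. coset K (push (m g) x))\<rparr>)"


section \<open>Induced modules\<close>

definition group_algebra :: "'g set \<Rightarrow> ('g \<Rightarrow>\<^sub>0 'f::field) set" where
  "group_algebra H = {a. Poly_Mapping.keys a \<subseteq> H}"

definition conv :: "'g monoid \<Rightarrow> ('g \<Rightarrow>\<^sub>0 'f) \<Rightarrow> ('g \<Rightarrow>\<^sub>0 'f) \<Rightarrow> ('g \<Rightarrow>\<^sub>0 'f::field)" where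
  "conv G a b = (\<Sum>x\<in>Poly_Mapping.keys a. \<Sum>y\<in>Poly_Mapping.keys b.
     Poly_Mapping.single (x \<otimes>\<^bsub>G\<^esub> y) (Poly_Mapping.lookup a x * Poly_Mapping.lookup b y))"

definition algebra_act :: "('f::field, 'g, 'v) gmodule \<Rightarrow> ('g \<Rightarrow>\<^sub>0 'f) \<Rightarrow> 'v \<Rightarrow> 'v" where
  "algebra_act W b w = (\<Oplus>\<^bsub>W\<^esub>h\<in>Poly_Mapping.keys b. Poly_Mapping.lookup b h \<odot>\<^bsub>W\<^esub> act W h w)"

text \<open>
  For a subgroup \<open>H\<close> of \<open>G\<close> and an \<open>FH\<close>-module \<open>W\<close> this is the tensor product of \<open>FG\<close> and \<open>W\<close>
  over \<open>FH\<close>: the space generated by the symbols \<open>(a, w)\<close> subject to additivity in \<open>a\<close> and in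
  \<open>w\<close>, \<open>F\<close>-homogeneity, and \<open>(a b, w) = (a, b w)\<close> for \<open>b\<close> in \<open>FH\<close>.
  An element \<open>g\<close> of \<open>G\<close> acts by \<open>g (a, w) = (g a, w)\<close>.
\<close>

definition induced_relators ::
    "'g monoid \<Rightarrow> 'g set \<Rightarrow> ('f::field, 'g, 'v) gmodule \<Rightarrow> ((('g \<Rightarrow>\<^sub>0 'f) \<times> 'v) \<Rightarrow>\<^sub>0 'f) set" where
  "induced_relators G H W =
     {basis_vec (a + a', w) - basis_vec (a, w) - basis_vec (a', w) | a a' w.
        a \<in> group_algebra (carrier G) \<and> a' \<in> group_algebra (carrier G) \<and> w \<in> carrier W} \<union>
     {basis_vec (a, w \<oplus>\<^bsub>W\<^esub> w') - basis_vec (a, w) - basis_vec (a, w') | a w w'.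
        a \<in> group_algebra (carrier G) \<and> w \<in> carrier W \<and> w' \<in> carrier W} \<union>
     {basis_vec (scale c a, w) - scale c (basis_vec (a, w)) | c a w.
        a \<in> group_algebra (carrier G) \<and> w \<in> carrier W} \<union>
     {basis_vec (conv G a b, w) - basis_vec (a, algebra_act W b w) | a b w.
        a \<in> group_algebra (carrier G) \<and> b \<in> group_algebra H \<and> w \<in> carrier W}"

definition induced ::
    "'g monoid \<Rightarrow> 'g set \<Rightarrow> ('f::field, 'g, 'v) gmodule \<Rightarrow>
     ('f, 'g, ((('g \<Rightarrow>\<^sub>0 'f) \<times> 'v) \<Rightarrow>\<^sub>0 'f) set) gmodule" where
  "induced G H W = presented_gmodule (group_algebra (carrier G) \<times> carrier W)
     (induced_relators G H W) (\<lambda>g (a, w). (conv G (basis_vec g) a, w))"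


section \<open>Tensor products with diagonal action\<close>

text \<open>
  The tensor product over \<open>F\<close> of a finite family of modules, as the space generated by the
  families \<open>u\<close> with \<open>u i\<close> in \<open>V i\<close> subject to multilinearity.
\<close>

definition tensor_relators ::
    "'i set \<Rightarrow> ('i \<Rightarrow> ('f::field, 'g, 'v) gmodule) \<Rightarrow> (('i \<Rightarrow> 'v) \<Rightarrow>\<^sub>0 'f) set" where
  "tensor_relators I V =
     {basis_vec (u(i := v \<oplus>\<^bsub>V i\<^esub> v')) - basis_vec (u(i := v)) - basis_vec (u(i := v')) | u i v v'.
        u \<in> (\<Pi>\<^sub>E i\<in>I. carrier (V i)) \<and> i \<in> I \<and> v \<in> carrier (V i) \<and> v' \<in> carrier (V i)} \<union>
     {basis_vec (u(i := c \<odot>\<^bsub>V i\<^esub> v)) - scale c (basis_vec (u(i := v))) | u i c v.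
        u \<in> (\<Pi>\<^sub>E i\<in>I. carrier (V i)) \<and> i \<in> I \<and> v \<in> carrier (V i)}"

definition tensor ::
    "'i set \<Rightarrow> ('i \<Rightarrow> ('f::field, 'g, 'v) gmodule) \<Rightarrow>
     ('f, 'g, (('i \<Rightarrow> 'v) \<Rightarrow>\<^sub>0 'f) set) gmodule" where
  "tensor I V = presented_gmodule (\<Pi>\<^sub>E i\<in>I. carrier (V i)) (tensor_relators I V)
     (\<lambda>g u. \<lambda>i\<in>I. act (V i) g (u i))"


section \<open>Elementary and basic modules\<close>

definition elem_L :: "'l \<Rightarrow> 'l \<Rightarrow> (('l::linorder \<times> 'l) \<Rightarrow>\<^sub>0 'r::ring_1) set" where
  "elem_L \<alpha> \<beta> = generate McLain
     (\<Union>{root_subgroup \<gamma> \<delta> | \<gamma> \<delta>. \<alpha> \<le> \<gamma> \<and> \<gamma> < \<delta> \<and> \<delta> \<le> \<beta>})"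

definition elem_P :: "'l \<Rightarrow> 'l \<Rightarrow> (('l::linorder \<times> 'l) \<Rightarrow>\<^sub>0 'r::ring_1) set" where
  "elem_P \<alpha> \<beta> = generate McLain
     (\<Union>{root_subgroup \<gamma> \<beta> | \<gamma>. \<alpha> \<le> \<gamma> \<and> \<gamma> < \<beta>} \<union>
      \<Union>{root_subgroup \<gamma> \<delta> | \<gamma> \<delta>. \<alpha> < \<gamma> \<and> \<gamma> < \<delta> \<and> \<delta> < \<beta>})"

definition normal_closure :: "'g monoid \<Rightarrow> 'g set \<Rightarrow> 'g set" where
  "normal_closure G S = generate G {g \<otimes>\<^bsub>G\<^esub> s \<otimes>\<^bsub>G\<^esub> inv\<^bsub>G\<^esub> g | g s. g \<in> carrier G \<and> s \<in> S}"

definition elem_N :: "'l \<Rightarrow> 'l \<Rightarrow> (('l::linorder \<times> 'l) \<Rightarrow>\<^sub>0 'r::ring_1) set" where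
  "elem_N \<alpha> \<beta> = normal_closure McLain
     (\<Union>{root_subgroup \<gamma> \<delta> | \<gamma> \<delta>. \<gamma> < \<delta> \<and> (\<gamma> < \<alpha> \<or> \<delta> > \<beta>)})"

text \<open>
  The character by which \<open>P\<close> acts on its \<open>1\<close>-dimensional module, determined by its values on the
  generators of \<open>P\<close>.
\<close>

definition is_elem_char ::
    "'l \<Rightarrow> 'l \<Rightarrow> ('r \<Rightarrow> 'f) \<Rightarrow> ((('l::linorder \<times> 'l) \<Rightarrow>\<^sub>0 'r::ring_1) \<Rightarrow> 'f::field) \<Rightarrow> bool" where
  "is_elem_char \<alpha> \<beta> \<mu> \<chi> \<longleftrightarrow>
     \<chi> \<in> extensional (elem_P \<alpha> \<beta>) \<and>
     (\<forall>p\<in>elem_P \<alpha> \<beta>. \<chi> p \<noteq> 0) \<and>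
     (\<forall>p\<in>elem_P \<alpha> \<beta>. \<forall>q\<in>elem_P \<alpha> \<beta>. \<chi> (p \<otimes>\<^bsub>McLain\<^esub> q) = \<chi> p * \<chi> q) \<and>
     (\<forall>r. \<chi> (Poly_Mapping.single (\<alpha>, \<beta>) r) = \<mu> r) \<and>
     (\<forall>\<gamma> r. \<alpha> < \<gamma> \<and> \<gamma> < \<beta> \<longrightarrow> \<chi> (Poly_Mapping.single (\<gamma>, \<beta>) r) = 1) \<and>
     (\<forall>\<gamma> \<delta> r. \<alpha> < \<gamma> \<and> \<gamma> < \<delta> \<and> \<delta> < \<beta> \<longrightarrow> \<chi> (Poly_Mapping.single (\<gamma>, \<delta>) r) = 1)"

definition elem_char ::
    "'l \<Rightarrow> 'l \<Rightarrow> ('r \<Rightarrow> 'f) \<Rightarrow> (('l::linorder \<times> 'l) \<Rightarrow>\<^sub>0 'r::ring_1) \<Rightarrow> 'f::field" where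
  "elem_char \<alpha> \<beta> \<mu> = (THE \<chi>. is_elem_char \<alpha> \<beta> \<mu> \<chi>)"

text \<open>The projection of \<open>M = N \<rtimes> L\<close> onto \<open>L\<close>.\<close>

definition elem_proj ::
    "'l \<Rightarrow> 'l \<Rightarrow> (('l \<times> 'l) \<Rightarrow>\<^sub>0 'r) \<Rightarrow> (('l::linorder \<times> 'l) \<Rightarrow>\<^sub>0 'r::ring_1)" where
  "elem_proj \<alpha> \<beta> x =
     (THE l. l \<in> elem_L \<alpha> \<beta> \<and> (\<exists>n\<in>elem_N \<alpha> \<beta>. x = n \<otimes>\<^bsub>McLain\<^esub> l))"

type_synonym ('l, 'r, 'f) elem_vec =
  "((((('l \<times> 'l) \<Rightarrow>\<^sub>0 'r) \<Rightarrow>\<^sub>0 'f) \<times> 'f) \<Rightarrow>\<^sub>0 'f) set"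

definition elem_L_module ::
    "'l \<Rightarrow> 'l \<Rightarrow> ('r \<Rightarrow> 'f) \<Rightarrow>
     ('f::field, (('l::linorder \<times> 'l) \<Rightarrow>\<^sub>0 'r::ring_1), ('l, 'r, 'f) elem_vec) gmodule" where
  "elem_L_module \<alpha> \<beta> \<mu> =
     induced (McLain\<lparr>carrier := elem_L \<alpha> \<beta>\<rparr>) (elem_P \<alpha> \<beta>) (one_dim_gmodule (elem_char \<alpha> \<beta> \<mu>))"

definition elementary_module ::
    "'l \<Rightarrow> 'l \<Rightarrow> ('r \<Rightarrow> 'f) \<Rightarrow>
     ('f::field, (('l::linorder \<times> 'l) \<Rightarrow>\<^sub>0 'r::ring_1), ('l, 'r, 'f) elem_vec) gmodule" where
  "elementary_module \<alpha> \<beta> \<mu> = (elem_L_module \<alpha> \<beta> \<mu>)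
     \<lparr>act := (\<lambda>x. act (elem_L_module \<alpha> \<beta> \<mu>) (elem_proj \<alpha> \<beta> x))\<rparr>"

definition basic :: "('l::linorder \<times> 'l) set \<Rightarrow> bool" where
  "basic D \<longleftrightarrow> finite D \<and> D \<noteq> {} \<and> D \<subseteq> Phi \<and> inj_on fst D \<and> inj_on snd D"

text \<open>The tensor product is indexed by \<open>D\<close> itself, so no enumeration of \<open>D\<close> is chosen.\<close>

definition basic_module ::
    "('l \<times> 'l) set \<Rightarrow> ('l \<times> 'l \<Rightarrow> 'r \<Rightarrow> 'f) \<Rightarrow>
     ('f::field, (('l::linorder \<times> 'l) \<Rightarrow>\<^sub>0 'r::ring_1),
      (('l \<times> 'l \<Rightarrow> ('l, 'r, 'f) elem_vec) \<Rightarrow>\<^sub>0 'f) set) gmodule" where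
  "basic_module D f = tensor D (\<lambda>(\<alpha>, \<beta>). elementary_module \<alpha> \<beta> (f (\<alpha>, \<beta>)))"

end

theory Submission
  imports Defs
begin

text \<open>
  Fix a linear form \<open>\<Xi>\<close> on \<open>V(D', f')\<close> and attach to a vector \<open>\<psi>\<close> the function
  \<open>z \<mapsto> \<Xi>((1 + z)\<^sup>-\<^sup>1 \<psi>)\<close> on \<open>J\<close>. For a suitable \<open>\<Xi>\<close>, the basis vector of \<open>V(D', f')\<close> with rows
  \<open>r\<^sub>j\<close> (supported strictly between \<open>\<alpha>'\<^sub>j\<close> and \<open>\<beta>'\<^sub>j\<close>) becomes the linear character
  \<open>\<Prod>\<^sub>j \<lambda>'\<^sub>j((r\<^sub>j z - z)\<^bsub>\<alpha>'\<^sub>j\<beta>'\<^sub>j\<^esub>)\<close> of \<open>J\<close>. As the \<open>\<lambda>'\<^sub>j\<close> are right primitive and the \<open>\<beta>'\<^sub>j\<close> are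
  distinct, different rows give different characters, which are linearly independent; so a
  nonzero \<open>\<psi>\<close> has a nonzero function.

  Let \<open>\<psi>\<close> be the image of the cyclic generator of \<open>V(D, f)\<close>, which is nonzero, and let its function
  not vanish at \<open>z\<close>. Let \<open>y\<close> be concentrated in a row \<open>\<kappa>\<close>, to the right of or at \<open>\<beta>\<^sub>i\<close> if
  \<open>\<kappa> = \<alpha>\<^sub>i\<close>. Then \<open>1 + y\<close> multiplies the generator by \<open>\<Prod>\<^sub>i \<lambda>\<^sub>i(y\<^bsub>\<alpha>\<^sub>i\<beta>\<^sub>i\<^esub>)\<close>. On functions it
  replaces \<open>z\<close> by \<open>z - q\<close> with \<open>q = y + y z\<close>, which is again concentrated in row \<open>\<kappa>\<close>; if
  \<open>q\<close> vanishes at the columns \<open>\<beta>'\<^sub>j\<close> with \<open>\<alpha>'\<^sub>j < \<kappa>\<close>, this multiplies every character by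
  \<open>\<Prod>\<^sub>j \<lambda>'\<^sub>j(q\<^bsub>\<alpha>'\<^sub>j\<beta>'\<^sub>j\<^esub>)\<close>. Hence the two products agree. If \<open>(D, f) \<noteq> (D', f')\<close>, let \<open>\<kappa>\<close> be the first
  row in which they differ: a row \<open>y\<close> violating this equality is found by solving a triangular
  system of linear equations.
\<close>

section \<open>Free spaces\<close>

lemma lookup_scale [simp]: "Poly_Mapping.lookup (scale c p) x = c * Poly_Mapping.lookup p x"
  unfolding scale_def by transfer (auto simp: when_def)

interpretation free: vector_space "scale :: 'f::field \<Rightarrow> ('x \<Rightarrow>\<^sub>0 'f) \<Rightarrow> ('x \<Rightarrow>\<^sub>0 'f)"
  by unfold_locales (auto intro!: poly_mapping_eqI simp: lookup_add algebra_simps)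

lemma keys_scale: "Poly_Mapping.keys (scale c p) \<subseteq> Poly_Mapping.keys p"
  by (auto simp: in_keys_iff)

lemma scale_single: "scale c (Poly_Mapping.single x d) = Poly_Mapping.single x (c * d)"
  by (rule poly_mapping_eqI) (simp add: lookup_single when_def)

lemma free_space_zero [simp]: "0 \<in> free_space S"
  and free_space_add: "p \<in> free_space S \<Longrightarrow> q \<in> free_space S \<Longrightarrow> p + q \<in> free_space S"
  and free_space_scale: "p \<in> free_space S \<Longrightarrow> scale c p \<in> free_space S"
  and free_space_basis_vec: "x \<in> S \<Longrightarrow> (basis_vec x :: _ \<Rightarrow>\<^sub>0 'f::field) \<in> free_space S"
  using keys_add[of p q] keys_scale[of c p] by (auto simp: free_space_def basis_vec_def)

text \<open>The induction runs over a finite set of basis elements containing the keys, because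
  \<open>keys\<close> of a difference is controlled only by inclusion.\<close>

lemma free_space_induct [consumes 1, case_names zero step]:
  fixes p :: "'x \<Rightarrow>\<^sub>0 'f::field"
  assumes "p \<in> free_space S" and zero: "Q 0"
    and step: "\<And>p c x. p \<in> free_space S \<Longrightarrow> Q p \<Longrightarrow> x \<in> S \<Longrightarrow> Q (scale c (basis_vec x) + p)"
  shows "Q p"
proof -
  have "Q p" if "finite A" "Poly_Mapping.keys p \<subseteq> A" "A \<subseteq> S" for A and p :: "'x \<Rightarrow>\<^sub>0 'f"
    using that
  proof (induction A arbitrary: p rule: finite_induct)
    case empty
    then have "p = 0" by (auto intro!: poly_mapping_eqI simp: in_keys_iff)
    then show ?case using zero by simp
  next
    case (insert x A)
    define q where "q = p - Poly_Mapping.single x (Poly_Mapping.lookup p x)"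
    have q: "Poly_Mapping.keys q \<subseteq> A"
      using insert.prems by (auto simp: q_def in_keys_iff lookup_minus lookup_single when_def split: if_splits)
    have "p = scale (Poly_Mapping.lookup p x) (basis_vec x) + q"
      by (simp add: q_def basis_vec_def scale_single)
    moreover have "Q (scale (Poly_Mapping.lookup p x) (basis_vec x) + q)"
    proof (rule step)
      show "q \<in> free_space S" using q insert.prems by (auto simp: free_space_def)
      show "Q q" using insert.IH q insert.prems by blast
      show "x \<in> S" using insert.prems by blast
    qed
    ultimately show ?case by simp
  qed
  from this[of "Poly_Mapping.keys p" p] assms(1) show ?thesis by (auto simp: free_space_def)
qed

section \<open>Linear forms and linear maps on a free space, given on the basis\<close>

definition lin_ext :: "('x \<Rightarrow> 'f) \<Rightarrow> ('x \<Rightarrow>\<^sub>0 'f::field) \<Rightarrow> 'f" where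
  "lin_ext \<phi> p = (\<Sum>x\<in>Poly_Mapping.keys p. Poly_Mapping.lookup p x * \<phi> x)"

lemma lin_ext_superset:
  assumes "finite A" "Poly_Mapping.keys p \<subseteq> A"
  shows "lin_ext \<phi> p = (\<Sum>x\<in>A. Poly_Mapping.lookup p x * \<phi> x)"
  unfolding lin_ext_def by (rule sum.mono_neutral_left) (use assms in \<open>auto simp: in_keys_iff\<close>)

lemma lin_ext_zero [simp]: "lin_ext \<phi> 0 = 0"
  by (simp add: lin_ext_def)

lemma lin_ext_add: "lin_ext \<phi> (p + q) = lin_ext \<phi> p + lin_ext \<phi> q"
proof -
  let ?A = "Poly_Mapping.keys p \<union> Poly_Mapping.keys q"
  show ?thesis
    using keys_add[of p q]
    by (simp add: lin_ext_superset[of ?A] lookup_add algebra_simps sum.distrib)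
qed

lemma lin_ext_scale: "lin_ext \<phi> (scale c p) = c * lin_ext \<phi> p"
  using keys_scale[of c p]
  by (simp add: lin_ext_superset[of "Poly_Mapping.keys p"] sum_distrib_left mult.assoc)

lemma lin_ext_diff: "lin_ext \<phi> (p - q) = lin_ext \<phi> p - lin_ext \<phi> q"
  using lin_ext_add[of \<phi> "p - q" q] by simp

lemma lin_ext_single: "lin_ext \<phi> (Poly_Mapping.single x c) = c * \<phi> x"
  by (simp add: lin_ext_def)

lemma lin_ext_basis_vec: "lin_ext \<phi> (basis_vec x) = \<phi> x"
  by (simp add: basis_vec_def lin_ext_single)

lemma push_superset:
  assumes "finite A" "Poly_Mapping.keys p \<subseteq> A"
  shows "push m p = (\<Sum>x\<in>A. Poly_Mapping.single (m x) (Poly_Mapping.lookup p x))"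
  unfolding push_def by (rule sum.mono_neutral_left) (use assms in \<open>auto simp: in_keys_iff\<close>)

lemma push_zero [simp]: "push m 0 = 0"
  by (simp add: push_def)

lemma push_add: "push m (p + q) = push m p + push m q"
proof -
  let ?A = "Poly_Mapping.keys p \<union> Poly_Mapping.keys q"
  show ?thesis
    using keys_add[of p q]
    by (simp add: push_superset[of ?A] lookup_add single_add sum.distrib)
qed

lemma push_scale: "push m (scale c p) = scale c (push m p)"
  using keys_scale[of c p]
  by (simp add: push_superset[of "Poly_Mapping.keys p"] free.scale_sum_right scale_single)

lemma push_diff: "push m (p - q) = push m p - push m q"
  using push_add[of m "p - q" q] by simp

lemma push_basis_vec: "push m (basis_vec x) = basis_vec (m x)"
  by (simp add: push_def basis_vec_def)

lemma lin_ext_push: "lin_ext \<phi> (push m p) = lin_ext (\<phi> \<circ> m) p"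
proof -
  have "p \<in> free_space UNIV" by (simp add: free_space_def)
  then show ?thesis
    by (induction rule: free_space_induct)
      (simp_all add: push_add push_scale push_basis_vec lin_ext_add lin_ext_scale lin_ext_basis_vec)
qed

lemma push_free_space:
  assumes "p \<in> free_space S" "m ` S \<subseteq> T"
  shows "push m p \<in> free_space T"
  using assms(1)
  by (induction rule: free_space_induct)
    (use assms(2) in \<open>auto simp: push_add push_scale push_basis_vec
       intro!: free_space_add free_space_scale free_space_basis_vec\<close>)

lemma push_span:
  assumes "\<And>e. e \<in> E \<Longrightarrow> push m e \<in> free.span E'" "p \<in> free.span E"
  shows "push m p \<in> free.span E'"
  using assms(2)
  by (induction rule: free.span_induct_alt)
    (auto simp: push_add push_scale intro!: free.span_add free.span_scale free.span_zero assms(1))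


section \<open>Modules given by generators and relations\<close>

text \<open>These are the consequences of the module axioms on which arguments with spans and
  multilinear maps rest. Compatibility with the group multiplication is proved separately, on the
  vectors \<open>T g\<close>, in \<open>act_act_T\<close>.\<close>

definition linear_gmodule :: "'g set \<Rightarrow> ('f::field, 'g, 'v) gmodule \<Rightarrow> bool" where
  "linear_gmodule G V \<longleftrightarrow>
     \<zero>\<^bsub>V\<^esub> \<in> carrier V \<and> \<zero>\<^bsub>V\<^esub> \<oplus>\<^bsub>V\<^esub> \<zero>\<^bsub>V\<^esub> = \<zero>\<^bsub>V\<^esub> \<and> (\<forall>c. c \<odot>\<^bsub>V\<^esub> \<zero>\<^bsub>V\<^esub> = \<zero>\<^bsub>V\<^esub>) \<and>
     (\<forall>u\<in>carrier V. 0 \<odot>\<^bsub>V\<^esub> u = \<zero>\<^bsub>V\<^esub> \<and> 1 \<odot>\<^bsub>V\<^esub> u = u) \<and>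
     (\<forall>u\<in>carrier V. \<forall>v\<in>carrier V. u \<oplus>\<^bsub>V\<^esub> v \<in> carrier V) \<and>
     (\<forall>c. \<forall>u\<in>carrier V. c \<odot>\<^bsub>V\<^esub> u \<in> carrier V) \<and>
     (\<forall>g\<in>G. \<forall>u\<in>carrier V. act V g u \<in> carrier V) \<and>
     (\<forall>g\<in>G. \<forall>u\<in>carrier V. \<forall>v\<in>carrier V. act V g (u \<oplus>\<^bsub>V\<^esub> v) = act V g u \<oplus>\<^bsub>V\<^esub> act V g v) \<and>
     (\<forall>g\<in>G. \<forall>c. \<forall>u\<in>carrier V. act V g (c \<odot>\<^bsub>V\<^esub> u) = c \<odot>\<^bsub>V\<^esub> act V g u)"

definition linear_form :: "('f::field, 'g, 'v) gmodule \<Rightarrow> ('v \<Rightarrow> 'f) \<Rightarrow> bool" where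
  "linear_form V \<xi> \<longleftrightarrow>
     (\<forall>u\<in>carrier V. \<forall>v\<in>carrier V. \<xi> (u \<oplus>\<^bsub>V\<^esub> v) = \<xi> u + \<xi> v) \<and>
     (\<forall>c. \<forall>u\<in>carrier V. \<xi> (c \<odot>\<^bsub>V\<^esub> u) = c * \<xi> u)"

text \<open>Zero has no rule of its own and arises as a \<open>0\<close>-multiple of a member. Hence
  the span of the empty set is empty, and spanning results have to exhibit some generator.\<close>

inductive_set lspan :: "('f::field, 'g, 'v) gmodule \<Rightarrow> 'v set \<Rightarrow> 'v set" for V B where
  base: "b \<in> B \<Longrightarrow> b \<in> lspan V B"
| add: "u \<in> lspan V B \<Longrightarrow> v \<in> lspan V B \<Longrightarrow> u \<oplus>\<^bsub>V\<^esub> v \<in> lspan V B"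
| smult: "u \<in> lspan V B \<Longrightarrow> c \<odot>\<^bsub>V\<^esub> u \<in> lspan V B"

lemma lspan_subset:
  assumes "linear_gmodule G V" "B \<subseteq> carrier V"
  shows "lspan V B \<subseteq> carrier V"
proof
  fix u assume "u \<in> lspan V B"
  then show "u \<in> carrier V"
    by induction (use assms in \<open>auto simp: linear_gmodule_def\<close>)
qed

lemma linear_gmodule_act_zero:
  assumes "linear_gmodule G V" "g \<in> G"
  shows "act V g \<zero>\<^bsub>V\<^esub> = \<zero>\<^bsub>V\<^esub>"
  using assms unfolding linear_gmodule_def by metis

section \<open>Cosets of the span of the relators\<close>

lemma in_coset_span_iff: "x \<in> coset (free.span E) p \<longleftrightarrow> x - p \<in> free.span E"
proof
  assume "x - p \<in> free.span E"
  then show "x \<in> coset (free.span E) p"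
    unfolding coset_def by (intro image_eqI[of _ _ "x - p"]) simp_all
qed (auto simp: coset_def)

lemma self_in_coset_span: "p \<in> coset (free.span E) p"
  by (simp add: in_coset_span_iff free.span_zero)

lemma coset_span_eq_iff: "coset (free.span E) p = coset (free.span E) q \<longleftrightarrow> p - q \<in> free.span E"
proof
  assume *: "coset (free.span E) p = coset (free.span E) q"
  show "p - q \<in> free.span E" using self_in_coset_span[of p E] unfolding * in_coset_span_iff .
next
  have sub: "coset (free.span E) p \<subseteq> coset (free.span E) q" if "p - q \<in> free.span E" for p q :: "'a \<Rightarrow>\<^sub>0 'b"
  proof
    fix x assume "x \<in> coset (free.span E) p"
    then obtain k where k: "k \<in> free.span E" "x = p + k" by (auto simp: coset_def)
    then have "x = q + ((p - q) + k)" by simp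
    then show "x \<in> coset (free.span E) q" using free.span_add[OF that k(1)] unfolding coset_def by blast
  qed
  assume *: "p - q \<in> free.span E"
  moreover have "q - p \<in> free.span E" using free.span_neg[OF *] by simp
  ultimately show "coset (free.span E) p = coset (free.span E) q" using sub by blast
qed

text \<open>If \<open>h\<close> respects congruence modulo the span, all members of the union
  coincide. This collapses the unions over representatives in
  \<open>presented_gmodule\<close>.\<close>

lemma UN_coset_eq:
  assumes "\<And>x. x - p \<in> free.span E \<Longrightarrow> h x - h p \<in> free.span E"
  shows "(\<Union>x\<in>coset (free.span E) p. coset (free.span E) (h x)) = coset (free.span E) (h p)"
proof -
  have "coset (free.span E) (h x) = coset (free.span E) (h p)" if "x \<in> coset (free.span E) p" for x
    using assms[of x] that by (simp add: coset_span_eq_iff in_coset_span_iff)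
  then have "(\<Union>x\<in>coset (free.span E) p. coset (free.span E) (h x)) =
      (\<Union>x\<in>coset (free.span E) p. coset (free.span E) (h p))"
    by (intro SUP_cong refl)
  then show ?thesis using self_in_coset_span[of p E] by blast
qed

text \<open>\<open>act_S\<close> keeps the action inside the carrier and \<open>act_E\<close> makes
  it well defined on cosets; for the latter it is enough that relators go into the span of the
  relators.\<close>

locale presentation =
  fixes S :: "'x set" and E :: "('x \<Rightarrow>\<^sub>0 'f::field) set" and m :: "'g \<Rightarrow> 'x \<Rightarrow> 'x" and G :: "'g set"
  assumes act_S: "g \<in> G \<Longrightarrow> m g ` S \<subseteq> S"
    and act_E: "g \<in> G \<Longrightarrow> e \<in> E \<Longrightarrow> push (m g) e \<in> free.span E"
begin

abbreviation "V \<equiv> presented_gmodule S E m"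
abbreviation "cls \<equiv> coset (free.span E)"

lemma carrier_eq: "carrier V = cls ` free_space S"
  by (simp add: presented_gmodule_def Let_def)

lemma add_cls: "cls p \<oplus>\<^bsub>V\<^esub> cls q = cls (p + q)"
proof -
  have "cls p \<oplus>\<^bsub>V\<^esub> cls q = (\<Union>x\<in>cls p. \<Union>y\<in>cls q. cls (x + y))"
    by (simp add: presented_gmodule_def Let_def)
  also have "\<dots> = (\<Union>x\<in>cls p. cls (x + q))"
    by (subst UN_coset_eq) simp_all
  also have "\<dots> = cls (p + q)"
    by (rule UN_coset_eq) simp
  finally show ?thesis .
qed

lemma smult_cls: "c \<odot>\<^bsub>V\<^esub> cls p = cls (scale c p)"
proof -
  have "c \<odot>\<^bsub>V\<^esub> cls p = (\<Union>x\<in>cls p. cls (scale c x))"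
    by (simp add: presented_gmodule_def Let_def)
  also have "\<dots> = cls (scale c p)"
    by (rule UN_coset_eq) (simp flip: free.scale_right_diff_distrib add: free.span_scale)
  finally show ?thesis .
qed

lemma act_cls:
  assumes "g \<in> G"
  shows "act V g (cls p) = cls (push (m g) p)"
proof -
  have "act V g (cls p) = (\<Union>x\<in>cls p. cls (push (m g) x))"
    by (simp add: presented_gmodule_def Let_def)
  also have "\<dots> = cls (push (m g) p)"
  proof (rule UN_coset_eq)
    fix x assume "x - p \<in> free.span E"
    then have "push (m g) (x - p) \<in> free.span E"
      using push_span[of E "m g" E] act_E[OF assms] by blast
    then show "push (m g) x - push (m g) p \<in> free.span E" by (simp add: push_diff)
  qed
  finally show ?thesis .
qed

lemma zero_eq: "\<zero>\<^bsub>V\<^esub> = cls 0"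
  by (simp add: presented_gmodule_def Let_def coset_def)

lemma cls_cong: "p - q \<in> E \<Longrightarrow> cls p = cls q"
  by (simp add: coset_span_eq_iff free.span_base)

lemma linear_gmodule: "linear_gmodule G V"
  unfolding linear_gmodule_def carrier_eq
  by (auto simp: zero_eq add_cls smult_cls act_cls push_add push_scale
      intro!: imageI free_space_add free_space_scale push_free_space[OF _ act_S])

lemma carrier_subset_lspan:
  assumes "S \<noteq> {}" "\<And>x. x \<in> S \<Longrightarrow> cls (basis_vec x) \<in> lspan V B"
  shows "carrier V \<subseteq> lspan V B"
proof -
  have "cls p \<in> lspan V B" if "p \<in> free_space S" for p
    using that
  proof (induction rule: free_space_induct)
    case zero
    \<comment> \<open>\<open>lspan\<close> has no rule for zero, so some generator is needed in
      order to take its \<open>0\<close>-multiple.\<close>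
    obtain x where "x \<in> S" using assms(1) by blast
    from lspan.smult[OF assms(2)[OF this], of 0] show ?case by (simp add: smult_cls)
  next
    case (step p c x)
    from lspan.add[OF lspan.smult[OF assms(2)[OF \<open>x \<in> S\<close>]] \<open>cls p \<in> lspan V B\<close>]
    show ?case by (simp add: smult_cls add_cls)
  qed
  then show ?thesis by (auto simp: carrier_eq)
qed

text \<open>A linear form on the free space that kills the relators descends to the quotient. All
  linear forms used to detect vectors of presented modules are built in this way.\<close>

lemma ex_linear_form:
  assumes "\<And>e. e \<in> E \<Longrightarrow> lin_ext \<phi> e = 0"
  shows "\<exists>\<xi>. linear_form V \<xi> \<and> (\<forall>p. \<xi> (cls p) = lin_ext \<phi> p)"
proof -
  have van: "lin_ext \<phi> p = 0" if "p \<in> free.span E" for p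
    using that by (induction rule: free.span_induct_alt) (simp_all add: lin_ext_add lin_ext_scale assms)
  \<comment> \<open>Which representative is chosen does not matter: two of them differ by an element
    of the span, on which \<open>lin_ext \<phi>\<close> vanishes.\<close>
  define \<xi> where "\<xi> X = lin_ext \<phi> (SOME p. p \<in> X)" for X
  have \<xi>: "\<xi> (cls p) = lin_ext \<phi> p" for p
  proof -
    have "(SOME q. q \<in> cls p) \<in> cls p" by (rule someI[of _ p]) (rule self_in_coset_span)
    then have "lin_ext \<phi> ((SOME q. q \<in> cls p) - p) = 0" by (intro van) (simp add: in_coset_span_iff)
    then show ?thesis by (simp add: \<xi>_def lin_ext_diff)
  qed
  then have "linear_form V \<xi>"
    by (auto simp: linear_form_def carrier_eq add_cls smult_cls lin_ext_add lin_ext_scale)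
  with \<xi> show ?thesis by blast
qed

end


section \<open>Tensor products\<close>

definition pure_tensor ::
    "'i set \<Rightarrow> ('i \<Rightarrow> ('f::field, 'g, 'v) gmodule) \<Rightarrow> ('i \<Rightarrow> 'v) \<Rightarrow> (('i \<Rightarrow> 'v) \<Rightarrow>\<^sub>0 'f) set" where
  "pure_tensor I V u = coset (free.span (tensor_relators I V)) (basis_vec u)"

context
  fixes I :: "'i set" and V :: "'i \<Rightarrow> ('f::field, 'g, 'v) gmodule" and G :: "'g set"
  assumes fin: "finite I"
    and lin: "\<And>i. i \<in> I \<Longrightarrow> linear_gmodule G (V i)"
begin

text \<open>Acting on every factor commutes with changing one coordinate, so linearity of the action
  in that coordinate turns a relator into a relator of the same shape.\<close>

lemma tensor_presentation:
  "presentation (\<Pi>\<^sub>E i\<in>I. carrier (V i)) (tensor_relators I V)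
     (\<lambda>g u. \<lambda>i\<in>I. act (V i) g (u i)) G"
proof
  fix g assume g: "g \<in> G"
  let ?m = "\<lambda>g u. \<lambda>i\<in>I. act (V i) g (u i)"
  show S: "?m g ` (\<Pi>\<^sub>E i\<in>I. carrier (V i)) \<subseteq> (\<Pi>\<^sub>E i\<in>I. carrier (V i))"
    using lin g by (auto simp: linear_gmodule_def PiE_iff extensional_def)
  have upd: "?m g (u(i := v)) = (?m g u)(i := act (V i) g v)" if "i \<in> I" for u i v
    using that by (auto simp: fun_eq_iff)
  fix e assume "e \<in> tensor_relators I V"
  then consider u i v v' where
      "e = basis_vec (u(i := v \<oplus>\<^bsub>V i\<^esub> v')) - basis_vec (u(i := v)) - basis_vec (u(i := v'))"
      "u \<in> (\<Pi>\<^sub>E i\<in>I. carrier (V i))" "i \<in> I" "v \<in> carrier (V i)" "v' \<in> carrier (V i)"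
    | u i c v where
      "e = basis_vec (u(i := c \<odot>\<^bsub>V i\<^esub> v)) - scale c (basis_vec (u(i := v)))"
      "u \<in> (\<Pi>\<^sub>E i\<in>I. carrier (V i))" "i \<in> I" "v \<in> carrier (V i)"
    unfolding tensor_relators_def by blast
  then have "push (?m g) e \<in> tensor_relators I V"
  proof cases
    case 1
    have a: "act (V i) g v \<in> carrier (V i)" "act (V i) g v' \<in> carrier (V i)"
        "act (V i) g (v \<oplus>\<^bsub>V i\<^esub> v') = act (V i) g v \<oplus>\<^bsub>V i\<^esub> act (V i) g v'"
      using lin[OF 1(3)] g 1(4,5) by (auto simp: linear_gmodule_def)
    have "push (?m g) e = basis_vec ((?m g u)(i := act (V i) g v \<oplus>\<^bsub>V i\<^esub> act (V i) g v')) -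
        basis_vec ((?m g u)(i := act (V i) g v)) - basis_vec ((?m g u)(i := act (V i) g v'))"
      unfolding 1(1) push_diff push_basis_vec upd[OF 1(3)] a(3) ..
    moreover have "?m g u \<in> (\<Pi>\<^sub>E i\<in>I. carrier (V i))" using S 1(2) by blast
    ultimately show ?thesis
      unfolding tensor_relators_def using a 1(3) by blast
  next
    case 2
    have a: "act (V i) g v \<in> carrier (V i)" "act (V i) g (c \<odot>\<^bsub>V i\<^esub> v) = c \<odot>\<^bsub>V i\<^esub> act (V i) g v"
      using lin[OF 2(3)] g 2(4) by (auto simp: linear_gmodule_def)
    have "push (?m g) e = basis_vec ((?m g u)(i := c \<odot>\<^bsub>V i\<^esub> act (V i) g v)) -
        scale c (basis_vec ((?m g u)(i := act (V i) g v)))"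
      unfolding 2(1) push_diff push_scale push_basis_vec upd[OF 2(3)] a(2) ..
    moreover have "?m g u \<in> (\<Pi>\<^sub>E i\<in>I. carrier (V i))" using S 2(2) by blast
    ultimately show ?thesis
      unfolding tensor_relators_def using a 2(3) by blast
  qed
  then show "push (?m g) e \<in> free.span (tensor_relators I V)" by (rule free.span_base)
qed

interpretation T: presentation "\<Pi>\<^sub>E i\<in>I. carrier (V i)" "tensor_relators I V"
  "\<lambda>g u. \<lambda>i\<in>I. act (V i) g (u i)" G
  by (rule tensor_presentation)

lemma tensor_eq: "tensor I V = T.V"
  by (simp add: tensor_def)

lemma linear_gmodule_tensor: "linear_gmodule G (tensor I V)"
  unfolding tensor_eq by (rule T.linear_gmodule)

lemma pure_tensor_carrier: "u \<in> (\<Pi>\<^sub>E i\<in>I. carrier (V i)) \<Longrightarrow> pure_tensor I V u \<in> carrier (tensor I V)"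
  unfolding tensor_eq T.carrier_eq pure_tensor_def by (intro imageI free_space_basis_vec)

lemma act_pure_tensor:
  "g \<in> G \<Longrightarrow> act (tensor I V) g (pure_tensor I V u) = pure_tensor I V (\<lambda>i\<in>I. act (V i) g (u i))"
  unfolding tensor_eq pure_tensor_def by (simp add: T.act_cls push_basis_vec)

lemma pure_tensor_add:
  assumes "u \<in> (\<Pi>\<^sub>E i\<in>I. carrier (V i))" "i \<in> I" "v \<in> carrier (V i)" "v' \<in> carrier (V i)"
  shows "pure_tensor I V (u(i := v \<oplus>\<^bsub>V i\<^esub> v')) =
    pure_tensor I V (u(i := v)) \<oplus>\<^bsub>tensor I V\<^esub> pure_tensor I V (u(i := v'))"
  unfolding tensor_eq pure_tensor_def T.add_cls
  by (rule T.cls_cong) (use assms in \<open>auto simp: tensor_relators_def diff_diff_eq2 diff_diff_add\<close>)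

lemma pure_tensor_smult:
  assumes "u \<in> (\<Pi>\<^sub>E i\<in>I. carrier (V i))" "i \<in> I" "v \<in> carrier (V i)"
  shows "pure_tensor I V (u(i := c \<odot>\<^bsub>V i\<^esub> v)) = c \<odot>\<^bsub>tensor I V\<^esub> pure_tensor I V (u(i := v))"
  unfolding tensor_eq pure_tensor_def T.smult_cls
  by (rule T.cls_cong) (use assms in \<open>auto simp: tensor_relators_def\<close>)

lemma pure_tensor_smult_all:
  assumes "u \<in> (\<Pi>\<^sub>E i\<in>I. carrier (V i))"
  shows "pure_tensor I V (\<lambda>i\<in>I. c i \<odot>\<^bsub>V i\<^esub> u i) = (\<Prod>i\<in>I. c i) \<odot>\<^bsub>tensor I V\<^esub> pure_tensor I V u"
proof -
  \<comment> \<open>For the induction only the coordinates in a subset \<open>J\<close> are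
    scaled.\<close>
  have "pure_tensor I V (\<lambda>i\<in>I. if i \<in> J then c i \<odot>\<^bsub>V i\<^esub> u i else u i) =
      (\<Prod>i\<in>J. c i) \<odot>\<^bsub>tensor I V\<^esub> pure_tensor I V u" if "J \<subseteq> I" for J
    using finite_subset[OF that fin] that
  proof (induction J rule: finite_induct)
    case empty
    have "(\<lambda>i\<in>I. u i) = u" using assms by (simp add: PiE_restrict)
    then show ?case
      using linear_gmodule_tensor pure_tensor_carrier[OF assms] by (simp add: linear_gmodule_def)
  next
    case (insert j J)
    define w where "w = (\<lambda>i\<in>I. if i \<in> J then c i \<odot>\<^bsub>V i\<^esub> u i else u i)"
    have w: "w \<in> (\<Pi>\<^sub>E i\<in>I. carrier (V i))"
      using assms lin by (auto simp: w_def linear_gmodule_def PiE_iff)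
    have j: "j \<in> I" using insert.prems by blast
    have "(\<lambda>i\<in>I. if i \<in> insert j J then c i \<odot>\<^bsub>V i\<^esub> u i else u i) = w(j := c j \<odot>\<^bsub>V j\<^esub> u j)"
      using j by (auto simp: w_def fun_eq_iff)
    moreover have "w(j := u j) = w" using insert.hyps j by (auto simp: w_def fun_eq_iff)
    ultimately have "pure_tensor I V (\<lambda>i\<in>I. if i \<in> insert j J then c i \<odot>\<^bsub>V i\<^esub> u i else u i) =
        c j \<odot>\<^bsub>tensor I V\<^esub> pure_tensor I V w"
      using pure_tensor_smult[OF w j, of "u j" "c j"] assms j by (auto simp: PiE_iff)
    also have "pure_tensor I V w = (\<Prod>i\<in>J. c i) \<odot>\<^bsub>tensor I V\<^esub> pure_tensor I V u"
      unfolding w_def using insert.IH insert.prems by blast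
    finally show ?case
      using insert.hyps unfolding tensor_eq pure_tensor_def by (simp add: T.smult_cls)
  qed
  from this[of I] show ?thesis by (simp cong: restrict_cong)
qed

text \<open>Coordinates are expanded one at a time: in the claim below, \<open>J\<close> is the set
  of coordinates that may still be arbitrary vectors, while the others already lie in
  \<open>B i\<close>.\<close>

lemma tensor_lspan:
  assumes B: "\<And>i. i \<in> I \<Longrightarrow> carrier (V i) \<subseteq> lspan (V i) (B i)"
    and Bc: "\<And>i. i \<in> I \<Longrightarrow> B i \<subseteq> carrier (V i)"
  shows "carrier (tensor I V) \<subseteq> lspan (tensor I V) (pure_tensor I V ` (\<Pi>\<^sub>E i\<in>I. B i))"
    (is "_ \<subseteq> ?X")
proof -
  have claim: "pure_tensor I V u \<in> ?X"
    if "J \<subseteq> I" "u \<in> (\<Pi>\<^sub>E i\<in>I. carrier (V i))" "\<And>i. i \<in> I - J \<Longrightarrow> u i \<in> B i" for J u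
    using finite_subset[OF that(1) fin] that
  proof (induction J arbitrary: u rule: finite_induct)
    case empty
    then show ?case by (intro lspan.base imageI) (auto simp: PiE_iff)
  next
    case (insert j J)
    have j: "j \<in> I" using insert.prems by blast
    \<comment> \<open>Linearity in coordinate \<open>j\<close> passes from \<open>B j\<close> to its
      span. Membership in the carrier is carried along because the multilinear relations are
      available only there.\<close>
    have "v \<in> carrier (V j) \<and> pure_tensor I V (u(j := v)) \<in> ?X" if "v \<in> lspan (V j) (B j)" for v
      using that
    proof induction
      case (base b)
      then have "b \<in> carrier (V j)" using Bc j by blast
      moreover have "pure_tensor I V (u(j := b)) \<in> ?X"
        by (rule insert.IH) (use insert.prems j \<open>b \<in> carrier (V j)\<close> base in \<open>auto simp: PiE_iff extensional_def\<close>)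
      ultimately show ?case by (rule conjI)
    next
      case (add v v')
      then show ?case
        using pure_tensor_add[OF insert.prems(2) j, of v v'] lin[OF j]
        by (auto simp: linear_gmodule_def intro: lspan.add simp del: fun_upd_apply)
    next
      case (smult v c)
      then show ?case
        using pure_tensor_smult[OF insert.prems(2) j, of v c] lin[OF j]
        by (auto simp: linear_gmodule_def intro: lspan.smult simp del: fun_upd_apply)
    qed
    from this[of "u j"] show ?case using insert.prems(2) B[OF j] j by (auto simp: PiE_iff)
  qed
  \<comment> \<open>The family of zero vectors is the generator whose existence
    \<open>T.carrier_subset_lspan\<close> demands.\<close>
  have "(\<lambda>i\<in>I. \<zero>\<^bsub>V i\<^esub>) \<in> (\<Pi>\<^sub>E i\<in>I. carrier (V i))"
    using lin by (auto simp: linear_gmodule_def)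
  then show ?thesis
    unfolding tensor_eq
    using claim[of I]
    by (intro T.carrier_subset_lspan) (blast, auto simp: pure_tensor_def tensor_eq)
qed

text \<open>A product of linear forms, one in each coordinate, is multilinear and therefore kills
  the relators. Splitting off the factor of one coordinate, as in \<open>upd\<close>, makes this
  visible.\<close>

lemma tensor_linear_form:
  assumes \<xi>: "\<And>i. i \<in> I \<Longrightarrow> linear_form (V i) (\<xi> i)"
  shows "\<exists>\<Xi>. linear_form (tensor I V) \<Xi> \<and> (\<forall>u. \<Xi> (pure_tensor I V u) = (\<Prod>i\<in>I. \<xi> i (u i)))"
proof -
  have upd: "(\<Prod>j\<in>I. \<xi> j ((u(i := v)) j)) = \<xi> i v * (\<Prod>j\<in>I - {i}. \<xi> j (u j))" if "i \<in> I" for u i v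
  proof -
    have "(\<Prod>j\<in>I - {i}. \<xi> j ((u(i := v)) j)) = (\<Prod>j\<in>I - {i}. \<xi> j (u j))"
      by (rule prod.cong) auto
    then show ?thesis by (simp add: prod.remove[OF fin that])
  qed
  have \<xi>': "\<xi> i (v \<oplus>\<^bsub>V i\<^esub> v') = \<xi> i v + \<xi> i v'" "\<xi> i (c \<odot>\<^bsub>V i\<^esub> v) = c * \<xi> i v"
    if "i \<in> I" "v \<in> carrier (V i)" "v' \<in> carrier (V i)" for i v v' c
    using \<xi>[OF that(1)] that(2,3) by (auto simp: linear_form_def)
  have "lin_ext (\<lambda>u. \<Prod>i\<in>I. \<xi> i (u i)) e = 0" if "e \<in> tensor_relators I V" for e
    using that unfolding tensor_relators_def
    by (elim UnE CollectE exE conjE; hypsubst)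
      (simp_all add: lin_ext_diff lin_ext_scale lin_ext_basis_vec upd \<xi>' distrib_right
        del: fun_upd_apply)
  from T.ex_linear_form[OF this] obtain \<Xi> where
    "linear_form T.V \<Xi>" "\<And>p. \<Xi> (T.cls p) = lin_ext (\<lambda>u. \<Prod>i\<in>I. \<xi> i (u i)) p"
    by blast
  then show ?thesis
    unfolding tensor_eq pure_tensor_def by (intro exI[of _ \<Xi>]) (simp add: lin_ext_basis_vec)
qed

end


section \<open>Modules induced from a linear character\<close>

lemma group_algebra_eq: "group_algebra H = free_space H"
  by (simp add: group_algebra_def free_space_def)

lemma push_push: "push m (push n p) = push (m \<circ> n) p"
proof -
  have "p \<in> free_space UNIV" by (simp add: free_space_def)
  then show ?thesis
    by (induction rule: free_space_induct) (simp_all add: push_add push_scale push_basis_vec)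
qed

lemma push_cong: "(\<And>x. x \<in> Poly_Mapping.keys p \<Longrightarrow> m x = n x) \<Longrightarrow> push m p = push n p"
  by (simp add: push_def)

text \<open>Written as a combination of left translates of \<open>b\<close>, the convolution is
  visibly linear in \<open>a\<close>.\<close>

lemma conv_eq:
  "conv G a b = (\<Sum>x\<in>Poly_Mapping.keys a. scale (Poly_Mapping.lookup a x) (push (mult G x) b))"
  unfolding conv_def push_def free.scale_sum_right by (simp add: scale_single)

lemma conv_superset:
  assumes "finite A" "Poly_Mapping.keys a \<subseteq> A"
  shows "conv G a b = (\<Sum>x\<in>A. scale (Poly_Mapping.lookup a x) (push (mult G x) b))"
  unfolding conv_eq by (rule sum.mono_neutral_left) (use assms in \<open>auto simp: in_keys_iff\<close>)

lemma conv_zero_left [simp]: "conv G 0 b = 0"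
  by (simp add: conv_eq)

lemma conv_add_left: "conv G (a + a') b = conv G a b + conv G a' b"
proof -
  let ?A = "Poly_Mapping.keys a \<union> Poly_Mapping.keys a'"
  show ?thesis
    using keys_add[of a a']
    by (simp add: conv_superset[of ?A] lookup_add free.scale_left_distrib sum.distrib)
qed

lemma conv_scale_left: "conv G (scale c a) b = scale c (conv G a b)"
  using keys_scale[of c a]
  by (simp add: conv_superset[of "Poly_Mapping.keys a"] free.scale_sum_right)

lemma conv_basis_left: "conv G (basis_vec g) b = push (mult G g) b"
  by (simp add: conv_eq basis_vec_def)

lemma finsum_one_dim:
  assumes "finite A"
  shows "(\<Oplus>\<^bsub>one_dim_gmodule \<chi>\<^esub>h\<in>A. u h) = (\<Sum>h\<in>A. u h)"
proof -
  interpret abelian_monoid "one_dim_gmodule \<chi>"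
    by (rule abelian_monoidI) (simp_all add: one_dim_gmodule_def ac_simps)
  show ?thesis
    using assms
  proof (induction rule: finite_induct)
    case empty
    show ?case unfolding finsum_empty by (simp add: one_dim_gmodule_def)
  next
    case (insert x A)
    have "u \<in> B \<rightarrow> carrier (one_dim_gmodule \<chi>)" for B by (simp add: one_dim_gmodule_def)
    note finsum_insert[OF insert.hyps(1,2) this[of A]]
    moreover have "u x \<in> carrier (one_dim_gmodule \<chi>)" by (simp add: one_dim_gmodule_def)
    moreover have "a \<oplus>\<^bsub>one_dim_gmodule \<chi>\<^esub> b = a + b" for a b by (simp add: one_dim_gmodule_def)
    ultimately show ?case using insert by simp
  qed
qed

lemma algebra_act_one_dim: "algebra_act (one_dim_gmodule \<chi>) b w = lin_ext \<chi> b * w"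
  unfolding algebra_act_def finsum_one_dim[OF finite_keys]
  by (simp add: one_dim_gmodule_def lin_ext_def sum_distrib_right mult.assoc)

locale char_induction = group G for G :: "'g monoid" (structure) +
  fixes H :: "'g set" and \<chi> :: "'g \<Rightarrow> 'f::field"
  assumes H: "subgroup H G"
    and char_mult: "h \<in> H \<Longrightarrow> h' \<in> H \<Longrightarrow> \<chi> (h \<otimes> h') = \<chi> h * \<chi> h'"
    and char_nonzero: "h \<in> H \<Longrightarrow> \<chi> h \<noteq> 0"
begin

abbreviation "W \<equiv> one_dim_gmodule \<chi>"

lemma char_one: "\<chi> \<one> = 1"
  using char_mult[of \<one> \<one>] char_nonzero[of \<one>] subgroup.one_closed[OF H] by simp

lemma push_mult_in: "g \<in> carrier G \<Longrightarrow> a \<in> group_algebra (carrier G) \<Longrightarrow>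
    push (mult G g) a \<in> group_algebra (carrier G)"
  unfolding group_algebra_eq by (erule push_free_space) auto

lemma push_mult_conv:
  assumes "g \<in> carrier G" "a \<in> group_algebra (carrier G)" "b \<in> group_algebra H"
  shows "push (mult G g) (conv G a b) = conv G (push (mult G g) a) b"
  using assms(2) unfolding group_algebra_eq
proof (induction rule: free_space_induct)
  case (step a c x)
  have "push (mult G g) (push (mult G x) b) = push (mult G (g \<otimes> x)) b"
    unfolding push_push
    by (rule push_cong)
      (use assms(1,3) step.hyps subgroup.mem_carrier[OF H] in \<open>auto simp: group_algebra_def m_assoc\<close>)
  with step.IH show ?case
    by (simp add: push_add push_scale conv_add_left conv_scale_left conv_basis_left push_basis_vec)
qed simp

text \<open>Left translation is linear and, by associativity, commutes with convolution from the
  right by the group algebra of \<open>H\<close>. So each of the four families of relators is mapped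
  into itself.\<close>

lemma induced_presentation:
  "presentation (group_algebra (carrier G) \<times> carrier W) (induced_relators G H W)
     (\<lambda>g (a, w). (conv G (basis_vec g) a, w)) (carrier G)"
proof
  fix g assume g: "g \<in> carrier G"
  let ?m = "\<lambda>(a :: 'g \<Rightarrow>\<^sub>0 'f, w :: 'f). (push (mult G g) a, w)"
  have m: "(\<lambda>(a, w). (conv G (basis_vec g) a, w)) = ?m"
    by (simp add: conv_basis_left)
  show "(\<lambda>(a, w). (conv G (basis_vec g) a, w)) ` (group_algebra (carrier G) \<times> carrier W)
      \<subseteq> group_algebra (carrier G) \<times> carrier W"
    using push_mult_in[OF g] by (auto simp: image_subset_iff conv_basis_left)
  fix e assume "e \<in> induced_relators G H W"
  then have "push ?m e \<in> induced_relators G H W"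
    unfolding induced_relators_def
  proof (elim UnE, goal_cases)
    case 1
    then obtain a a' w where "e = basis_vec (a + a', w) - basis_vec (a, w) - basis_vec (a', w)"
      "a \<in> group_algebra (carrier G)" "a' \<in> group_algebra (carrier G)" "w \<in> carrier W" by blast
    then have "push ?m e = basis_vec (push (mult G g) a + push (mult G g) a', w) -
        basis_vec (push (mult G g) a, w) - basis_vec (push (mult G g) a', w)"
      "push (mult G g) a \<in> group_algebra (carrier G)" "push (mult G g) a' \<in> group_algebra (carrier G)"
      "w \<in> carrier W"
      using push_mult_in[OF g] by (auto simp: push_diff push_basis_vec push_add)
    then show ?case by blast
  next
    case 2
    then obtain a w w' where "e = basis_vec (a, w \<oplus>\<^bsub>W\<^esub> w') - basis_vec (a, w) - basis_vec (a, w')"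
      "a \<in> group_algebra (carrier G)" "w \<in> carrier W" "w' \<in> carrier W" by blast
    then have "push ?m e = basis_vec (push (mult G g) a, w \<oplus>\<^bsub>W\<^esub> w') -
        basis_vec (push (mult G g) a, w) - basis_vec (push (mult G g) a, w')"
      "push (mult G g) a \<in> group_algebra (carrier G)" "w \<in> carrier W" "w' \<in> carrier W"
      using push_mult_in[OF g] by (auto simp: push_diff push_basis_vec)
    then show ?case by blast
  next
    case 3
    then obtain c a w where "e = basis_vec (scale c a, w) - scale c (basis_vec (a, w))"
      "a \<in> group_algebra (carrier G)" "w \<in> carrier W" by blast
    then have "push ?m e = basis_vec (scale c (push (mult G g) a), w) -
        scale c (basis_vec (push (mult G g) a, w))"
      "push (mult G g) a \<in> group_algebra (carrier G)" "w \<in> carrier W"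
      using push_mult_in[OF g] by (auto simp: push_diff push_basis_vec push_scale)
    then show ?case by blast
  next
    case 4
    then obtain a b w where "e = basis_vec (conv G a b, w) - basis_vec (a, algebra_act W b w)"
      and b: "a \<in> group_algebra (carrier G)" "b \<in> group_algebra H" "w \<in> carrier W" by blast
    then have "push ?m e = basis_vec (conv G (push (mult G g) a) b, w) -
        basis_vec (push (mult G g) a, algebra_act W b w)"
      "push (mult G g) a \<in> group_algebra (carrier G)"
      using push_mult_in[OF g] by (auto simp: push_diff push_basis_vec push_mult_conv[OF g])
    with b show ?case by blast
  qed
  then show "push (\<lambda>(a, w). (conv G (basis_vec g) a, w)) e \<in> free.span (induced_relators G H W)"
    unfolding m by (rule free.span_base)
qed

sublocale ind: presentation "group_algebra (carrier G) \<times> carrier W" "induced_relators G H W"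
  "\<lambda>g (a, w). (conv G (basis_vec g) a, w)" "carrier G"
  by (rule induced_presentation)

lemma induced_eq: "induced G H W = ind.V"
  by (simp add: induced_def)

lemma linear_gmodule_induced: "linear_gmodule (carrier G) (induced G H W)"
  unfolding induced_eq by (rule ind.linear_gmodule)

text \<open>The tensor of \<open>g\<close> with the basis vector \<open>1\<close> of the
  one-dimensional module.\<close>

definition gen :: "'g \<Rightarrow> ((('g \<Rightarrow>\<^sub>0 'f) \<times> 'f) \<Rightarrow>\<^sub>0 'f) set" where
  "gen g = ind.cls (basis_vec (basis_vec g, 1))"

lemma carrier_W: "carrier W = UNIV"
  by (simp add: one_dim_gmodule_def)

lemma basis_vec_group_algebra: "g \<in> K \<Longrightarrow> (basis_vec g :: _ \<Rightarrow>\<^sub>0 'f) \<in> group_algebra K"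
  unfolding group_algebra_eq by (rule free_space_basis_vec)

lemma gen_carrier: "g \<in> carrier G \<Longrightarrow> gen g \<in> carrier (induced G H W)"
  unfolding induced_eq ind.carrier_eq gen_def
  by (intro imageI free_space_basis_vec) (simp add: basis_vec_group_algebra carrier_W)

lemma act_gen: "g \<in> carrier G \<Longrightarrow> act (induced G H W) g (gen x) = gen (g \<otimes> x)"
  unfolding induced_eq gen_def ind.act_cls push_basis_vec by (simp add: conv_basis_left push_basis_vec)

lemma cls_conv:
  "a \<in> group_algebra (carrier G) \<Longrightarrow> b \<in> group_algebra H \<Longrightarrow>
    ind.cls (basis_vec (conv G a b, w)) = ind.cls (basis_vec (a, lin_ext \<chi> b * w))"
  unfolding algebra_act_one_dim[symmetric]
  by (rule ind.cls_cong) (unfold induced_relators_def carrier_W, blast)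

lemma cls_scale:
  "a \<in> group_algebra (carrier G) \<Longrightarrow>
    ind.cls (basis_vec (scale c a, w)) = ind.cls (scale c (basis_vec (a, w)))"
  by (rule ind.cls_cong) (unfold induced_relators_def carrier_W, blast)

lemma cls_add:
  "a \<in> group_algebra (carrier G) \<Longrightarrow> a' \<in> group_algebra (carrier G) \<Longrightarrow>
    ind.cls (basis_vec (a + a', w)) = ind.cls (basis_vec (a, w) + basis_vec (a', w))"
  by (rule ind.cls_cong) (unfold induced_relators_def carrier_W diff_diff_add[symmetric], blast)

lemma cls_basis:
  assumes "g \<in> carrier G"
  shows "ind.cls (basis_vec (basis_vec g, w)) = w \<odot>\<^bsub>induced G H W\<^esub> gen g"
proof -
  have g: "(basis_vec g :: _ \<Rightarrow>\<^sub>0 'f) \<in> group_algebra (carrier G)"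
    by (rule basis_vec_group_algebra[OF assms])
  \<comment> \<open>The relators state homogeneity in the first argument only. To leave the second
    argument, \<open>w\<close> is moved across the tensor as the element \<open>w\<close> times
    \<open>\<one>\<close> of the group algebra of \<open>H\<close>.\<close>
  have "scale w (basis_vec \<one>) \<in> group_algebra H"
    using subgroup.one_closed[OF H] unfolding group_algebra_eq
    by (intro free_space_scale free_space_basis_vec)
  from cls_conv[OF g this, of 1]
  have "ind.cls (basis_vec (basis_vec g, w)) = ind.cls (basis_vec (scale w (basis_vec g), 1))"
    using assms
    by (simp add: conv_basis_left push_scale push_basis_vec lin_ext_scale lin_ext_basis_vec char_one)
  then show ?thesis
    unfolding induced_eq gen_def ind.smult_cls using cls_scale[OF g] by simp
qed

lemma gen_mult:
  assumes "g \<in> carrier G" "h \<in> H"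
  shows "gen (g \<otimes> h) = \<chi> h \<odot>\<^bsub>induced G H W\<^esub> gen g"
proof -
  have "gen (g \<otimes> h) = ind.cls (basis_vec (conv G (basis_vec g) (basis_vec h), 1))"
    by (simp add: gen_def conv_basis_left push_basis_vec)
  also have "\<dots> = ind.cls (basis_vec (basis_vec g, lin_ext \<chi> (basis_vec h) * 1))"
    using assms by (intro cls_conv basis_vec_group_algebra)
  finally show ?thesis using assms by (simp add: lin_ext_basis_vec cls_basis)
qed

lemma induced_lspan: "carrier (induced G H W) \<subseteq> lspan (induced G H W) (gen ` carrier G)"
proof -
  let ?X = "lspan ind.V (gen ` carrier G)"
  have gen: "w \<odot>\<^bsub>ind.V\<^esub> gen g \<in> ?X" if "g \<in> carrier G" for g w
    using that by (intro lspan.smult lspan.base imageI)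
  have "ind.cls (basis_vec (a, w)) \<in> ?X" if "a \<in> group_algebra (carrier G)" for a w
    using that[unfolded group_algebra_eq]
  proof (induction rule: free_space_induct)
    case zero
    \<comment> \<open>The symbol \<open>(0, w)\<close> is a \<open>0\<close>-multiple by homogeneity
      in the first argument, hence it is also \<open>0\<close> times a generator.\<close>
    have "(0 :: _ \<Rightarrow>\<^sub>0 'f) \<in> group_algebra (carrier G)" by (simp add: group_algebra_eq)
    from cls_scale[OF this, of 0 w] have "ind.cls (basis_vec (0, w)) = 0 \<odot>\<^bsub>ind.V\<^esub> gen \<one>"
      by (simp add: gen_def ind.smult_cls)
    then show ?case using gen[of \<one>] by simp
  next
    case (step a c x)
    have "(basis_vec x :: _ \<Rightarrow>\<^sub>0 'f) \<in> group_algebra (carrier G)"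
      "scale c (basis_vec x) \<in> group_algebra (carrier G)" "a \<in> group_algebra (carrier G)"
      using step.hyps unfolding group_algebra_eq by (auto intro: free_space_scale free_space_basis_vec)
    then have "ind.cls (basis_vec (scale c (basis_vec x) + a, w)) =
        c \<odot>\<^bsub>ind.V\<^esub> ind.cls (basis_vec (basis_vec x, w)) \<oplus>\<^bsub>ind.V\<^esub> ind.cls (basis_vec (a, w))"
      by (simp add: cls_add cls_scale ind.smult_cls flip: ind.add_cls)
    moreover have "ind.cls (basis_vec (basis_vec x, w)) \<in> ?X"
      using step.hyps gen cls_basis by (simp add: induced_eq)
    ultimately show ?case using step.IH by (metis lspan.add lspan.smult)
  qed
  moreover have "group_algebra (carrier G) \<times> carrier W \<noteq> {}"
    using free_space_zero[of "carrier G"] by (auto simp: group_algebra_eq carrier_W simp del: free_space_zero)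
  ultimately show ?thesis unfolding induced_eq by (intro ind.carrier_subset_lspan) auto
qed

text \<open>The hypothesis says that the linear extension of \<phi> turns right convolution by the
  group algebra of \<open>H\<close> into multiplication by \<chi>. Hence sending
  \<open>(a, w)\<close> to \<phi>(a) w respects the balancing relators, and the other relators hold
  by bilinearity.\<close>

lemma induced_linear_form:
  assumes \<phi>: "\<And>g h. g \<in> carrier G \<Longrightarrow> h \<in> H \<Longrightarrow> \<phi> (g \<otimes> h) = \<phi> g * \<chi> h"
  shows "\<exists>\<xi>. linear_form (induced G H W) \<xi> \<and> (\<forall>g. \<xi> (gen g) = \<phi> g)"
proof -
  have push: "lin_ext \<phi> (push (mult G g) b) = \<phi> g * lin_ext \<chi> b"
    if "g \<in> carrier G" "b \<in> group_algebra H" for g b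
    unfolding lin_ext_push unfolding lin_ext_def sum_distrib_left
    by (rule sum.cong) (use that \<phi> in \<open>auto simp: group_algebra_def\<close>)
  have conv: "lin_ext \<phi> (conv G a b) = lin_ext \<phi> a * lin_ext \<chi> b"
    if "a \<in> group_algebra (carrier G)" "b \<in> group_algebra H" for a b
    using that(1) unfolding group_algebra_eq
    by (induction rule: free_space_induct)
      (simp_all add: conv_add_left conv_scale_left conv_basis_left push[OF _ that(2)]
        lin_ext_add lin_ext_scale lin_ext_basis_vec algebra_simps)
  have "lin_ext (\<lambda>(a, w). lin_ext \<phi> a * w) e = 0" if "e \<in> induced_relators G H W" for e
    using that unfolding induced_relators_def algebra_act_one_dim
    by (elim UnE CollectE exE conjE; hypsubst)
      (simp_all add: lin_ext_diff lin_ext_scale lin_ext_basis_vec lin_ext_add conv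
        one_dim_gmodule_def algebra_simps)
  from ind.ex_linear_form[OF this] obtain \<xi> where
    "linear_form ind.V \<xi>" "\<And>p. \<xi> (ind.cls p) = lin_ext (\<lambda>(a, w). lin_ext \<phi> a * w) p"
    by blast
  then show ?thesis
    unfolding induced_eq gen_def by (intro exI[of _ \<xi>]) (simp add: lin_ext_basis_vec)
qed

end


section \<open>The McLain group\<close>

text \<open>The groups \<open>L\<close>, \<open>P\<close> and \<open>N\<close> of an elementary
  module will all be identified with sets of this form, for transitive \<open>A\<close> inside
  \<open>Phi\<close>.\<close>

definition supported :: "'k set \<Rightarrow> ('k \<Rightarrow>\<^sub>0 'r::zero) set" where
  "supported A = {x. Poly_Mapping.keys x \<subseteq> A}"

lemma in_supported_iff: "x \<in> supported A \<longleftrightarrow> (\<forall>k. k \<notin> A \<longrightarrow> Poly_Mapping.lookup x k = 0)"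
  by (auto simp: supported_def in_keys_iff)

lemma supported_lookup: "x \<in> supported A \<Longrightarrow> k \<notin> A \<Longrightarrow> Poly_Mapping.lookup x k = 0"
  by (simp add: in_supported_iff)

lemma supported_mono: "x \<in> supported A \<Longrightarrow> A \<subseteq> B \<Longrightarrow> x \<in> supported B"
  by (auto simp: supported_def)

lemma zero_supported [simp]: "0 \<in> supported A"
  by (simp add: supported_def)

lemma single_supported: "k \<in> A \<Longrightarrow> Poly_Mapping.single k r \<in> supported A"
  by (simp add: supported_def)

lemma supported_add: "x \<in> supported A \<Longrightarrow> y \<in> supported A \<Longrightarrow> x + y \<in> supported A"
  by (simp add: in_supported_iff lookup_add)

lemma supported_uminus:
  fixes x :: "'k \<Rightarrow>\<^sub>0 'r::ring_1"
  shows "x \<in> supported A \<Longrightarrow> - x \<in> supported A"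
  by (simp add: in_supported_iff)

lemma McLain_J_eq: "McLain_J = supported Phi"
  by (simp add: McLain_J_def supported_def)

text \<open>The matrix product formula. The freedom in choosing \<open>B\<close> allows several
  products to be compared over one index set.\<close>

lemma lookup_J_mult:
  assumes "finite B" "\<And>b. b \<notin> B \<Longrightarrow> Poly_Mapping.lookup x (a, b) = 0"
  shows "Poly_Mapping.lookup (J_mult x y) (a, d) =
    (\<Sum>b\<in>B. Poly_Mapping.lookup x (a, b) * Poly_Mapping.lookup y (b, d))"
proof -
  \<comment> \<open>Against a fixed entry of \<open>x\<close> in column \<beta>, only the entry of
    \<open>y\<close> at \<open>(\<beta>, d)\<close> contributes to column \<open>d\<close>.\<close>
  have inner: "Poly_Mapping.lookup (\<Sum>(\<gamma>, \<delta>)\<in>Poly_Mapping.keys y. if \<beta> = \<gamma>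
      then Poly_Mapping.single (\<alpha>, \<delta>) (Poly_Mapping.lookup x (\<alpha>, \<beta>) * Poly_Mapping.lookup y (\<gamma>, \<delta>))
      else 0) (a, d) =
    (if \<alpha> = a then Poly_Mapping.lookup x (a, \<beta>) * Poly_Mapping.lookup y (\<beta>, d) else 0)" for \<alpha> \<beta>
  proof -
    have "Poly_Mapping.lookup (\<Sum>(\<gamma>, \<delta>)\<in>Poly_Mapping.keys y. if \<beta> = \<gamma>
      then Poly_Mapping.single (\<alpha>, \<delta>) (Poly_Mapping.lookup x (\<alpha>, \<beta>) * Poly_Mapping.lookup y (\<gamma>, \<delta>))
      else 0) (a, d) = (\<Sum>k\<in>Poly_Mapping.keys y. if k = (\<beta>, d) then
        (if \<alpha> = a then Poly_Mapping.lookup x (a, \<beta>) * Poly_Mapping.lookup y (\<beta>, d) else 0) else 0)"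
      unfolding lookup_sum by (rule sum.cong) (auto simp: lookup_single when_def split: if_splits)
    also have "\<dots> = (if \<alpha> = a then Poly_Mapping.lookup x (a, \<beta>) * Poly_Mapping.lookup y (\<beta>, d) else 0)"
      by (simp add: in_keys_iff)
    finally show ?thesis .
  qed
  have "Poly_Mapping.lookup (J_mult x y) (a, d) = (\<Sum>k\<in>Poly_Mapping.keys x.
      if fst k = a then Poly_Mapping.lookup x (a, snd k) * Poly_Mapping.lookup y (snd k, d) else 0)"
    unfolding J_mult_def lookup_sum by (rule sum.cong) (auto simp: inner)
  also have "\<dots> = (\<Sum>k\<in>Pair a ` B. Poly_Mapping.lookup x (a, snd k) * Poly_Mapping.lookup y (snd k, d))"
    by (rule sum.mono_neutral_cong)
      (use assms in \<open>auto simp: in_keys_iff image_iff\<close>)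
  also have "\<dots> = (\<Sum>b\<in>B. Poly_Mapping.lookup x (a, b) * Poly_Mapping.lookup y (b, d))"
    by (simp add: sum.reindex inj_on_def)
  finally show ?thesis .
qed

lemma lookup_notin_snd_keys: "b \<notin> snd ` Poly_Mapping.keys x \<Longrightarrow> Poly_Mapping.lookup x (a, b) = 0"
  by (force simp: in_keys_iff image_iff)

lemma lookup_J_mult_keys: "Poly_Mapping.lookup (J_mult x y) (a, d) =
    (\<Sum>b\<in>snd ` Poly_Mapping.keys x. Poly_Mapping.lookup x (a, b) * Poly_Mapping.lookup y (b, d))"
  by (rule lookup_J_mult) (simp_all add: lookup_notin_snd_keys)

lemma lookup_J_mult_eq_0:
  assumes "\<And>b. Poly_Mapping.lookup x (a, b) = 0 \<or> Poly_Mapping.lookup y (b, d) = 0"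
  shows "Poly_Mapping.lookup (J_mult x y) (a, d) = 0"
proof -
  have "Poly_Mapping.lookup x (a, b) * Poly_Mapping.lookup y (b, d) = 0" for b
    using assms[of b] by auto
  then show ?thesis by (simp add: lookup_J_mult_keys)
qed

lemma lookup_J_mult_single:
  assumes "\<And>b. b \<noteq> c \<Longrightarrow> Poly_Mapping.lookup x (a, b) = 0 \<or> Poly_Mapping.lookup y (b, d) = 0"
  shows "Poly_Mapping.lookup (J_mult x y) (a, d) = Poly_Mapping.lookup x (a, c) * Poly_Mapping.lookup y (c, d)"
proof -
  have 0: "Poly_Mapping.lookup x (a, b) * Poly_Mapping.lookup y (b, d) = 0" if "b \<noteq> c" for b
    using assms[OF that] by auto
  have "Poly_Mapping.lookup (J_mult x y) (a, d) =
      (\<Sum>b\<in>insert c (snd ` Poly_Mapping.keys x). Poly_Mapping.lookup x (a, b) * Poly_Mapping.lookup y (b, d))"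
    by (rule lookup_J_mult) (auto intro: lookup_notin_snd_keys)
  also have "\<dots> = (\<Sum>b\<in>{c}. Poly_Mapping.lookup x (a, b) * Poly_Mapping.lookup y (b, d))"
    by (rule sum.mono_neutral_right) (use 0 in auto)
  finally show ?thesis by simp
qed

lemma J_mult_add_left: "J_mult (x + x') y = J_mult x y + J_mult x' y"
proof (rule poly_mapping_eqI, clarify)
  fix a d
  let ?B = "snd ` Poly_Mapping.keys x \<union> snd ` Poly_Mapping.keys x'"
  have 0: "Poly_Mapping.lookup x (a, b) = 0" "Poly_Mapping.lookup x' (a, b) = 0" if "b \<notin> ?B" for b
    using that by (auto intro: lookup_notin_snd_keys)
  have B: "Poly_Mapping.lookup (J_mult u y) (a, d) =
      (\<Sum>b\<in>?B. Poly_Mapping.lookup u (a, b) * Poly_Mapping.lookup y (b, d))"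
    if "u \<in> {x, x', x + x'}" for u
    using that 0 by (intro lookup_J_mult) (auto simp: lookup_add)
  show "Poly_Mapping.lookup (J_mult (x + x') y) (a, d) =
      Poly_Mapping.lookup (J_mult x y + J_mult x' y) (a, d)"
    by (simp add: lookup_add B distrib_right sum.distrib)
qed

lemma J_mult_add_right: "J_mult x (y + y') = J_mult x y + J_mult x y'"
  by (rule poly_mapping_eqI, clarify) (simp add: lookup_add lookup_J_mult_keys distrib_left sum.distrib)

lemma J_mult_zero_left [simp]: "J_mult 0 y = 0"
  using J_mult_add_left[of 0 0 y] by simp

lemma J_mult_zero_right [simp]: "J_mult x 0 = 0"
  using J_mult_add_right[of x 0 0] by simp

lemma J_mult_minus_left: "J_mult (- x) y = - J_mult x y"
  using J_mult_add_left[of x "- x" y] by (simp add: eq_neg_iff_add_eq_0 add.commute)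

lemma J_mult_minus_right: "J_mult x (- y) = - J_mult x y"
  using J_mult_add_right[of x y "- y"] by (simp add: eq_neg_iff_add_eq_0 add.commute)

lemma J_mult_assoc: "J_mult (J_mult x y) z = J_mult x (J_mult y z)"
proof (rule poly_mapping_eqI, clarify)
  fix a d
  let ?B = "snd ` Poly_Mapping.keys x" and ?C = "snd ` Poly_Mapping.keys y"
  \<comment> \<open>The columns of the product are among those of \<open>y\<close>, so both
    bracketings can be expanded over the same pair of index sets.\<close>
  have 0: "Poly_Mapping.lookup (J_mult x y) (a, c) = 0" if "c \<notin> ?C" for c
    by (rule lookup_J_mult_eq_0) (simp add: lookup_notin_snd_keys[OF that])
  have "Poly_Mapping.lookup (J_mult (J_mult x y) z) (a, d) =
      (\<Sum>c\<in>?C. \<Sum>b\<in>?B. Poly_Mapping.lookup x (a, b) * Poly_Mapping.lookup y (b, c) * Poly_Mapping.lookup z (c, d))"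
    by (subst lookup_J_mult[of ?C]) (simp_all add: 0, simp add: lookup_J_mult_keys sum_distrib_right)
  also have "\<dots> = (\<Sum>b\<in>?B. \<Sum>c\<in>?C. Poly_Mapping.lookup x (a, b) * Poly_Mapping.lookup y (b, c) * Poly_Mapping.lookup z (c, d))"
    by (rule sum.swap)
  also have "\<dots> = Poly_Mapping.lookup (J_mult x (J_mult y z)) (a, d)"
    by (simp add: lookup_J_mult_keys sum_distrib_left mult.assoc)
  finally show "Poly_Mapping.lookup (J_mult (J_mult x y) z) (a, d) =
      Poly_Mapping.lookup (J_mult x (J_mult y z)) (a, d)" .
qed

text \<open>A nonzero entry of the product at \<open>(a, d)\<close> needs an intermediate
  \<open>b\<close> with \<open>(a, b)\<close> and \<open>(b, d)\<close> both in
  \<open>A\<close>.\<close>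

lemma J_mult_supported:
  assumes "trans A" "x \<in> supported A" "y \<in> supported A"
  shows "J_mult x y \<in> supported A"
  unfolding in_supported_iff
proof clarify
  fix a d assume "(a, d) \<notin> A"
  then show "Poly_Mapping.lookup (J_mult x y) (a, d) = 0"
    using assms by (intro lookup_J_mult_eq_0) (metis in_supported_iff transD)
qed

section \<open>The circle operation: factorisation, inverses and subgroups\<close>

lemma trans_Phi: "trans Phi"
  by (auto simp: Phi_def trans_def)

lemma McLain_mult: "x \<otimes>\<^bsub>McLain\<^esub> y = x + y + J_mult x y"
  and McLain_one: "\<one>\<^bsub>McLain\<^esub> = 0"
  and McLain_carrier: "carrier McLain = supported Phi"
  by (simp_all add: McLain_def McLain_J_eq)

lemma McLain_mult_zero [simp]: "0 \<otimes>\<^bsub>McLain\<^esub> y = y" "y \<otimes>\<^bsub>McLain\<^esub> 0 = y"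
  by (simp_all add: McLain_mult)

lemma McLain_mult_supported:
  "trans A \<Longrightarrow> x \<in> supported A \<Longrightarrow> y \<in> supported A \<Longrightarrow> x \<otimes>\<^bsub>McLain\<^esub> y \<in> supported A"
  unfolding McLain_mult by (intro supported_add J_mult_supported)

text \<open>The factor split off belongs to the last row of \<open>x\<close>, so no product of matrix units occurs.\<close>

lemma supported_induct [consumes 2, case_names zero mult]:
  fixes x :: "('l::linorder \<times> 'l) \<Rightarrow>\<^sub>0 'r::ring_1"
  assumes "A \<subseteq> Phi" "x \<in> supported A" and zero: "Q 0"
    and mult: "\<And>\<alpha> \<beta> r y. (\<alpha>, \<beta>) \<in> A \<Longrightarrow> y \<in> supported A \<Longrightarrow> Q y \<Longrightarrow>
      Q (Poly_Mapping.single (\<alpha>, \<beta>) r \<otimes>\<^bsub>McLain\<^esub> y)"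
  shows "Q x"
  using assms(2)
proof (induction "card (Poly_Mapping.keys x)" arbitrary: x rule: less_induct)
  case less
  show ?case
  proof (cases "Poly_Mapping.keys x = {}")
    case True
    then have "x = 0" by (auto intro!: poly_mapping_eqI simp: in_keys_iff)
    then show ?thesis using zero by simp
  next
    case False
    define \<alpha> where "\<alpha> = Max (fst ` Poly_Mapping.keys x)"
    have "\<alpha> \<in> fst ` Poly_Mapping.keys x" unfolding \<alpha>_def using False by (intro Max_in) auto
    then obtain \<beta> where \<beta>: "(\<alpha>, \<beta>) \<in> Poly_Mapping.keys x" by auto
    have max: "\<gamma> \<le> \<alpha>" if "(\<gamma>, \<delta>) \<in> Poly_Mapping.keys x" for \<gamma> \<delta>
      unfolding \<alpha>_def using that by (intro Max_ge) force+
    have A: "(\<alpha>, \<beta>) \<in> A" using \<beta> less.prems by (auto simp: supported_def)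
    then have lt: "\<alpha> < \<beta>" using assms(1) by (auto simp: Phi_def)
    define r where "r = Poly_Mapping.lookup x (\<alpha>, \<beta>)"
    define y where "y = x - Poly_Mapping.single (\<alpha>, \<beta>) r"
    have y: "Poly_Mapping.lookup y k = (if k = (\<alpha>, \<beta>) then 0 else Poly_Mapping.lookup x k)" for k
      by (auto simp: y_def r_def lookup_minus lookup_single when_def)
    then have "Poly_Mapping.keys y \<subseteq> Poly_Mapping.keys x - {(\<alpha>, \<beta>)}"
      by (auto simp: in_keys_iff split: if_splits)
    then have "Poly_Mapping.keys y \<subset> Poly_Mapping.keys x"
      using \<beta> by blast
    then have "card (Poly_Mapping.keys y) < card (Poly_Mapping.keys x)"
      by (intro psubset_card_mono) auto
    moreover have yA: "y \<in> supported A" using less.prems y by (simp add: in_supported_iff)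
    ultimately have "Q y" using less.hyps by blast
    have "J_mult (Poly_Mapping.single (\<alpha>, \<beta>) r) y = 0"
    proof (rule poly_mapping_eqI, clarify)
      fix a d
      have "(\<beta>, d) \<notin> Poly_Mapping.keys x" using max[of \<beta> d] lt by auto
      then have "Poly_Mapping.lookup y (\<beta>, d) = 0" using y by (simp add: in_keys_iff)
      then show "Poly_Mapping.lookup (J_mult (Poly_Mapping.single (\<alpha>, \<beta>) r) y) (a, d) =
          Poly_Mapping.lookup 0 (a, d)"
        by (subst lookup_J_mult_eq_0) (auto simp: lookup_single when_def)
    qed
    then have "x = Poly_Mapping.single (\<alpha>, \<beta>) r \<otimes>\<^bsub>McLain\<^esub> y"
      by (simp add: McLain_mult y_def)
    with mult[OF A yA \<open>Q y\<close>, of r] show ?thesis by simp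
  qed
qed

lemma McLain_assoc:
  "(x \<otimes>\<^bsub>McLain\<^esub> y) \<otimes>\<^bsub>McLain\<^esub> z = x \<otimes>\<^bsub>McLain\<^esub> (y \<otimes>\<^bsub>McLain\<^esub> z)"
  by (simp add: McLain_mult J_mult_add_left J_mult_add_right J_mult_assoc algebra_simps)

lemma J_mult_square_eq_0:
  assumes "\<And>k l. k \<in> Poly_Mapping.keys x \<Longrightarrow> l \<in> Poly_Mapping.keys x \<Longrightarrow> snd k \<noteq> fst l"
  shows "J_mult x x = 0"
proof (rule poly_mapping_eqI, clarify)
  fix a d
  show "Poly_Mapping.lookup (J_mult x x) (a, d) = Poly_Mapping.lookup 0 (a, d)"
    by (subst lookup_J_mult_eq_0) (use assms in \<open>force simp: in_keys_iff\<close>)+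
qed

text \<open>In the factorisation of \<open>supported_induct\<close> each factor \<open>s\<close> has
  square zero in \<open>J\<close>, so its inverse is \<open>- s\<close>. Multiplying these inverses
  in reverse order stays inside \<open>supported A\<close>.\<close>

lemma ex_McLain_inverse:
  assumes "A \<subseteq> Phi" "trans A" "x \<in> supported A"
  shows "\<exists>y\<in>supported A. x \<otimes>\<^bsub>McLain\<^esub> y = 0 \<and> y \<otimes>\<^bsub>McLain\<^esub> x = 0"
  using assms(1,3)
proof (induction rule: supported_induct)
  case zero
  show ?case by (rule bexI[of _ 0]) (simp_all add: McLain_mult)
next
  case (mult \<alpha> \<beta> r y)
  then obtain y' where y': "y' \<in> supported A" "y \<otimes>\<^bsub>McLain\<^esub> y' = 0" "y' \<otimes>\<^bsub>McLain\<^esub> y = 0" by blast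
  let ?s = "Poly_Mapping.single (\<alpha>, \<beta>) r"
  have "\<alpha> \<noteq> \<beta>" using mult assms(1) by (auto simp: Phi_def)
  then have "J_mult ?s ?s = 0" by (intro J_mult_square_eq_0) (auto split: if_splits)
  then have s: "?s \<otimes>\<^bsub>McLain\<^esub> (- ?s) = 0" "(- ?s) \<otimes>\<^bsub>McLain\<^esub> ?s = 0"
    by (simp_all add: McLain_mult J_mult_minus_left J_mult_minus_right)
  have "?s \<otimes>\<^bsub>McLain\<^esub> y \<otimes>\<^bsub>McLain\<^esub> (y' \<otimes>\<^bsub>McLain\<^esub> (- ?s)) =
      ?s \<otimes>\<^bsub>McLain\<^esub> ((y \<otimes>\<^bsub>McLain\<^esub> y') \<otimes>\<^bsub>McLain\<^esub> (- ?s))"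
    by (simp only: McLain_assoc)
  moreover have "y' \<otimes>\<^bsub>McLain\<^esub> (- ?s) \<otimes>\<^bsub>McLain\<^esub> (?s \<otimes>\<^bsub>McLain\<^esub> y) =
      y' \<otimes>\<^bsub>McLain\<^esub> (((- ?s) \<otimes>\<^bsub>McLain\<^esub> ?s) \<otimes>\<^bsub>McLain\<^esub> y)"
    by (simp only: McLain_assoc)
  moreover have "y' \<otimes>\<^bsub>McLain\<^esub> (- ?s) \<in> supported A"
    using y'(1) mult by (intro McLain_mult_supported assms supported_uminus single_supported)
  ultimately show ?case using y' s by (intro bexI[of _ "y' \<otimes>\<^bsub>McLain\<^esub> (- ?s)"]) simp_all
qed

lemma group_McLain: "group McLain"
proof (rule groupI)
  fix x :: "('a \<times> 'a) \<Rightarrow>\<^sub>0 'b" assume "x \<in> carrier McLain"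
  then show "\<exists>y\<in>carrier McLain. y \<otimes>\<^bsub>McLain\<^esub> x = \<one>\<^bsub>McLain\<^esub>"
    using ex_McLain_inverse[OF subset_refl trans_Phi] by (auto simp: McLain_carrier McLain_one)
qed (auto simp: McLain_carrier McLain_one McLain_assoc intro: McLain_mult_supported[OF trans_Phi])

interpretation M: group "McLain :: (('l::linorder \<times> 'l) \<Rightarrow>\<^sub>0 'r::ring_1) monoid"
  by (rule group_McLain)

lemma McLain_inv_supported:
  assumes "A \<subseteq> Phi" "trans A" "x \<in> supported A"
  shows "inv\<^bsub>McLain\<^esub> x \<in> supported A"
proof -
  obtain y where y: "y \<in> supported A" "x \<otimes>\<^bsub>McLain\<^esub> y = 0" "y \<otimes>\<^bsub>McLain\<^esub> x = 0"
    using ex_McLain_inverse[OF assms] by blast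
  moreover have "x \<in> carrier McLain" "y \<in> carrier McLain"
    unfolding McLain_carrier using assms y(1) supported_mono by blast+
  ultimately have "inv\<^bsub>McLain\<^esub> x = y"
    by (intro M.inv_equality) (simp_all add: McLain_one)
  with y show ?thesis by simp
qed

lemma subgroup_supported:
  assumes "A \<subseteq> Phi" "trans A"
  shows "subgroup (supported A) McLain"
  by (rule subgroup.intro)
    (use assms McLain_inv_supported in \<open>auto simp: McLain_carrier McLain_one
       intro: supported_mono McLain_mult_supported\<close>)

lemma single_mem_generate:
  assumes "A \<subseteq> Phi" "x \<in> supported A"
    "\<And>\<gamma> \<delta> r. (\<gamma>, \<delta>) \<in> A \<Longrightarrow> Poly_Mapping.single (\<gamma>, \<delta>) r \<in> K"
  shows "x \<in> generate McLain K"
  using assms(1,2)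
proof (induction rule: supported_induct)
  case zero
  then show ?case using generate.one[of McLain K] by (simp add: McLain_one)
next
  case mult
  then show ?case using assms(3) by (intro generate.eng[OF generate.incl])
qed

lemma generate_roots:
  assumes "A \<subseteq> Phi" "trans A" "K = {Poly_Mapping.single k r | k r. k \<in> A}"
  shows "generate McLain K = supported A"
proof
  show "generate McLain K \<subseteq> supported A"
    by (rule M.generate_subgroup_incl)
      (use assms in \<open>auto intro: single_supported subgroup_supported\<close>)
  show "supported A \<subseteq> generate McLain K"
    using assms by (blast intro: single_mem_generate)
qed


section \<open>The groups and the character of an elementary module\<close>

definition box :: "'l::linorder \<Rightarrow> 'l \<Rightarrow> ('l \<times> 'l) set" where
  "box \<alpha> \<beta> = {(\<gamma>, \<delta>). \<alpha> \<le> \<gamma> \<and> \<gamma> < \<delta> \<and> \<delta> \<le> \<beta>}"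

text \<open>The roots of \<open>L\<close> that are missing in \<open>P\<close>. Elements of
  \<open>J\<close> supported here will represent the cosets of \<open>P\<close> in
  \<open>L\<close>.\<close>

definition row :: "'l::linorder \<Rightarrow> 'l \<Rightarrow> ('l \<times> 'l) set" where
  "row \<alpha> \<beta> = {(\<alpha>, \<gamma>) | \<gamma>. \<alpha> < \<gamma> \<and> \<gamma> < \<beta>}"

lemma box_Phi: "box \<alpha> \<beta> \<subseteq> Phi"
  by (auto simp: box_def Phi_def)

lemma row_box: "row \<alpha> \<beta> \<subseteq> box \<alpha> \<beta>"
  by (auto simp: box_def row_def)

lemma trans_box: "trans (box \<alpha> \<beta>)"
  by (auto simp: box_def trans_def)

text \<open>A root of this set that starts at \<alpha> ends at \<beta>, so it cannot be continued
  inside the box; and roots with a later start never compose to one that starts at \<alpha>.\<close>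

lemma trans_box_minus_row: "trans (box \<alpha> \<beta> - row \<alpha> \<beta>)"
  unfolding trans_def box_def row_def by fastforce

lemma elem_L_eq: "elem_L \<alpha> \<beta> = supported (box \<alpha> \<beta>)"
  unfolding elem_L_def
  by (rule generate_roots[OF box_Phi trans_box]) (auto simp: root_subgroup_def box_def)

lemma elem_P_eq: "elem_P \<alpha> \<beta> = supported (box \<alpha> \<beta> - row \<alpha> \<beta>)"
  unfolding elem_P_def
proof (rule generate_roots)
  show "box \<alpha> \<beta> - row \<alpha> \<beta> \<subseteq> Phi" using box_Phi by blast
  show "trans (box \<alpha> \<beta> - row \<alpha> \<beta>)" by (rule trans_box_minus_row)
  have "box \<alpha> \<beta> - row \<alpha> \<beta> =
      {(\<gamma>, \<beta>) | \<gamma>. \<alpha> \<le> \<gamma> \<and> \<gamma> < \<beta>} \<union> {(\<gamma>, \<delta>) | \<gamma> \<delta>. \<alpha> < \<gamma> \<and> \<gamma> < \<delta> \<and> \<delta> < \<beta>}"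
    by (auto simp: box_def row_def)
  then show "\<Union> {root_subgroup \<gamma> \<beta> |\<gamma>. \<alpha> \<le> \<gamma> \<and> \<gamma> < \<beta>} \<union>
      \<Union> {root_subgroup \<gamma> \<delta> |\<gamma> \<delta>. \<alpha> < \<gamma> \<and> \<gamma> < \<delta> \<and> \<delta> < \<beta>} =
      {Poly_Mapping.single k r |k r. k \<in> box \<alpha> \<beta> - row \<alpha> \<beta>}"
    unfolding root_subgroup_def by simp blast
qed

section \<open>Truncation to a box and the projection onto \<open>L\<close>\<close>

definition cut :: "'k set \<Rightarrow> ('k \<Rightarrow>\<^sub>0 'r) \<Rightarrow> ('k \<Rightarrow>\<^sub>0 'r::ring_1)" where
  "cut A x = (\<Sum>k\<in>Poly_Mapping.keys x \<inter> A. Poly_Mapping.single k (Poly_Mapping.lookup x k))"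

lemma lookup_cut: "Poly_Mapping.lookup (cut A x) k = (if k \<in> A then Poly_Mapping.lookup x k else 0)"
proof -
  have "Poly_Mapping.lookup (cut A x) k =
      (\<Sum>l\<in>Poly_Mapping.keys x \<inter> A. if l = k then Poly_Mapping.lookup x k else 0)"
    unfolding cut_def lookup_sum by (rule sum.cong) (auto simp: lookup_single when_def)
  then show ?thesis by (auto simp: in_keys_iff)
qed

lemma cut_supported: "cut A x \<in> supported A"
  by (simp add: in_supported_iff lookup_cut)

lemma cut_eq_self: "x \<in> supported A \<Longrightarrow> cut A x = x"
  by (rule poly_mapping_eqI) (auto simp: lookup_cut supported_lookup)

text \<open>The box is convex: if \<open>(\<gamma>, \<delta>)\<close> lies in it and \<gamma> < b <
  \<delta>, then both \<open>(\<gamma>, b)\<close> and \<open>(b, \<delta>)\<close> lie in it. So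
  entries outside the box never influence the product inside.\<close>

lemma cut_box_mult:
  assumes "x \<in> supported Phi" "y \<in> supported Phi"
  shows "cut (box \<alpha> \<beta>) (x \<otimes>\<^bsub>McLain\<^esub> y) = cut (box \<alpha> \<beta>) x \<otimes>\<^bsub>McLain\<^esub> cut (box \<alpha> \<beta>) y"
proof (rule poly_mapping_eqI, clarify)
  fix \<gamma> \<delta>
  have x: "Poly_Mapping.lookup x (a, b) = 0" and y: "Poly_Mapping.lookup y (a, b) = 0" if "b \<le> a" for a b
    using that assms by (auto simp: Phi_def intro: supported_lookup)
  have "Poly_Mapping.lookup (J_mult (cut (box \<alpha> \<beta>) x) (cut (box \<alpha> \<beta>) y)) (\<gamma>, \<delta>) =
      (if (\<gamma>, \<delta>) \<in> box \<alpha> \<beta> then Poly_Mapping.lookup (J_mult x y) (\<gamma>, \<delta>) else 0)"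
  proof (cases "(\<gamma>, \<delta>) \<in> box \<alpha> \<beta>")
    case True
    have "Poly_Mapping.lookup (J_mult (cut (box \<alpha> \<beta>) x) (cut (box \<alpha> \<beta>) y)) (\<gamma>, \<delta>) =
      (\<Sum>b\<in>snd ` Poly_Mapping.keys x. Poly_Mapping.lookup (cut (box \<alpha> \<beta>) x) (\<gamma>, b) *
        Poly_Mapping.lookup (cut (box \<alpha> \<beta>) y) (b, \<delta>))"
      by (rule lookup_J_mult) (auto simp: lookup_cut intro: lookup_notin_snd_keys)
    also have "\<dots> = Poly_Mapping.lookup (J_mult x y) (\<gamma>, \<delta>)"
      unfolding lookup_J_mult_keys
    proof (rule sum.cong)
      fix b
      show "Poly_Mapping.lookup (cut (box \<alpha> \<beta>) x) (\<gamma>, b) * Poly_Mapping.lookup (cut (box \<alpha> \<beta>) y) (b, \<delta>) =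
          Poly_Mapping.lookup x (\<gamma>, b) * Poly_Mapping.lookup y (b, \<delta>)"
      proof (cases "\<gamma> < b \<and> b < \<delta>")
        case b: True
        then have "(\<gamma>, b) \<in> box \<alpha> \<beta>" "(b, \<delta>) \<in> box \<alpha> \<beta>"
          using True by (auto simp: box_def)
        then show ?thesis by (simp add: lookup_cut)
      next
        case False
        then have "Poly_Mapping.lookup x (\<gamma>, b) = 0 \<or> Poly_Mapping.lookup y (b, \<delta>) = 0"
          using x y by (meson not_le)
        then show ?thesis by (auto simp: lookup_cut)
      qed
    qed simp
    finally show ?thesis using True by simp
  next
    case False
    have "J_mult (cut (box \<alpha> \<beta>) x) (cut (box \<alpha> \<beta>) y) \<in> supported (box \<alpha> \<beta>)"
      by (intro J_mult_supported trans_box cut_supported)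
    with False show ?thesis by (simp add: supported_lookup)
  qed
  then show "Poly_Mapping.lookup (cut (box \<alpha> \<beta>) (x \<otimes>\<^bsub>McLain\<^esub> y)) (\<gamma>, \<delta>) =
      Poly_Mapping.lookup (cut (box \<alpha> \<beta>) x \<otimes>\<^bsub>McLain\<^esub> cut (box \<alpha> \<beta>) y) (\<gamma>, \<delta>)"
    by (simp add: McLain_mult lookup_add lookup_cut)
qed

lemma cut_box_Phi: "cut (box \<alpha> \<beta>) x \<in> supported Phi"
  by (rule supported_mono[OF cut_supported box_Phi])

lemma cut_box_inv:
  assumes "x \<in> supported Phi"
  shows "cut (box \<alpha> \<beta>) (inv\<^bsub>McLain\<^esub> x) = inv\<^bsub>McLain\<^esub> (cut (box \<alpha> \<beta>) x)"
proof (rule M.inv_equality[symmetric])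
  have i: "inv\<^bsub>McLain\<^esub> x \<in> supported Phi" using assms by (intro McLain_inv_supported trans_Phi subset_refl)
  have "inv\<^bsub>McLain\<^esub> x \<otimes>\<^bsub>McLain\<^esub> x = 0"
    using assms by (subst M.l_inv) (simp_all add: McLain_carrier McLain_one)
  then show "cut (box \<alpha> \<beta>) (inv\<^bsub>McLain\<^esub> x) \<otimes>\<^bsub>McLain\<^esub> cut (box \<alpha> \<beta>) x = \<one>\<^bsub>McLain\<^esub>"
    unfolding cut_box_mult[OF i assms, symmetric] by (simp add: McLain_one cut_def)
qed (simp_all add: McLain_carrier cut_box_Phi)

lemma supported_Phi_minus_box_iff:
  "n \<in> supported (Phi - box \<alpha> \<beta>) \<longleftrightarrow> n \<in> supported Phi \<and> cut (box \<alpha> \<beta>) n = 0"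
  by (auto simp: in_supported_iff poly_mapping_eq_iff fun_eq_iff lookup_cut)

text \<open>By \<open>cut_box_mult\<close> the truncation is a homomorphism on the McLain group, and
  the right-hand side is its kernel; it therefore contains all conjugates of the generators of
  \<open>N\<close>.\<close>

lemma elem_N_eq:
  fixes \<alpha> \<beta> :: "'l::linorder"
  shows "(elem_N \<alpha> \<beta> :: (_ \<Rightarrow>\<^sub>0 'r::ring_1) set) = supported (Phi - box \<alpha> \<beta>)"
proof
  let ?K = "\<Union>{root_subgroup \<gamma> \<delta> | \<gamma> \<delta>. \<gamma> < \<delta> \<and> (\<gamma> < \<alpha> \<or> \<delta> > \<beta>)} :: (_ \<Rightarrow>\<^sub>0 'r) set"
  let ?C = "{g \<otimes>\<^bsub>McLain\<^esub> s \<otimes>\<^bsub>McLain\<^esub> inv\<^bsub>McLain\<^esub> g | g s. g \<in> carrier McLain \<and> s \<in> ?K}"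
  have K: "?K = {Poly_Mapping.single k r | k r. k \<in> Phi - box \<alpha> \<beta>}"
    by (auto simp: root_subgroup_def Phi_def box_def not_le)
  have "?C \<subseteq> supported (Phi - box \<alpha> \<beta>)"
  proof
    fix c assume "c \<in> ?C"
    then obtain g s where g: "g \<in> carrier McLain" and s: "s \<in> ?K"
      and c: "c = g \<otimes>\<^bsub>McLain\<^esub> s \<otimes>\<^bsub>McLain\<^esub> inv\<^bsub>McLain\<^esub> g" by blast
    have s: "s \<in> supported (Phi - box \<alpha> \<beta>)" using s unfolding K by (auto intro: single_supported)
    then have s': "s \<in> supported Phi" "cut (box \<alpha> \<beta>) s = 0" by (simp_all add: supported_Phi_minus_box_iff)
    have g': "g \<in> supported Phi" "inv\<^bsub>McLain\<^esub> g \<in> supported Phi"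
      using g M.inv_closed[OF g] by (simp_all add: McLain_carrier)
    have "cut (box \<alpha> \<beta>) (g \<otimes>\<^bsub>McLain\<^esub> s \<otimes>\<^bsub>McLain\<^esub> inv\<^bsub>McLain\<^esub> g) =
        cut (box \<alpha> \<beta>) (g \<otimes>\<^bsub>McLain\<^esub> inv\<^bsub>McLain\<^esub> g)"
      using g' s' by (simp add: cut_box_mult McLain_mult_supported[OF trans_Phi])
    also have "\<dots> = 0" using g by (simp add: McLain_one cut_def)
    finally show "c \<in> supported (Phi - box \<alpha> \<beta>)"
      unfolding c using g' s' by (simp add: supported_Phi_minus_box_iff McLain_mult_supported[OF trans_Phi])
  qed
  moreover have "subgroup (supported (Phi - box \<alpha> \<beta>) :: (_ \<Rightarrow>\<^sub>0 'r) set) McLain"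
  proof (rule subgroup_supported)
    show "trans (Phi - box \<alpha> \<beta>)" unfolding trans_def Phi_def box_def by fastforce
  qed blast
  ultimately show "(elem_N \<alpha> \<beta> :: (_ \<Rightarrow>\<^sub>0 'r) set) \<subseteq> supported (Phi - box \<alpha> \<beta>)"
    unfolding elem_N_def normal_closure_def by (intro M.generate_subgroup_incl)
  \<comment> \<open>A root element outside the box is its own conjugate by the identity.\<close>
  have "Poly_Mapping.single k r \<in> ?C" if "k \<in> Phi - box \<alpha> \<beta>" for k and r :: 'r
  proof -
    have "Poly_Mapping.single k r \<in> ?K" unfolding K using that by blast
    moreover have "Poly_Mapping.single k r =
        \<one>\<^bsub>McLain\<^esub> \<otimes>\<^bsub>McLain\<^esub> Poly_Mapping.single k r \<otimes>\<^bsub>McLain\<^esub> inv\<^bsub>McLain\<^esub> \<one>\<^bsub>McLain\<^esub>"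
      unfolding M.inv_one by (simp add: McLain_one McLain_mult)
    ultimately show ?thesis using M.one_closed by blast
  qed
  then show "supported (Phi - box \<alpha> \<beta>) \<subseteq> (elem_N \<alpha> \<beta> :: (_ \<Rightarrow>\<^sub>0 'r) set)"
    unfolding elem_N_def normal_closure_def
    by (intro subsetI single_mem_generate[of "Phi - box \<alpha> \<beta>"]) auto
qed

text \<open>Truncation kills \<open>N\<close> and fixes \<open>L\<close>, which determines the
  component in \<open>L\<close>. Conversely, dividing \<open>x\<close> on the right by its
  truncation leaves an element of \<open>N\<close>.\<close>

lemma elem_proj_eq:
  assumes x: "x \<in> supported Phi"
  shows "elem_proj \<alpha> \<beta> x = cut (box \<alpha> \<beta>) x"
  unfolding elem_proj_def elem_L_eq elem_N_eq
proof (rule the_equality)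
  let ?l = "cut (box \<alpha> \<beta>) x"
  have l: "?l \<in> carrier McLain" by (simp add: McLain_carrier cut_box_Phi)
  have xc: "x \<in> carrier McLain" using x by (simp add: McLain_carrier)
  let ?n = "x \<otimes>\<^bsub>McLain\<^esub> inv\<^bsub>McLain\<^esub> ?l"
  have il: "inv\<^bsub>McLain\<^esub> ?l \<in> supported (box \<alpha> \<beta>)"
    by (intro McLain_inv_supported box_Phi trans_box cut_supported)
  then have il': "inv\<^bsub>McLain\<^esub> ?l \<in> supported Phi" using supported_mono box_Phi by blast
  have "cut (box \<alpha> \<beta>) ?n = ?l \<otimes>\<^bsub>McLain\<^esub> inv\<^bsub>McLain\<^esub> ?l"
    using il by (simp add: cut_box_mult[OF x il'] cut_eq_self)
  also have "\<dots> = 0" using l by (simp add: McLain_one)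
  finally have "?n \<in> supported (Phi - box \<alpha> \<beta>)"
    using x il' by (simp add: supported_Phi_minus_box_iff McLain_mult_supported[OF trans_Phi])
  moreover have "x = ?n \<otimes>\<^bsub>McLain\<^esub> ?l" using xc l by (simp add: M.m_assoc McLain_one)
  ultimately show "?l \<in> supported (box \<alpha> \<beta>) \<and>
      (\<exists>n\<in>supported (Phi - box \<alpha> \<beta>). x = n \<otimes>\<^bsub>McLain\<^esub> ?l)"
    using cut_supported by blast
next
  fix l assume "l \<in> supported (box \<alpha> \<beta>) \<and> (\<exists>n\<in>supported (Phi - box \<alpha> \<beta>). x = n \<otimes>\<^bsub>McLain\<^esub> l)"
  then obtain n where l: "l \<in> supported (box \<alpha> \<beta>)" and n: "n \<in> supported (Phi - box \<alpha> \<beta>)"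
    and x: "x = n \<otimes>\<^bsub>McLain\<^esub> l" by blast
  have "l \<in> supported Phi" using l supported_mono box_Phi by blast
  with n l show "l = cut (box \<alpha> \<beta>) x"
    unfolding x by (simp add: supported_Phi_minus_box_iff cut_box_mult cut_eq_self)
qed

section \<open>The linear character of \<open>P\<close>\<close>

lemma linear_char_0: "linear_char \<mu> \<Longrightarrow> \<mu> 0 = 1"
  unfolding linear_char_def by (metis add.right_neutral mult_cancel_left1)

lemma linear_char_add: "linear_char \<mu> \<Longrightarrow> \<mu> (r + s) = \<mu> r * \<mu> s"
  and linear_char_nonzero: "linear_char \<mu> \<Longrightarrow> \<mu> r \<noteq> 0"
  by (simp_all add: linear_char_def)

text \<open>For b < \<beta> the entry of \<open>p\<close> at \<open>(\<alpha>, b)\<close> vanishes,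
  and for b \<ge> \<beta> the entry of \<open>q\<close> at \<open>(b, \<beta>)\<close> does, so the
  corner entry is additive. That \<open>q\<close> may lie outside \<open>P\<close> is used for
  inverses of general elements of \<open>L\<close>.\<close>

lemma elem_P_lookup_mult:
  assumes "p \<in> elem_P \<alpha> \<beta>" "q \<in> supported Phi"
  shows "Poly_Mapping.lookup (p \<otimes>\<^bsub>McLain\<^esub> q) (\<alpha>, \<beta>) =
    Poly_Mapping.lookup p (\<alpha>, \<beta>) + Poly_Mapping.lookup q (\<alpha>, \<beta>)"
proof -
  have "Poly_Mapping.lookup (J_mult p q) (\<alpha>, \<beta>) = 0"
  proof (rule lookup_J_mult_eq_0)
    fix b
    show "Poly_Mapping.lookup p (\<alpha>, b) = 0 \<or> Poly_Mapping.lookup q (b, \<beta>) = 0"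
    proof (cases "b < \<beta>")
      case True
      then show ?thesis using assms(1) by (auto simp: elem_P_eq in_supported_iff box_def row_def)
    next
      case False
      then show ?thesis using assms(2) by (auto simp: in_supported_iff Phi_def)
    qed
  qed
  then show ?thesis by (simp add: McLain_mult lookup_add)
qed

lemma elem_P_Phi: "p \<in> elem_P \<alpha> \<beta> \<Longrightarrow> p \<in> supported Phi"
  unfolding elem_P_eq using supported_mono box_Phi by blast

lemma subgroup_elem_P: "subgroup (elem_P \<alpha> \<beta>) McLain"
  unfolding elem_P_eq by (rule subgroup_supported[OF _ trans_box_minus_row]) (use box_Phi in blast)

lemma subgroup_elem_L: "subgroup (elem_L \<alpha> \<beta>) McLain"
  unfolding elem_L_eq by (rule subgroup_supported[OF box_Phi trans_box])

lemma elem_P_lookup_inv: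
  assumes "p \<in> elem_P \<alpha> \<beta>"
  shows "Poly_Mapping.lookup (inv\<^bsub>McLain\<^esub> p) (\<alpha>, \<beta>) = - Poly_Mapping.lookup p (\<alpha>, \<beta>)"
proof -
  have p: "p \<in> carrier McLain" using elem_P_Phi[OF assms] by (simp add: McLain_carrier)
  have "inv\<^bsub>McLain\<^esub> p \<in> supported Phi" using M.inv_closed[OF p] by (simp add: McLain_carrier)
  from elem_P_lookup_mult[OF assms this] M.r_inv[OF p] show ?thesis
    by (simp add: McLain_one eq_neg_iff_add_eq_0 add.commute)
qed

text \<open>Applying \<mu> to the additive corner entry gives a character with the required values.
  It is the only one, because every element of \<open>P\<close> is a product of root elements on
  which the values are prescribed.\<close>

lemma elem_char_eq:
  fixes \<mu> :: "'r::ring_1 \<Rightarrow> 'f::field"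
  assumes "linear_char \<mu>" "\<alpha> < \<beta>" "p \<in> elem_P \<alpha> \<beta>"
  shows "elem_char \<alpha> \<beta> \<mu> p = \<mu> (Poly_Mapping.lookup p (\<alpha>, \<beta>))"
proof -
  let ?\<chi> = "\<lambda>p\<in>elem_P \<alpha> \<beta>. \<mu> (Poly_Mapping.lookup p (\<alpha>, \<beta>))"
  have P: "Poly_Mapping.single (\<gamma>, \<delta>) r \<in> elem_P \<alpha> \<beta>"
    if "\<alpha> \<le> \<gamma>" "\<gamma> < \<delta>" "\<delta> \<le> \<beta>" "\<gamma> = \<alpha> \<longrightarrow> \<delta> = \<beta>" for \<gamma> \<delta> and r :: 'r
    unfolding elem_P_eq using that by (intro single_supported) (auto simp: box_def row_def)
  have "elem_char \<alpha> \<beta> \<mu> = ?\<chi>"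
    unfolding elem_char_def
  proof (rule the_equality)
    show "is_elem_char \<alpha> \<beta> \<mu> ?\<chi>"
      unfolding is_elem_char_def
      using assms(1,2) subgroup.m_closed[OF subgroup_elem_P]
        P[of \<alpha> \<beta>, OF order_refl assms(2) order_refl] P[OF less_imp_le _ order_refl]
        P[OF less_imp_le _ less_imp_le]
      by (auto simp: less_imp_neq[symmetric] less_imp_neq linear_char_nonzero linear_char_add linear_char_0 elem_P_lookup_mult elem_P_Phi
          lookup_single when_def)
    fix \<chi> assume \<chi>: "is_elem_char \<alpha> \<beta> \<mu> \<chi>"
    have single: "\<chi> (Poly_Mapping.single (\<gamma>, \<delta>) r) =
        \<mu> (Poly_Mapping.lookup (Poly_Mapping.single (\<gamma>, \<delta>) r) (\<alpha>, \<beta>))"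
      if "(\<gamma>, \<delta>) \<in> box \<alpha> \<beta> - row \<alpha> \<beta>" for \<gamma> \<delta> r
    proof -
      from that consider "\<gamma> = \<alpha>" "\<delta> = \<beta>" | "\<alpha> < \<gamma>" "\<gamma> < \<beta>" "\<delta> = \<beta>" | "\<alpha> < \<gamma>" "\<gamma> < \<delta>" "\<delta> < \<beta>"
        unfolding box_def row_def by fastforce
      then show ?thesis
        by cases (use \<chi> in \<open>auto simp: is_elem_char_def lookup_single when_def linear_char_0[OF assms(1)]\<close>)
    qed
    have "\<chi> p = \<mu> (Poly_Mapping.lookup p (\<alpha>, \<beta>))" if "p \<in> elem_P \<alpha> \<beta>" for p
      using _ that[unfolded elem_P_eq]
    proof (induction rule: supported_induct)
      show "box \<alpha> \<beta> - row \<alpha> \<beta> \<subseteq> Phi" using box_Phi by blast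
      have "0 \<in> elem_P \<alpha> \<beta>" by (simp add: elem_P_eq)
      with \<chi> have "\<chi> 0 \<noteq> 0" "\<chi> (0 \<otimes>\<^bsub>McLain\<^esub> 0) = \<chi> 0 * \<chi> 0" unfolding is_elem_char_def by blast+
      then show "\<chi> 0 = \<mu> (Poly_Mapping.lookup 0 (\<alpha>, \<beta>))"
        by (simp add: McLain_mult linear_char_0[OF assms(1)])
    next
      fix \<gamma> \<delta> and r :: 'r and y assume *: "(\<gamma>, \<delta>) \<in> box \<alpha> \<beta> - row \<alpha> \<beta>" "y \<in> supported (box \<alpha> \<beta> - row \<alpha> \<beta>)"
        "\<chi> y = \<mu> (Poly_Mapping.lookup y (\<alpha>, \<beta>))"
      let ?s = "Poly_Mapping.single (\<gamma>, \<delta>) (r :: 'r)"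
      have s: "?s \<in> elem_P \<alpha> \<beta>" and y: "y \<in> elem_P \<alpha> \<beta>"
        using * by (auto simp: elem_P_eq intro: single_supported)
      then have "\<chi> (?s \<otimes>\<^bsub>McLain\<^esub> y) = \<chi> ?s * \<chi> y" using \<chi> unfolding is_elem_char_def by blast
      then show "\<chi> (?s \<otimes>\<^bsub>McLain\<^esub> y) = \<mu> (Poly_Mapping.lookup (?s \<otimes>\<^bsub>McLain\<^esub> y) (\<alpha>, \<beta>))"
        using * y by (simp add: single elem_P_lookup_mult[OF s] elem_P_Phi linear_char_add[OF assms(1)])
    qed
    then show "\<chi> = ?\<chi>"
      using \<chi> by (auto simp: is_elem_char_def extensional_def fun_eq_iff)
  qed
  then show ?thesis using assms(3) by simp
qed


section \<open>Elementary modules\<close>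

lemma lspan_minimal:
  assumes "B \<subseteq> lspan V C"
  shows "lspan V B \<subseteq> lspan V C"
proof
  fix u assume "u \<in> lspan V B"
  then show "u \<in> lspan V C" by induction (use assms in \<open>auto intro: lspan.intros\<close>)
qed

lemma lspan_act_update: "lspan (V\<lparr>act := a\<rparr>) B = lspan V B"
proof -
  have "lspan (V\<lparr>act := a\<rparr>) B \<subseteq> lspan V B" for V :: "('f::field, 'g, 'v) gmodule" and a and B :: "'v set"
  proof
    fix u assume "u \<in> lspan (V\<lparr>act := a\<rparr>) B"
    then show "u \<in> lspan V B"
      by induction (auto intro: lspan.intros)
  qed
  from this[of a V B] this[of "act V" "V\<lparr>act := a\<rparr>" B] show ?thesis by simp
qed

lemma inv_eq_uminus:
  assumes "x \<in> supported Phi" "J_mult x x = 0"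
  shows "inv\<^bsub>McLain\<^esub> x = - x"
  by (rule M.inv_equality)
    (use assms in \<open>simp_all add: McLain_carrier McLain_one supported_uminus,
      simp add: McLain_mult J_mult_minus_left\<close>)

lemma inv_row:
  assumes "r \<in> supported (row \<alpha> \<beta>)"
  shows "inv\<^bsub>McLain\<^esub> r = - r"
proof (rule inv_eq_uminus)
  show "r \<in> supported Phi" by (rule supported_mono[OF supported_mono[OF assms row_box] box_Phi])
  show "J_mult r r = 0"
  proof (rule J_mult_square_eq_0)
    fix k l assume "k \<in> Poly_Mapping.keys r" "l \<in> Poly_Mapping.keys r"
    then have "k \<in> row \<alpha> \<beta>" "l \<in> row \<alpha> \<beta>" using assms by (auto simp: supported_def)
    then show "snd k \<noteq> fst l" by (auto simp: row_def)
  qed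
qed

text \<open>The vector \<open>char_induction.gen\<close> of the induced module, restated with
  explicit parameters so that a family of modules can be treated at once.\<close>

definition elem_gen ::
    "'l \<Rightarrow> 'l \<Rightarrow> ('r \<Rightarrow> 'f) \<Rightarrow> (('l::linorder \<times> 'l) \<Rightarrow>\<^sub>0 'r::ring_1) \<Rightarrow> ('l, 'r, 'f::field) elem_vec" where
  "elem_gen \<alpha> \<beta> \<mu> g = coset (free.span (induced_relators (McLain\<lparr>carrier := elem_L \<alpha> \<beta>\<rparr>) (elem_P \<alpha> \<beta>)
     (one_dim_gmodule (elem_char \<alpha> \<beta> \<mu>)))) (basis_vec (basis_vec g, 1))"

locale elementary =
  fixes \<alpha> \<beta> :: "'l::linorder" and \<mu> :: "'r::ring_1 \<Rightarrow> 'f::field"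
  assumes lt: "\<alpha> < \<beta>" and lin_char: "linear_char \<mu>"
begin

abbreviation "V \<equiv> elementary_module \<alpha> \<beta> \<mu>"
abbreviation "L \<equiv> (elem_L \<alpha> \<beta> :: (_ \<Rightarrow>\<^sub>0 'r) set)"
abbreviation "P \<equiv> (elem_P \<alpha> \<beta> :: (_ \<Rightarrow>\<^sub>0 'r) set)"
abbreviation "t \<equiv> elem_gen \<alpha> \<beta> \<mu>"

lemma P_subset_L: "P \<subseteq> L"
  unfolding elem_L_eq elem_P_eq by (auto simp: supported_def)

lemma L_Phi: "g \<in> L \<Longrightarrow> g \<in> supported Phi"
  unfolding elem_L_eq by (rule supported_mono[OF _ box_Phi])

lemma char_induction: "char_induction (McLain\<lparr>carrier := L\<rparr>) P (elem_char \<alpha> \<beta> \<mu>)"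
proof (intro char_induction.intro char_induction_axioms.intro)
  show "group (McLain\<lparr>carrier := L\<rparr>)" by (rule M.subgroup_imp_group[OF subgroup_elem_L])
  show "subgroup P (McLain\<lparr>carrier := L\<rparr>)"
    by (rule M.subgroup_incl[OF subgroup_elem_P subgroup_elem_L P_subset_L])
qed (simp_all add: elem_char_eq[OF lin_char lt] linear_char_nonzero[OF lin_char]
    linear_char_add[OF lin_char] elem_P_lookup_mult elem_P_Phi subgroup.m_closed[OF subgroup_elem_P])

interpretation ci: char_induction "McLain\<lparr>carrier := L\<rparr>" P "elem_char \<alpha> \<beta> \<mu>"
  by (rule char_induction)

lemma gen_eq: "ci.gen = t"
  by (rule ext) (simp add: ci.gen_def elem_gen_def)

lemma linear_gmodule: "linear_gmodule (supported Phi) V"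
proof -
  have "elem_proj \<alpha> \<beta> x \<in> L" if "x \<in> supported Phi" for x
    using that by (simp add: elem_proj_eq elem_L_eq cut_supported)
  with ci.linear_gmodule_induced show ?thesis
    unfolding linear_gmodule_def elementary_module_def elem_L_module_def by simp
qed

lemma act_t: "x \<in> supported Phi \<Longrightarrow> act V x (t g) = t (cut (box \<alpha> \<beta>) x \<otimes>\<^bsub>McLain\<^esub> g)"
  using ci.act_gen[of "cut (box \<alpha> \<beta>) x" g, unfolded gen_eq]
  by (simp add: elementary_module_def elem_L_module_def elem_proj_eq)
    (simp add: elem_L_eq cut_supported)

lemma t_carrier: "g \<in> L \<Longrightarrow> t g \<in> carrier V"
  using ci.gen_carrier[of g] by (simp add: elementary_module_def elem_L_module_def gen_eq)

lemma t_mult: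
  assumes "g \<in> L" "p \<in> P"
  shows "t (g \<otimes>\<^bsub>McLain\<^esub> p) = \<mu> (Poly_Mapping.lookup p (\<alpha>, \<beta>)) \<odot>\<^bsub>V\<^esub> t g"
  using ci.gen_mult[of g p] assms
  by (simp add: elementary_module_def elem_L_module_def gen_eq elem_char_eq[OF lin_char lt])

text \<open>A coset \<open>g P\<close> is determined by the row \<open>\<alpha>\<close> of the inverse of \<open>g\<close>, up to its entry at \<open>(\<alpha>, \<beta>)\<close>.\<close>

lemma t_row:
  assumes g: "g \<in> L" and r: "r = - cut (row \<alpha> \<beta>) (inv\<^bsub>McLain\<^esub> g)"
  shows "t g = \<mu> (- Poly_Mapping.lookup (inv\<^bsub>McLain\<^esub> g) (\<alpha>, \<beta>)) \<odot>\<^bsub>V\<^esub> t r"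
proof -
  let ?w = "inv\<^bsub>McLain\<^esub> g"
  have rr: "r \<in> supported (row \<alpha> \<beta>)" unfolding r by (intro supported_uminus cut_supported)
  have rb: "r \<in> supported (box \<alpha> \<beta>)" by (rule supported_mono[OF rr row_box])
  have rc: "r \<in> carrier McLain" unfolding McLain_carrier by (rule supported_mono[OF rb box_Phi])
  have gc: "g \<in> carrier McLain" using L_Phi[OF g] by (simp add: McLain_carrier)
  have w: "?w \<in> supported (box \<alpha> \<beta>)"
    using g by (intro McLain_inv_supported box_Phi trans_box) (simp add: elem_L_eq)
  have J: "Poly_Mapping.lookup (J_mult ?w r) (\<alpha>, \<gamma>) = 0" for \<gamma>
  proof (rule lookup_J_mult_eq_0)
    fix b
    show "Poly_Mapping.lookup ?w (\<alpha>, b) = 0 \<or> Poly_Mapping.lookup r (b, \<gamma>) = 0"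
    proof (cases "b = \<alpha>")
      case True
      then show ?thesis by (intro disjI1 supported_lookup[OF w]) (simp add: box_def)
    next
      case False
      then show ?thesis by (intro disjI2 supported_lookup[OF rr]) (simp add: row_def)
    qed
  qed
  \<comment> \<open>\<open>r\<close> cancels row \<alpha> of the inverse of \<open>g\<close>
    strictly before \<beta>, which says that \<open>g\<close> and \<open>r\<close> lie in the same
    coset of \<open>P\<close>.\<close>
  have wr: "?w \<otimes>\<^bsub>McLain\<^esub> r \<in> P"
    unfolding elem_P_eq in_supported_iff
  proof (intro allI impI)
    fix k assume "k \<notin> box \<alpha> \<beta> - row \<alpha> \<beta>"
    then consider "k \<notin> box \<alpha> \<beta>" | \<gamma> where "k = (\<alpha>, \<gamma>)" "k \<in> row \<alpha> \<beta>" by (auto simp: row_def)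
    then show "Poly_Mapping.lookup (?w \<otimes>\<^bsub>McLain\<^esub> r) k = 0"
    proof cases
      case 1
      with McLain_mult_supported[OF trans_box w rb] show ?thesis by (rule supported_lookup)
    next
      case 2
      then have "Poly_Mapping.lookup r k = - Poly_Mapping.lookup ?w k" by (simp add: r lookup_cut)
      with 2 show ?thesis by (simp add: McLain_mult lookup_add J)
    qed
  qed
  have "t g = t (r \<otimes>\<^bsub>McLain\<^esub> inv\<^bsub>McLain\<^esub> (?w \<otimes>\<^bsub>McLain\<^esub> r))"
    using gc rc by (simp add: M.inv_mult_group flip: M.m_assoc)
  also have "\<dots> = \<mu> (Poly_Mapping.lookup (inv\<^bsub>McLain\<^esub> (?w \<otimes>\<^bsub>McLain\<^esub> r)) (\<alpha>, \<beta>)) \<odot>\<^bsub>V\<^esub> t r"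
    using rb wr by (intro t_mult subgroup.m_inv_closed[OF subgroup_elem_P]) (simp add: elem_L_eq)
  also have "Poly_Mapping.lookup (inv\<^bsub>McLain\<^esub> (?w \<otimes>\<^bsub>McLain\<^esub> r)) (\<alpha>, \<beta>) =
      - Poly_Mapping.lookup ?w (\<alpha>, \<beta>)"
    unfolding elem_P_lookup_inv[OF wr]
    using supported_lookup[OF rr, of "(\<alpha>, \<beta>)"] by (simp add: McLain_mult lookup_add J row_def)
  finally show ?thesis .
qed

lemma row_L: "r \<in> supported (row \<alpha> \<beta>) \<Longrightarrow> r \<in> L"
  unfolding elem_L_eq by (rule supported_mono[OF _ row_box])

lemma carrier_subset_lspan: "carrier V \<subseteq> lspan V (t ` supported (row \<alpha> \<beta>))"
proof -
  have "carrier V \<subseteq> lspan V (t ` L)"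
    using ci.induced_lspan
    by (simp add: elementary_module_def elem_L_module_def gen_eq lspan_act_update)
  moreover have "t g \<in> lspan V (t ` supported (row \<alpha> \<beta>))" if "g \<in> L" for g
    by (subst t_row[OF that refl])
      (intro lspan.smult lspan.base imageI supported_uminus cut_supported)
  ultimately show ?thesis using lspan_minimal[of "t ` L"] by blast
qed

text \<open>The inverse of \<open>g h\<close> is the inverse of \<open>h\<close>, an element of
  \<open>P\<close>, times that of \<open>g\<close>; so the corner entry changes additively and
  \<open>induced_linear_form\<close> applies. The form has the value 1 at every \<open>t r\<close>
  with \<open>r\<close> supported in the row, so it adds up coordinates.\<close>

lemma ex_linear_form:
  "\<exists>\<xi>. linear_form V \<xi> \<and> (\<forall>g. \<xi> (t g) = \<mu> (- Poly_Mapping.lookup (inv\<^bsub>McLain\<^esub> g) (\<alpha>, \<beta>)))"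
proof -
  let ?\<phi> = "\<lambda>g. \<mu> (- Poly_Mapping.lookup (inv\<^bsub>McLain\<^esub> g) (\<alpha>, \<beta>))"
  have "?\<phi> (g \<otimes>\<^bsub>McLain\<^esub> h) = ?\<phi> g * \<mu> (Poly_Mapping.lookup h (\<alpha>, \<beta>))" if g: "g \<in> L" and h: "h \<in> P" for g h
  proof -
    have c: "g \<in> carrier McLain" "h \<in> carrier McLain"
      using L_Phi[OF g] elem_P_Phi[OF h] by (simp_all add: McLain_carrier)
    have "inv\<^bsub>McLain\<^esub> h \<in> P" by (rule subgroup.m_inv_closed[OF subgroup_elem_P h])
    then have "Poly_Mapping.lookup (inv\<^bsub>McLain\<^esub> (g \<otimes>\<^bsub>McLain\<^esub> h)) (\<alpha>, \<beta>) =
        - Poly_Mapping.lookup h (\<alpha>, \<beta>) + Poly_Mapping.lookup (inv\<^bsub>McLain\<^esub> g) (\<alpha>, \<beta>)"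
      using c M.inv_closed[OF c(1)]
      by (simp add: M.inv_mult_group elem_P_lookup_mult McLain_carrier elem_P_lookup_inv[OF h])
    then have "- Poly_Mapping.lookup (inv\<^bsub>McLain\<^esub> (g \<otimes>\<^bsub>McLain\<^esub> h)) (\<alpha>, \<beta>) =
        - Poly_Mapping.lookup (inv\<^bsub>McLain\<^esub> g) (\<alpha>, \<beta>) + Poly_Mapping.lookup h (\<alpha>, \<beta>)" by simp
    then show ?thesis by (simp only: linear_char_add[OF lin_char])
  qed
  then show ?thesis
    using ci.induced_linear_form[of ?\<phi>]
    by (simp add: elementary_module_def elem_L_module_def gen_eq elem_char_eq[OF lin_char lt]
        linear_form_def)
qed

end

text \<open>This is the exponent that appears when the form of
  \<open>elementary.ex_linear_form\<close> is evaluated on a translate of \<open>t r\<close>.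
  Inverting gives \<open>- r\<close> times the truncation of \<open>z\<close>, and neither the
  truncation nor the missing corner of \<open>r\<close> affects the entry in question.\<close>

lemma lookup_inv_box_mult_row:
  assumes r: "r \<in> supported (row \<alpha> \<beta>)" and z: "z \<in> supported Phi"
  shows "- Poly_Mapping.lookup (inv\<^bsub>McLain\<^esub> (cut (box \<alpha> \<beta>) (inv\<^bsub>McLain\<^esub> z) \<otimes>\<^bsub>McLain\<^esub> r)) (\<alpha>, \<beta>) =
    Poly_Mapping.lookup (J_mult r z - z) (\<alpha>, \<beta>)"
proof -
  let ?c = "cut (box \<alpha> \<beta>) z"
  have rc: "r \<in> carrier McLain" unfolding McLain_carrier
    by (rule supported_mono[OF supported_mono[OF r row_box] box_Phi])
  have zc: "?c \<in> carrier McLain" by (simp add: McLain_carrier cut_box_Phi)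
  have "inv\<^bsub>McLain\<^esub> (cut (box \<alpha> \<beta>) (inv\<^bsub>McLain\<^esub> z) \<otimes>\<^bsub>McLain\<^esub> r) = (- r) \<otimes>\<^bsub>McLain\<^esub> ?c"
    using rc zc by (simp add: cut_box_inv[OF z] M.inv_mult_group inv_row[OF r])
  moreover have "Poly_Mapping.lookup (J_mult r ?c) (\<alpha>, \<beta>) = Poly_Mapping.lookup (J_mult r z) (\<alpha>, \<beta>)"
    unfolding lookup_J_mult_keys
  proof (rule sum.cong)
    fix b
    have "Poly_Mapping.lookup r (\<alpha>, b) = 0 \<or> Poly_Mapping.lookup ?c (b, \<beta>) = Poly_Mapping.lookup z (b, \<beta>)"
    proof (cases "\<alpha> < b \<and> b < \<beta>")
      case True
      then show ?thesis by (auto simp: lookup_cut box_def)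
    next
      case False
      then show ?thesis by (intro disjI1 supported_lookup[OF r]) (auto simp: row_def)
    qed
    then show "Poly_Mapping.lookup r (\<alpha>, b) * Poly_Mapping.lookup ?c (b, \<beta>) =
        Poly_Mapping.lookup r (\<alpha>, b) * Poly_Mapping.lookup z (b, \<beta>)" by auto
  qed simp
  moreover have "Poly_Mapping.lookup ?c (\<alpha>, \<beta>) = Poly_Mapping.lookup z (\<alpha>, \<beta>)"
  proof (cases "\<alpha> < \<beta>")
    case True
    then show ?thesis by (simp add: lookup_cut box_def)
  next
    case False
    then have "(\<alpha>, \<beta>) \<notin> Phi" by (simp add: Phi_def)
    from supported_lookup[OF z this] show ?thesis by (simp add: lookup_cut)
  qed
  moreover have "Poly_Mapping.lookup r (\<alpha>, \<beta>) = 0"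
    by (rule supported_lookup[OF r]) (simp add: row_def)
  ultimately show ?thesis
    by (simp add: McLain_mult lookup_add lookup_minus J_mult_minus_left)
qed


section \<open>Basic modules\<close>

lemma linear_forms_agree:
  assumes "linear_gmodule G V" "B \<subseteq> carrier V" "linear_form V \<xi>" "linear_form V \<zeta>"
    "\<And>b. b \<in> B \<Longrightarrow> \<xi> b = c * \<zeta> b" "u \<in> lspan V B"
  shows "\<xi> u = c * \<zeta> u"
  using assms(6)
proof induction
  case (add u v)
  moreover have "u \<in> carrier V" "v \<in> carrier V" using add lspan_subset[OF assms(1,2)] by blast+
  ultimately show ?case using assms(3,4) by (simp add: linear_form_def distrib_left)
next
  case (smult u d)
  moreover have "u \<in> carrier V" using smult lspan_subset[OF assms(1,2)] by blast
  ultimately show ?case using assms(3,4) by (simp add: linear_form_def)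
qed (rule assms(5))

lemma linear_form_act:
  assumes "linear_gmodule G V" "linear_form V \<xi>" "g \<in> G"
  shows "linear_form V (\<lambda>u. \<xi> (act V g u))"
  using assms by (simp add: linear_form_def linear_gmodule_def)

text \<open>Coordinates of a vector with respect to a spanning family, to which independence of
  characters can be applied. Nothing is claimed about uniqueness of \<open>q\<close>; it is enough
  that \<open>q = 0\<close> forces the vector to vanish.\<close>

lemma (in presentation) lspan_normal_form:
  assumes "h ` R \<subseteq> S" "\<psi> \<in> lspan V ((\<lambda>r. cls (basis_vec (h r))) ` R)"
  shows "\<exists>q\<in>free_space R. (\<forall>\<zeta>. linear_form V \<zeta> \<longrightarrow> \<zeta> \<psi> = lin_ext (\<lambda>r. \<zeta> (cls (basis_vec (h r)))) q) \<and>
    (q = 0 \<longrightarrow> \<psi> = \<zero>\<^bsub>V\<^esub>)"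
proof -
  have "\<exists>q\<in>free_space R. \<psi> = cls (push h q)"
    using assms(2)
  proof induction
    case (base b)
    then obtain r where "r \<in> R" "b = cls (basis_vec (h r))" by blast
    then show ?case by (intro bexI[of _ "basis_vec r"]) (simp_all add: push_basis_vec free_space_basis_vec)
  next
    case (add u v)
    then obtain p q where "p \<in> free_space R" "q \<in> free_space R" "u = cls (push h p)" "v = cls (push h q)"
      by blast
    then show ?case by (intro bexI[of _ "p + q"]) (simp_all add: push_add add_cls free_space_add)
  next
    case (smult u c)
    then obtain p where "p \<in> free_space R" "u = cls (push h p)" by blast
    then show ?case by (intro bexI[of _ "scale c p"]) (simp_all add: push_scale smult_cls free_space_scale)
  qed
  then obtain q where q: "q \<in> free_space R" "\<psi> = cls (push h q)" by blast
  have "\<zeta> (cls (push h q)) = lin_ext (\<lambda>r. \<zeta> (cls (basis_vec (h r)))) q" if \<zeta>: "linear_form V \<zeta>" for \<zeta>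
    using q(1)
  proof (induction rule: free_space_induct)
    case zero
    \<comment> \<open>A linear form vanishes at zero, since zero is \<open>0\<close> times
      itself.\<close>
    have "cls 0 \<in> carrier V" by (simp add: carrier_eq)
    then have "\<zeta> (0 \<odot>\<^bsub>V\<^esub> cls 0) = 0 * \<zeta> (cls 0)" using \<zeta> unfolding linear_form_def by blast
    then show ?case by (simp add: smult_cls)
  next
    case (step p c r)
    have 1: "cls (push h p) \<in> carrier V" "cls (basis_vec (h r)) \<in> carrier V"
      unfolding carrier_eq
      using push_free_space[OF step.hyps(1) assms(1)] assms(1) step.hyps
      by (auto intro!: imageI free_space_basis_vec)
    moreover have "c \<odot>\<^bsub>V\<^esub> cls (basis_vec (h r)) \<in> carrier V"
      using 1(2) linear_gmodule by (simp add: linear_gmodule_def)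
    moreover have "cls (push h (scale c (basis_vec r) + p)) =
        c \<odot>\<^bsub>V\<^esub> cls (basis_vec (h r)) \<oplus>\<^bsub>V\<^esub> cls (push h p)"
      by (simp add: push_add push_scale push_basis_vec smult_cls add_cls)
    ultimately show ?case
      using \<zeta> step.IH unfolding linear_form_def by (simp add: lin_ext_add lin_ext_scale lin_ext_basis_vec)
  qed
  with q show ?thesis by (intro bexI[of _ q]) (auto simp: zero_eq)
qed

locale basic_data =
  fixes D :: "('l::linorder \<times> 'l) set" and f :: "'l \<times> 'l \<Rightarrow> 'r::ring_1 \<Rightarrow> 'f::field"
  assumes basic: "basic D" and prim: "\<And>i. i \<in> D \<Longrightarrow> right_primitive (f i)"
begin

abbreviation "V \<equiv> \<lambda>(\<alpha>, \<beta>). elementary_module \<alpha> \<beta> (f (\<alpha>, \<beta>))"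
abbreviation "U \<equiv> basic_module D f"
abbreviation "t i \<equiv> elem_gen (fst i) (snd i) (f i)"
abbreviation "R \<equiv> (\<Pi>\<^sub>E i\<in>D. supported (row (fst i) (snd i)) :: (_ \<Rightarrow>\<^sub>0 'r) set)"

definition T :: "('l \<times> 'l \<Rightarrow> ('l \<times> 'l) \<Rightarrow>\<^sub>0 'r) \<Rightarrow> (('l \<times> 'l \<Rightarrow> ('l, 'r, 'f) elem_vec) \<Rightarrow>\<^sub>0 'f) set" where
  "T g = pure_tensor D V (\<lambda>i\<in>D. t i (g i))"

text \<open>The function of \<open>z\<close> attached to the vector \<open>T r\<close>, as shown in
  \<open>ex_linear_form\<close> below.\<close>

definition weight :: "('l \<times> 'l \<Rightarrow> ('l \<times> 'l) \<Rightarrow>\<^sub>0 'r) \<Rightarrow> (('l \<times> 'l) \<Rightarrow>\<^sub>0 'r) \<Rightarrow> 'f" where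
  "weight r z = (\<Prod>i\<in>D. f i (Poly_Mapping.lookup (J_mult (r i) z - z) i))"

lemma finite_D: "finite D"
  using basic by (simp add: basic_def)

lemma elementary: "i \<in> D \<Longrightarrow> elementary (fst i) (snd i) (f i)"
  using basic prim by (unfold_locales) (auto simp: basic_def Phi_def right_primitive_def)

lemma V_eq: "V i = elementary_module (fst i) (snd i) (f i)"
  by (simp add: case_prod_unfold)

lemma V_linear: "i \<in> D \<Longrightarrow> linear_gmodule (supported Phi) (V i)"
  unfolding V_eq by (rule elementary.linear_gmodule[OF elementary])

lemmas tensor_facts = finite_D V_linear

lemma U_linear: "linear_gmodule (supported Phi) U"
  unfolding basic_module_def by (rule linear_gmodule_tensor[OF tensor_facts])

lemma t_carrier: "(\<And>i. i \<in> D \<Longrightarrow> g i \<in> elem_L (fst i) (snd i)) \<Longrightarrow> (\<lambda>i\<in>D. t i (g i)) \<in> (\<Pi>\<^sub>E i\<in>D. carrier (V i))"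
  by (simp add: V_eq elementary.t_carrier[OF elementary])

lemma T_carrier: "(\<And>i. i \<in> D \<Longrightarrow> g i \<in> elem_L (fst i) (snd i)) \<Longrightarrow> T g \<in> carrier U"
  unfolding basic_module_def T_def by (intro pure_tensor_carrier[OF tensor_facts] t_carrier)

lemma row_L: "r \<in> R \<Longrightarrow> i \<in> D \<Longrightarrow> r i \<in> elem_L (fst i) (snd i)"
  by (rule elementary.row_L[OF elementary]) auto

lemma act_T: "x \<in> supported Phi \<Longrightarrow> act U x (T g) = T (\<lambda>i. cut (box (fst i) (snd i)) x \<otimes>\<^bsub>McLain\<^esub> g i)"
  unfolding basic_module_def T_def
  by (subst act_pure_tensor[OF tensor_facts])
    (auto simp: V_eq elementary.act_t[OF elementary] cong: restrict_cong)

lemma T_cong: "(\<And>i. i \<in> D \<Longrightarrow> t i (g i) = t i (h i)) \<Longrightarrow> T g = T h"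
  unfolding T_def by (simp cong: restrict_cong)

lemma act_act_T:
  assumes "x \<in> supported Phi" "y \<in> supported Phi"
  shows "act U x (act U y (T g)) = act U (x \<otimes>\<^bsub>McLain\<^esub> y) (T g)"
  using assms by (simp add: act_T cut_box_mult McLain_assoc McLain_mult_supported[OF trans_Phi])

lemma carrier_subset_lspan: "carrier U \<subseteq> lspan U (T ` R)"
proof -
  have "carrier U \<subseteq> lspan U (pure_tensor D V ` (\<Pi>\<^sub>E i\<in>D. t i ` supported (row (fst i) (snd i))))"
    unfolding basic_module_def
    by (rule tensor_lspan[OF tensor_facts], assumption)
      (auto simp: V_eq elementary.carrier_subset_lspan[OF elementary]
        intro!: elementary.t_carrier[OF elementary] elementary.row_L[OF elementary])
  moreover have "pure_tensor D V u \<in> T ` R"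
    if "u \<in> (\<Pi>\<^sub>E i\<in>D. t i ` supported (row (fst i) (snd i)))" for u
  proof -
    have "\<forall>i\<in>D. \<exists>r. r \<in> supported (row (fst i) (snd i)) \<and> u i = t i r" using that by (auto simp: PiE_iff)
    from bchoice[OF this]
    obtain r where r: "\<forall>i\<in>D. r i \<in> supported (row (fst i) (snd i)) \<and> u i = t i (r i)"
      by blast
    then have "u = (\<lambda>i\<in>D. t i (restrict r D i))" using that by (auto simp: PiE_iff extensional_def fun_eq_iff)
    then have "pure_tensor D V u = T (restrict r D)" by (simp add: T_def)
    then show ?thesis using r by auto
  qed
  then have "pure_tensor D V ` (\<Pi>\<^sub>E i\<in>D. t i ` supported (row (fst i) (snd i))) \<subseteq> lspan U (T ` R)"
    by (intro image_subsetI lspan.base)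
  ultimately show ?thesis by (rule subset_trans[OF _ lspan_minimal])
qed

text \<open>As the \<open>\<alpha>\<^sub>i\<close> are distinct, one group element can carry prescribed rows for all factors.\<close>

lemma ex_act_T_zero:
  assumes r: "r \<in> R"
  shows "\<exists>x\<in>supported Phi. act U x (T (\<lambda>i. 0)) = T r"
proof -
  \<comment> \<open>By \<open>t_row\<close> a vector \<open>t i g\<close> is governed by row
    \<open>fst i\<close> of the inverse of \<open>g\<close>. So the inverse \<open>z\<close> of the
    acting element is written down first, with row \<open>fst i\<close> equal to that of
    \<open>- r i\<close>.\<close>
  define z where "z = - (\<Sum>i\<in>D. r i)"
  have rP: "r i \<in> supported Phi" if "i \<in> D" for i
    using row_L[OF r that] elementary.L_Phi[OF elementary[OF that]] by blast
  have "sum r D' \<in> supported Phi" if "D' \<subseteq> D" for D'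
    using finite_subset[OF that finite_D] that
    by (induction rule: finite_induct) (auto intro: supported_add rP)
  then have z: "z \<in> supported Phi" unfolding z_def by (intro supported_uminus) blast
  have zi: "Poly_Mapping.lookup z (fst i, \<gamma>) = - Poly_Mapping.lookup (r i) (fst i, \<gamma>)" if i: "i \<in> D" for i \<gamma>
  proof -
    have "Poly_Mapping.lookup (r j) (fst i, \<gamma>) = 0" if "j \<in> D - {i}" for j
    proof -
      have "fst j \<noteq> fst i" using basic i that by (auto simp: basic_def inj_on_def)
      moreover have "r j \<in> supported (row (fst j) (snd j))" using r that by (auto simp: PiE_iff)
      ultimately show ?thesis by (auto simp: row_def intro: supported_lookup)
    qed
    then have "(\<Sum>j\<in>D. Poly_Mapping.lookup (r j) (fst i, \<gamma>)) = Poly_Mapping.lookup (r i) (fst i, \<gamma>)"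
      by (simp add: sum.remove[OF finite_D i])
    then show ?thesis by (simp add: z_def lookup_sum)
  qed
  have "act U (inv\<^bsub>McLain\<^esub> z) (T (\<lambda>i. 0)) = T (\<lambda>i. cut (box (fst i) (snd i)) (inv\<^bsub>McLain\<^esub> z))"
    using McLain_inv_supported[OF subset_refl trans_Phi z] by (simp add: act_T)
  also have "\<dots> = T r"
  proof (rule T_cong)
    fix i assume i: "i \<in> D"
    let ?g = "cut (box (fst i) (snd i)) (inv\<^bsub>McLain\<^esub> z)"
    interpret e: elementary "fst i" "snd i" "f i" by (rule elementary[OF i])
    have ri: "r i \<in> supported (row (fst i) (snd i))" using r i by (auto simp: PiE_iff)
    have gL: "?g \<in> elem_L (fst i) (snd i)" by (simp add: elem_L_eq cut_supported)
    have inv: "inv\<^bsub>McLain\<^esub> ?g = cut (box (fst i) (snd i)) z"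
      unfolding cut_box_inv[OF z] by (rule M.inv_inv) (simp add: McLain_carrier cut_box_Phi)
    have "r i = - cut (row (fst i) (snd i)) (inv\<^bsub>McLain\<^esub> ?g)"
      unfolding inv
    proof (rule poly_mapping_eqI)
      fix k
      show "Poly_Mapping.lookup (r i) k =
          Poly_Mapping.lookup (- cut (row (fst i) (snd i)) (cut (box (fst i) (snd i)) z)) k"
      proof (cases "k \<in> row (fst i) (snd i)")
        case True
        then have "k \<in> box (fst i) (snd i)" "k = (fst i, snd k)" using row_box by (auto simp: row_def)
        with True zi[OF i, of "snd k"] show ?thesis by (simp add: lookup_cut)
      next
        case False
        with supported_lookup[OF ri False] show ?thesis by (simp add: lookup_cut)
      qed
    qed
    from e.t_row[OF gL this]
    have "t i ?g = f i (- Poly_Mapping.lookup (inv\<^bsub>McLain\<^esub> ?g) i)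
        \<odot>\<^bsub>elementary_module (fst i) (snd i) (f i)\<^esub> t i (r i)" by simp
    \<comment> \<open>The corner entry vanishes, so the scalar supplied by \<open>t_row\<close> is
      1.\<close>
    moreover have "(fst i, snd i) \<notin> row (fst i) (snd i)" by (auto simp: row_def prod_eq_iff)
    from supported_lookup[OF ri this]
    have "Poly_Mapping.lookup (inv\<^bsub>McLain\<^esub> ?g) i = 0"
      unfolding inv using zi[OF i, of "snd i"] by (simp add: lookup_cut)
    moreover have "t i (r i) \<in> carrier (elementary_module (fst i) (snd i) (f i))"
      by (rule e.t_carrier[OF e.row_L[OF ri]])
    ultimately show "t i ?g = t i (r i)"
      using e.linear_gmodule by (simp add: linear_char_0[OF e.lin_char] linear_gmodule_def)
  qed
  finally show ?thesis by (rule bexI[OF _ McLain_inv_supported[OF subset_refl trans_Phi z]])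
qed

text \<open>The hypothesis puts the truncation of \<open>x\<close> to each box into the
  corresponding \<open>P\<close>, so every tensor factor of the cyclic generator is multiplied by
  its character.\<close>

lemma act_T_zero_scalar:
  assumes x: "x \<in> supported Phi"
    and 0: "\<And>i \<gamma>. i \<in> D \<Longrightarrow> \<gamma> < snd i \<Longrightarrow> Poly_Mapping.lookup x (fst i, \<gamma>) = 0"
  shows "act U x (T (\<lambda>i. 0)) = (\<Prod>i\<in>D. f i (Poly_Mapping.lookup x i)) \<odot>\<^bsub>U\<^esub> T (\<lambda>i. 0)"
proof -
  have "act U x (T (\<lambda>i. 0)) = T (\<lambda>i. cut (box (fst i) (snd i)) x)"
    using x by (simp add: act_T)
  also have "\<dots> = pure_tensor D V (\<lambda>i\<in>D. f i (Poly_Mapping.lookup x i) \<odot>\<^bsub>V i\<^esub> (\<lambda>i\<in>D. t i 0) i)"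
    unfolding T_def
  proof (rule arg_cong[where f = "pure_tensor D V"], rule restrict_ext)
    fix i assume i: "i \<in> D"
    interpret e: elementary "fst i" "snd i" "f i" by (rule elementary[OF i])
    let ?g = "cut (box (fst i) (snd i)) x"
    have "?g \<in> e.P"
      unfolding elem_P_eq in_supported_iff using 0[OF i] by (auto simp: lookup_cut row_def)
    moreover have "0 \<in> e.L" by (simp add: elem_L_eq)
    ultimately have "t i (0 \<otimes>\<^bsub>McLain\<^esub> ?g) =
        f i (Poly_Mapping.lookup ?g (fst i, snd i)) \<odot>\<^bsub>elementary_module (fst i) (snd i) (f i)\<^esub> t i 0"
      by (intro e.t_mult)
    moreover have "i \<in> box (fst i) (snd i)" using e.lt by (simp add: box_def case_prod_unfold)
    ultimately show "t i ?g = f i (Poly_Mapping.lookup x i) \<odot>\<^bsub>V i\<^esub> (\<lambda>i\<in>D. t i 0) i"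
      using i by (simp add: V_eq lookup_cut)
  qed
  also have "\<dots> = (\<Prod>i\<in>D. f i (Poly_Mapping.lookup x i)) \<odot>\<^bsub>U\<^esub> T (\<lambda>i. 0)"
    unfolding basic_module_def T_def
    by (rule pure_tensor_smult_all[OF tensor_facts], assumption, rule t_carrier) (simp add: elem_L_eq)
  finally show ?thesis .
qed

text \<open>The form is the product of the coordinate sums of the factors. Their values on
  translates are read off from \<open>lookup_inv_box_mult_row\<close>.\<close>

lemma ex_linear_form:
  "\<exists>\<Xi>. linear_form U \<Xi> \<and>
    (\<forall>r\<in>R. \<forall>z\<in>supported Phi. \<Xi> (act U (inv\<^bsub>McLain\<^esub> z) (T r)) = weight r z)"
proof -
  have "\<exists>\<xi>. linear_form (V i) \<xi> \<and>
      (\<forall>g. \<xi> (t i g) = f i (- Poly_Mapping.lookup (inv\<^bsub>McLain\<^esub> g) i))" if "i \<in> D" for i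
    using elementary.ex_linear_form[OF elementary[OF that]] by (simp add: V_eq)
  then have "\<forall>i\<in>D. \<exists>\<xi>. linear_form (V i) \<xi> \<and>
      (\<forall>g. \<xi> (t i g) = f i (- Poly_Mapping.lookup (inv\<^bsub>McLain\<^esub> g) i))" by blast
  from bchoice[OF this] obtain \<xi> where \<xi>: "\<And>i. i \<in> D \<Longrightarrow> linear_form (V i) (\<xi> i)"
    and \<xi>t: "\<And>i g. i \<in> D \<Longrightarrow> \<xi> i (t i g) = f i (- Poly_Mapping.lookup (inv\<^bsub>McLain\<^esub> g) i)"
    by blast
  obtain \<Xi> where \<Xi>: "linear_form U \<Xi>" "\<And>u. \<Xi> (pure_tensor D V u) = (\<Prod>i\<in>D. \<xi> i (u i))"
    using tensor_linear_form[where I = D and V = V and \<xi> = \<xi>, OF tensor_facts \<xi>] unfolding basic_module_def by blast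
  have "\<Xi> (act U (inv\<^bsub>McLain\<^esub> z) (T r)) = weight r z" if r: "r \<in> R" and z: "z \<in> supported Phi" for r z
  proof -
    have "\<Xi> (act U (inv\<^bsub>McLain\<^esub> z) (T r)) =
        (\<Prod>i\<in>D. f i (- Poly_Mapping.lookup (inv\<^bsub>McLain\<^esub> (cut (box (fst i) (snd i)) (inv\<^bsub>McLain\<^esub> z) \<otimes>\<^bsub>McLain\<^esub> r i)) i))"
      using McLain_inv_supported[OF subset_refl trans_Phi z]
      by (simp add: act_T) (simp add: T_def \<Xi>(2) \<xi>t)
    also have "\<dots> = weight r z"
      unfolding weight_def
    proof (rule prod.cong)
      fix i assume "i \<in> D"
      then have "r i \<in> supported (row (fst i) (snd i))" using r by (auto simp: PiE_iff)
      from lookup_inv_box_mult_row[OF this z]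
      show "f i (- Poly_Mapping.lookup (inv\<^bsub>McLain\<^esub> (cut (box (fst i) (snd i)) (inv\<^bsub>McLain\<^esub> z) \<otimes>\<^bsub>McLain\<^esub> r i)) i) =
          f i (Poly_Mapping.lookup (J_mult (r i) z - z) i)" by simp
    qed simp
    finally show ?thesis .
  qed
  with \<Xi>(1) show ?thesis by blast
qed

lemma normal_form:
  assumes "\<psi> \<in> carrier U"
  shows "\<exists>q\<in>free_space R. (\<forall>\<zeta>. linear_form U \<zeta> \<longrightarrow> \<zeta> \<psi> = lin_ext (\<lambda>r. \<zeta> (T r)) q) \<and>
    (q = 0 \<longrightarrow> \<psi> = \<zero>\<^bsub>U\<^esub>)"
proof -
  interpret pr: presentation "\<Pi>\<^sub>E i\<in>D. carrier (V i)" "tensor_relators D V"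
      "\<lambda>g u. \<lambda>i\<in>D. act (V i) g (u i)" "supported Phi"
    by (rule tensor_presentation[OF tensor_facts])
  have U: "U = pr.V" by (simp add: basic_module_def tensor_def)
  have T: "T = (\<lambda>r. pr.cls (basis_vec (\<lambda>i\<in>D. t i (r i))))"
    by (simp add: fun_eq_iff T_def pure_tensor_def)
  have "(\<lambda>r. \<lambda>i\<in>D. t i (r i)) ` R \<subseteq> (\<Pi>\<^sub>E i\<in>D. carrier (V i))"
    using t_carrier row_L by blast
  moreover have "\<psi> \<in> lspan U (T ` R)" using assms carrier_subset_lspan by blast
  ultimately show ?thesis unfolding U T by (rule pr.lspan_normal_form)
qed

end


section \<open>Independence of the characters\<close>

lemma characters_independent:
  fixes \<chi> :: "'i \<Rightarrow> 'a::ab_group_add \<Rightarrow> 'f::field"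
  assumes "finite A" and J: "0 \<in> J" "\<And>x y. x \<in> J \<Longrightarrow> y \<in> J \<Longrightarrow> x + y \<in> J"
    and add: "\<And>r x y. r \<in> A \<Longrightarrow> \<chi> r (x + y) = \<chi> r x * \<chi> r y"
    and one: "\<And>r. r \<in> A \<Longrightarrow> \<chi> r 0 = 1"
    and dist: "\<And>r s. r \<in> A \<Longrightarrow> s \<in> A \<Longrightarrow> r \<noteq> s \<Longrightarrow> \<exists>x\<in>J. \<chi> r x \<noteq> \<chi> s x"
    and "\<And>x. x \<in> J \<Longrightarrow> (\<Sum>r\<in>A. c r * \<chi> r x) = 0"
  shows "r \<in> A \<Longrightarrow> c r = 0"
  using assms(1) add one dist assms(7)
proof (induction A arbitrary: c r rule: finite_induct)
  case (insert a A)
  have c: "c s = 0" if s: "s \<in> A" for s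
  proof -
    obtain y where y: "y \<in> J" "\<chi> s y \<noteq> \<chi> a y" using insert.prems(4)[of s a] insert.hyps s by auto
    have "c s * (\<chi> s y - \<chi> a y) = 0"
    proof (rule insert.IH[OF s])
      fix x assume x: "x \<in> J"
      have "(\<Sum>r\<in>A. c r * (\<chi> r y - \<chi> a y) * \<chi> r x) =
          (\<Sum>r\<in>A. c r * \<chi> r (x + y) - \<chi> a y * (c r * \<chi> r x))"
        by (rule sum.cong) (simp_all add: insert.prems(2) algebra_simps)
      also have "\<dots> = (\<Sum>r\<in>A. c r * \<chi> r (x + y)) - \<chi> a y * (\<Sum>r\<in>A. c r * \<chi> r x)"
        by (simp add: sum_subtractf sum_distrib_left)
      also have "(\<Sum>r\<in>A. c r * \<chi> r (x + y)) = - (c a * \<chi> a (x + y))"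
        using insert.prems(5)[OF J(2)[OF x y(1)]] insert.hyps by (simp add: eq_neg_iff_add_eq_0 add.commute)
      also have "(\<Sum>r\<in>A. c r * \<chi> r x) = - (c a * \<chi> a x)"
        using insert.prems(5)[OF x] insert.hyps by (simp add: eq_neg_iff_add_eq_0 add.commute)
      finally show "(\<Sum>r\<in>A. c r * (\<chi> r y - \<chi> a y) * \<chi> r x) = 0"
        by (simp add: insert.prems(2) algebra_simps)
    qed (use insert.prems in auto)
    with y show ?thesis by simp
  qed
  then have "(\<Sum>r\<in>A. c r * \<chi> r 0) = 0" by simp
  then have "c a = 0" using insert.prems(5)[OF J(1)] insert.prems(3) insert.hyps by simp
  with c insert.prems(1) show ?case by auto
qed simp

text \<open>Otherwise the right ideal generated by \<open>a\<close> would lie in the kernel of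
  \<mu>.\<close>

lemma right_primitive_mult:
  assumes "right_primitive \<mu>" "a \<noteq> 0"
  shows "\<exists>x. \<mu> (a * x) \<noteq> 1"
proof (rule ccontr)
  assume "\<not> (\<exists>x. \<mu> (a * x) \<noteq> 1)"
  then have "range ((*) a) \<subseteq> {r. \<mu> r = 1}" by auto
  moreover have "right_ideal (range ((*) a))"
    unfolding right_ideal_def
  proof (intro conjI ballI allI)
    show "0 \<in> range ((*) a)" by (rule range_eqI[of _ _ 0]) simp
  qed (auto simp: mult.assoc simp flip: distrib_left)
  ultimately have "range ((*) a) = {0}" using assms(1) by (auto simp: right_primitive_def)
  then have "a * 1 = 0" by blast
  with assms(2) show False by simp
qed

section \<open>The weights as distinct characters of \<open>J\<close>\<close>

context basic_data
begin

lemma lin: "i \<in> D \<Longrightarrow> linear_char (f i)"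
  using prim by (simp add: right_primitive_def)

lemma weight_add: "weight r (x + y) = weight r x * weight r y"
  unfolding weight_def prod.distrib[symmetric]
proof (rule prod.cong)
  fix i assume i: "i \<in> D"
  have "Poly_Mapping.lookup (J_mult (r i) (x + y) - (x + y)) i =
      Poly_Mapping.lookup (J_mult (r i) x - x) i + Poly_Mapping.lookup (J_mult (r i) y - y) i"
    by (simp add: J_mult_add_right lookup_add lookup_minus)
  then show "f i (Poly_Mapping.lookup (J_mult (r i) (x + y) - (x + y)) i) =
      f i (Poly_Mapping.lookup (J_mult (r i) x - x) i) * f i (Poly_Mapping.lookup (J_mult (r i) y - y) i)"
    by (simp add: linear_char_add[OF lin[OF i]])
qed simp

lemma weight_zero: "weight r 0 = 1"
  unfolding weight_def by (rule prod.neutral) (simp add: linear_char_0[OF lin])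

lemma row_supported: "r \<in> R \<Longrightarrow> i \<in> D \<Longrightarrow> r i \<in> supported (row (fst i) (snd i))"
  by auto

text \<open>If \<open>r i\<close> and \<open>s i\<close> differ in column \<gamma>, take
  \<open>z\<close> concentrated at \<open>(\<gamma>, snd i)\<close>. Since second components are
  distinct on \<open>D\<close>, only factor \<open>i\<close> sees \<open>z\<close>, and right
  primitivity separates the two values.\<close>

lemma weight_distinct:
  assumes r: "r \<in> R" and s: "s \<in> R" and "r \<noteq> s"
  shows "\<exists>z\<in>supported Phi. weight r z \<noteq> weight s z"
proof -
  obtain i where i: "i \<in> D" "r i \<noteq> s i" using assms PiE_ext[OF r s] by blast
  then obtain k where k: "Poly_Mapping.lookup (r i) k \<noteq> Poly_Mapping.lookup (s i) k"
    by (meson poly_mapping_eqI)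
  have "k \<in> row (fst i) (snd i)"
  proof (rule ccontr)
    assume "k \<notin> row (fst i) (snd i)"
    with supported_lookup[OF row_supported[OF r i(1)]] supported_lookup[OF row_supported[OF s i(1)]] k
    show False by simp
  qed
  then obtain \<gamma> where \<gamma>: "k = (fst i, \<gamma>)" "fst i < \<gamma>" "\<gamma> < snd i" by (auto simp: row_def)
  obtain x where x: "f i ((Poly_Mapping.lookup (r i) k - Poly_Mapping.lookup (s i) k) * x) \<noteq> 1"
    using right_primitive_mult[OF prim[OF i(1)]] k by (metis right_minus_eq)
  define z where "z = Poly_Mapping.single (\<gamma>, snd i) x"
  have w: "weight u z = f i (Poly_Mapping.lookup (u i) k * x)" if "u \<in> R" for u
  proof -
    have "f j (Poly_Mapping.lookup (J_mult (u j) z - z) j) =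
        (if j = i then f i (Poly_Mapping.lookup (u i) k * x) else 1)" if j: "j \<in> D" for j
    proof -
      have "Poly_Mapping.lookup (J_mult (u j) z) (fst j, snd j) =
          Poly_Mapping.lookup (u j) (fst j, \<gamma>) * Poly_Mapping.lookup z (\<gamma>, snd j)"
        by (rule lookup_J_mult_single) (simp add: z_def lookup_single when_def)
      moreover have ji: "j = i" if "snd j = snd i"
        using basic j i(1) that by (auto simp: basic_def inj_on_def)
      \<comment> \<open>This removes the contribution of \<open>- z\<close> itself: the only root of
        \<open>D\<close> in column \<open>snd i\<close> is \<open>i\<close>, and it starts at
        \<open>fst i\<close>, strictly before \<gamma>.\<close>
      have "j \<noteq> (\<gamma>, snd i)"
      proof
        assume "j = (\<gamma>, snd i)"
        then have *: "fst j = \<gamma>" "snd j = snd i" by simp_all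
        from ji[OF *(2)] *(1) \<gamma>(2) show False by simp
      qed
      then have "Poly_Mapping.lookup z j = 0" by (simp add: z_def lookup_single when_def)
      moreover have "Poly_Mapping.lookup z (\<gamma>, snd j) = (if j = i then x else 0)"
        using ji by (auto simp: z_def lookup_single when_def)
      ultimately show ?thesis
        using \<gamma>(1) linear_char_0[OF lin[OF j]] by (simp add: lookup_minus)
    qed
    then have "weight u z = (\<Prod>j\<in>D. if j = i then f i (Poly_Mapping.lookup (u i) k * x) else 1)"
      unfolding weight_def by (intro prod.cong) auto
    then show ?thesis using i(1) finite_D by (simp add: prod.delta)
  qed
  have "weight r z \<noteq> weight s z"
  proof
    assume "weight r z = weight s z"
    moreover have "f i (Poly_Mapping.lookup (r i) k * x) =
        f i ((Poly_Mapping.lookup (r i) k - Poly_Mapping.lookup (s i) k) * x + Poly_Mapping.lookup (s i) k * x)"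
      by (simp add: left_diff_distrib)
    then have "f i (Poly_Mapping.lookup (r i) k * x) =
        f i ((Poly_Mapping.lookup (r i) k - Poly_Mapping.lookup (s i) k) * x) * f i (Poly_Mapping.lookup (s i) k * x)"
      by (simp only: linear_char_add[OF lin[OF i(1)]])
    ultimately show False
      using x linear_char_nonzero[OF lin[OF i(1)]] by (simp add: w[OF r] w[OF s])
  qed
  moreover have "z \<in> supported Phi"
    unfolding z_def by (rule single_supported) (use \<gamma> in \<open>simp add: Phi_def\<close>)
  ultimately show ?thesis by blast
qed

text \<open>Evaluated on translates, a vector with coordinates \<open>q\<close> becomes the
  combination of weights with coefficients \<open>q\<close>. If that is zero everywhere,
  independence gives \<open>q = 0\<close>.\<close>

lemma ex_nonvanishing:
  assumes "linear_form U \<Xi>" and \<Xi>: "\<And>r z. r \<in> R \<Longrightarrow> z \<in> supported Phi \<Longrightarrow> \<Xi> (act U (inv\<^bsub>McLain\<^esub> z) (T r)) = weight r z"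
    and "\<psi> \<in> carrier U" "\<psi> \<noteq> \<zero>\<^bsub>U\<^esub>"
  shows "\<exists>z\<in>supported Phi. \<Xi> (act U (inv\<^bsub>McLain\<^esub> z) \<psi>) \<noteq> 0"
proof (rule ccontr)
  assume *: "\<not> (\<exists>z\<in>supported Phi. \<Xi> (act U (inv\<^bsub>McLain\<^esub> z) \<psi>) \<noteq> 0)"
  obtain q where q: "q \<in> free_space R" "\<And>\<zeta>. linear_form U \<zeta> \<Longrightarrow> \<zeta> \<psi> = lin_ext (\<lambda>r. \<zeta> (T r)) q"
    "q = 0 \<longrightarrow> \<psi> = \<zero>\<^bsub>U\<^esub>"
    using normal_form[OF assms(3)] by blast
  have keys: "Poly_Mapping.keys q \<subseteq> R" using q(1) by (simp add: free_space_def)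
  have "(\<Sum>r\<in>Poly_Mapping.keys q. Poly_Mapping.lookup q r * weight r z) = 0" if z: "z \<in> supported Phi" for z
  proof -
    have iz: "inv\<^bsub>McLain\<^esub> z \<in> supported Phi" by (rule McLain_inv_supported[OF subset_refl trans_Phi z])
    have "lin_ext (\<lambda>r. \<Xi> (act U (inv\<^bsub>McLain\<^esub> z) (T r))) q = 0"
      using q(2)[OF linear_form_act[OF U_linear assms(1) iz]] * z by simp
    then show ?thesis
      unfolding lin_ext_def using keys z by (simp add: \<Xi> subset_iff cong: sum.cong)
  qed
  note vanish = this
  have "Poly_Mapping.lookup q r = 0" if r: "r \<in> Poly_Mapping.keys q" for r
  proof (rule characters_independent[OF finite_keys _ _ _ _ _ _ r])
    show "0 \<in> supported Phi" by simp
    show "x + y \<in> supported Phi" if "x \<in> supported Phi" "y \<in> supported Phi" for x y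
      using that by (rule supported_add)
    show "\<exists>x\<in>supported Phi. weight r x \<noteq> weight s x"
      if "r \<in> Poly_Mapping.keys q" "s \<in> Poly_Mapping.keys q" "r \<noteq> s" for r s
      by (rule weight_distinct) (use that keys in auto)
  qed (simp_all add: weight_add weight_zero vanish)
  then have "Poly_Mapping.lookup q r = 0" for r by (cases "r \<in> Poly_Mapping.keys q") (simp_all add: in_keys_iff)
  then have "q = 0" by (intro poly_mapping_eqI) simp
  with q(3) assms(4) show False by blast
qed

text \<open>Since \<open>q\<close> lives in row \<kappa>, the product of \<open>r j\<close> with
  \<open>q\<close> meets column \<open>snd j\<close> only through the entry of \<open>r j\<close> at
  \<open>(fst j, \<kappa>)\<close>. That entry is zero unless \<open>fst j\<close> is less than
  \<kappa>, and then the hypothesis kills the entry of \<open>q\<close>. So the factor does not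
  depend on \<open>r\<close>.\<close>

lemma weight_shift:
  assumes r: "r \<in> R" and q: "q \<in> supported ({\<kappa>} \<times> UNIV)"
    and 0: "\<And>j. j \<in> D \<Longrightarrow> fst j < \<kappa> \<Longrightarrow> Poly_Mapping.lookup q (\<kappa>, snd j) = 0"
  shows "weight r (z - q) = (\<Prod>j\<in>D. f j (Poly_Mapping.lookup q j)) * weight r z"
proof -
  have "weight r (- q) = (\<Prod>j\<in>D. f j (Poly_Mapping.lookup q j))"
    unfolding weight_def
  proof (rule prod.cong)
    fix j assume j: "j \<in> D"
    have "Poly_Mapping.lookup (J_mult (r j) q) (fst j, snd j) = 0"
    proof (rule lookup_J_mult_eq_0)
      fix b
      consider "b \<noteq> \<kappa>" | "b = \<kappa>" "fst j < \<kappa>" | "b = \<kappa>" "\<not> fst j < \<kappa>" by blast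
      then show "Poly_Mapping.lookup (r j) (fst j, b) = 0 \<or> Poly_Mapping.lookup q (b, snd j) = 0"
      proof cases
        case 1
        then show ?thesis by (intro disjI2 supported_lookup[OF q]) simp
      next
        case 2
        then show ?thesis using 0[OF j] by simp
      next
        case 3
        then show ?thesis by (intro disjI1 supported_lookup[OF row_supported[OF r j]]) (simp add: row_def)
      qed
    qed
    then show "f j (Poly_Mapping.lookup (J_mult (r j) (- q) - - q) j) = f j (Poly_Mapping.lookup q j)"
      by (simp add: J_mult_minus_right lookup_minus lookup_add)
  qed simp
  then show ?thesis using weight_add[of r z "- q"] by simp
qed

lemma prod_row:
  assumes "x \<in> supported ({\<kappa>} \<times> UNIV)"
  shows "(\<kappa>, \<beta>) \<in> D \<Longrightarrow> (\<Prod>i\<in>D. f i (Poly_Mapping.lookup x i)) = f (\<kappa>, \<beta>) (Poly_Mapping.lookup x (\<kappa>, \<beta>))"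
    and "(\<And>j. j \<in> D \<Longrightarrow> fst j = \<kappa> \<Longrightarrow> Poly_Mapping.lookup x j = 0) \<Longrightarrow>
      (\<Prod>i\<in>D. f i (Poly_Mapping.lookup x i)) = 1"
proof -
  have other: "f i (Poly_Mapping.lookup x i) = 1" if "i \<in> D" "fst i \<noteq> \<kappa>" for i
    using that supported_lookup[OF assms, of i] by (cases i) (simp add: linear_char_0[OF lin])
  show "(\<Prod>i\<in>D. f i (Poly_Mapping.lookup x i)) = f (\<kappa>, \<beta>) (Poly_Mapping.lookup x (\<kappa>, \<beta>))"
    if k: "(\<kappa>, \<beta>) \<in> D"
  proof -
    have "(\<Prod>i\<in>D - {(\<kappa>, \<beta>)}. f i (Poly_Mapping.lookup x i)) = 1"
    proof (rule prod.neutral, rule ballI)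
      fix i assume "i \<in> D - {(\<kappa>, \<beta>)}"
      moreover from this have "fst i \<noteq> \<kappa>" using basic k by (auto simp: basic_def inj_on_def)
      ultimately show "f i (Poly_Mapping.lookup x i) = 1" using other by blast
    qed
    then show ?thesis by (simp add: prod.remove[OF finite_D k])
  qed
  show "(\<Prod>i\<in>D. f i (Poly_Mapping.lookup x i)) = 1"
    if "\<And>j. j \<in> D \<Longrightarrow> fst j = \<kappa> \<Longrightarrow> Poly_Mapping.lookup x j = 0"
    by (rule prod.neutral) (use that other in \<open>metis linear_char_0 lin\<close>)
qed

end


section \<open>Homomorphisms between basic modules\<close>

lemma J_mult_row_supported: "y \<in> supported ({\<kappa>} \<times> UNIV) \<Longrightarrow> J_mult y z \<in> supported ({\<kappa>} \<times> UNIV)"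
  unfolding in_supported_iff
proof (intro allI impI)
  fix k :: "'a \<times> 'a"
  assume *: "\<forall>k. k \<notin> {\<kappa>} \<times> UNIV \<longrightarrow> Poly_Mapping.lookup y k = 0" and k: "k \<notin> {\<kappa>} \<times> UNIV"
  obtain a d where "k = (a, d)" by fastforce
  moreover from this have "Poly_Mapping.lookup (J_mult y z) (a, d) = 0"
    using * k by (intro lookup_J_mult_eq_0) simp
  ultimately show "Poly_Mapping.lookup (J_mult y z) k = 0" by simp
qed

text \<open>Needed to extract a nonzero homomorphism from the assumption that the set is not the
  singleton of the zero map.\<close>

lemma zero_hom_mem:
  assumes "linear_gmodule (carrier G) U" "linear_gmodule (carrier G) U'"
  shows "zero_hom U U' \<in> gmodule_hom G U U'"
  using assms linear_gmodule_act_zero[OF assms(2)]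
  by (auto simp: zero_hom_def gmodule_hom_def linear_gmodule_def)

text \<open>The action of \<open>y\<close> on the image of the cyclic generator is computed twice:
  through \<theta> by \<open>act_T_zero_scalar\<close>, and in the target by
  \<open>weight_shift\<close>. The two scalars agree because the form does not vanish at the chosen
  \<open>z\<close>, which is fixed before \<kappa> and \<open>y\<close>.\<close>

lemma hom_relation:
  fixes D D' :: "('l::linorder \<times> 'l) set" and f f' :: "'l \<times> 'l \<Rightarrow> 'r::ring_1 \<Rightarrow> 'f::field"
  assumes "basic_data D f" "basic_data D' f'"
    and \<theta>: "\<theta> \<in> gmodule_hom McLain (basic_module D f) (basic_module D' f')"
    and nz: "\<theta> \<noteq> zero_hom (basic_module D f) (basic_module D' f')"
  obtains z where "z \<in> supported Phi"
    "\<And>\<kappa> y. y \<in> supported ({\<kappa>} \<times> UNIV \<inter> Phi) \<Longrightarrow>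
      (\<And>i \<gamma>. i \<in> D \<Longrightarrow> \<gamma> < snd i \<Longrightarrow> Poly_Mapping.lookup y (fst i, \<gamma>) = 0) \<Longrightarrow>
      (\<And>j. j \<in> D' \<Longrightarrow> fst j < \<kappa> \<Longrightarrow> Poly_Mapping.lookup (y + J_mult y z) (\<kappa>, snd j) = 0) \<Longrightarrow>
      (\<Prod>i\<in>D. f i (Poly_Mapping.lookup y i)) = (\<Prod>j\<in>D'. f' j (Poly_Mapping.lookup (y + J_mult y z) j))"
proof -
  interpret a: basic_data D f by fact
  interpret b: basic_data D' f' by fact
  have \<theta>_carrier: "\<theta> u \<in> carrier b.U" if "u \<in> carrier a.U" for u
    using \<theta> that by (auto simp: gmodule_hom_def PiE_iff)
  have \<theta>_add: "\<theta> (u \<oplus>\<^bsub>a.U\<^esub> v) = \<theta> u \<oplus>\<^bsub>b.U\<^esub> \<theta> v" if "u \<in> carrier a.U" "v \<in> carrier a.U" for u v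
    using \<theta> that by (simp add: gmodule_hom_def)
  have \<theta>_smult: "\<theta> (c \<odot>\<^bsub>a.U\<^esub> u) = c \<odot>\<^bsub>b.U\<^esub> \<theta> u" if "u \<in> carrier a.U" for c u
    using \<theta> that by (simp add: gmodule_hom_def)
  have \<theta>_act: "\<theta> (act a.U x u) = act b.U x (\<theta> u)" if "x \<in> supported Phi" "u \<in> carrier a.U" for x u
    using \<theta> that by (simp add: gmodule_hom_def McLain_carrier)
  define \<psi> where "\<psi> = \<theta> (a.T (\<lambda>i. 0))"
  have T0: "a.T (\<lambda>i. 0) \<in> carrier a.U" by (rule a.T_carrier) (simp add: elem_L_eq)
  then have \<psi>: "\<psi> \<in> carrier b.U" unfolding \<psi>_def by (rule \<theta>_carrier)
  \<comment> \<open>By \<open>ex_act_T_zero\<close> the translates of the generator span the source,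
    so \<theta> would vanish together with \<psi>.\<close>
  have "\<psi> \<noteq> \<zero>\<^bsub>b.U\<^esub>"
  proof
    assume \<psi>0: "\<psi> = \<zero>\<^bsub>b.U\<^esub>"
    have TR: "a.T ` a.R \<subseteq> carrier a.U" using a.T_carrier a.row_L by blast
    have "\<theta> u = \<zero>\<^bsub>b.U\<^esub>" if "u \<in> lspan a.U (a.T ` a.R)" for u
      using that
    proof induction
      case (base u)
      then obtain r where "r \<in> a.R" "u = a.T r" by blast
      then obtain x where "x \<in> supported Phi" "u = act a.U x (a.T (\<lambda>i. 0))"
        using a.ex_act_T_zero[of r] by auto
      then show ?case
        using \<theta>_act[OF _ T0] \<psi>0 linear_gmodule_act_zero[OF b.U_linear] by (simp add: \<psi>_def)
    next
      case (add u v)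
      moreover have "u \<in> carrier a.U" "v \<in> carrier a.U"
        using add lspan_subset[OF a.U_linear TR] by blast+
      ultimately show ?case using \<theta>_add b.U_linear by (simp add: linear_gmodule_def)
    next
      case (smult u c)
      moreover have "u \<in> carrier a.U" using smult lspan_subset[OF a.U_linear TR] by blast
      ultimately show ?case using \<theta>_smult b.U_linear by (simp add: linear_gmodule_def)
    qed
    then have "\<theta> u = zero_hom a.U b.U u" if "u \<in> carrier a.U" for u
      using that a.carrier_subset_lspan by (auto simp: zero_hom_def)
    moreover have "\<theta> u = zero_hom a.U b.U u" if "u \<notin> carrier a.U" for u
      using that \<theta> by (auto simp: zero_hom_def gmodule_hom_def PiE_iff extensional_def)
    ultimately show False using nz by blast
  qed
  obtain \<Xi> where \<Xi>: "linear_form b.U \<Xi>"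
    "\<And>r z. r \<in> b.R \<Longrightarrow> z \<in> supported Phi \<Longrightarrow> \<Xi> (act b.U (inv\<^bsub>McLain\<^esub> z) (b.T r)) = b.weight r z"
    using b.ex_linear_form by blast
  obtain z where z: "z \<in> supported Phi" "\<Xi> (act b.U (inv\<^bsub>McLain\<^esub> z) \<psi>) \<noteq> 0"
    using b.ex_nonvanishing[OF \<Xi> \<psi> \<open>\<psi> \<noteq> \<zero>\<^bsub>b.U\<^esub>\<close>] by blast
  have iz: "inv\<^bsub>McLain\<^esub> z \<in> supported Phi" by (rule McLain_inv_supported[OF subset_refl trans_Phi z(1)])
  show thesis
  proof (rule that[OF z(1)])
    fix \<kappa> y
    assume y: "y \<in> supported ({\<kappa>} \<times> UNIV \<inter> Phi)"
      and D0: "\<And>i \<gamma>. i \<in> D \<Longrightarrow> \<gamma> < snd i \<Longrightarrow> Poly_Mapping.lookup y (fst i, \<gamma>) = 0"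
      and D'0: "\<And>j. j \<in> D' \<Longrightarrow> fst j < \<kappa> \<Longrightarrow> Poly_Mapping.lookup (y + J_mult y z) (\<kappa>, snd j) = 0"
    let ?q = "y + J_mult y z"
    let ?c = "\<Prod>i\<in>D. f i (Poly_Mapping.lookup y i)" and ?c' = "\<Prod>j\<in>D'. f' j (Poly_Mapping.lookup ?q j)"
    have yP: "y \<in> supported Phi" and y\<kappa>: "y \<in> supported ({\<kappa>} \<times> UNIV)"
      using y by (auto intro: supported_mono)
    have q: "?q \<in> supported ({\<kappa>} \<times> UNIV)" by (intro supported_add y\<kappa> J_mult_row_supported)
    have qP: "z - ?q \<in> supported Phi"
      unfolding diff_conv_add_uminus[of z]
      by (intro supported_add supported_uminus J_mult_supported trans_Phi yP z(1))
    \<comment> \<open>With square zero, \<open>1 + y\<close> has inverse \<open>1 - y\<close>, and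
      \<open>(1 - y) (1 + z)\<close> is \<open>1 + (z - q)\<close> for \<open>q = y + y z\<close>.
      This is how the action of \<open>y\<close> becomes a shift of \<open>z\<close>.\<close>
    have "J_mult y y = 0"
    proof (rule J_mult_square_eq_0)
      fix k l assume "k \<in> Poly_Mapping.keys y" "l \<in> Poly_Mapping.keys y"
      then have "k \<in> {\<kappa>} \<times> UNIV \<inter> Phi" "l \<in> {\<kappa>} \<times> UNIV \<inter> Phi" using y by (auto simp: supported_def)
      then show "snd k \<noteq> fst l" by (auto simp: Phi_def)
    qed
    then have "inv\<^bsub>McLain\<^esub> y \<otimes>\<^bsub>McLain\<^esub> z = z - ?q"
      using inv_eq_uminus[OF yP] by (simp add: McLain_mult J_mult_minus_left)
    moreover have "inv\<^bsub>McLain\<^esub> (inv\<^bsub>McLain\<^esub> y \<otimes>\<^bsub>McLain\<^esub> z) = inv\<^bsub>McLain\<^esub> z \<otimes>\<^bsub>McLain\<^esub> y"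
      using yP z(1) unfolding McLain_carrier[symmetric] by (simp add: M.inv_mult_group)
    ultimately have inv: "inv\<^bsub>McLain\<^esub> z \<otimes>\<^bsub>McLain\<^esub> y = inv\<^bsub>McLain\<^esub> (z - ?q)" by simp
    let ?\<zeta> = "\<lambda>u. \<Xi> (act b.U (inv\<^bsub>McLain\<^esub> z) u)"
    have \<zeta>: "linear_form b.U ?\<zeta>" by (rule linear_form_act[OF b.U_linear \<Xi>(1) iz])
    have "act b.U y \<psi> = ?c \<odot>\<^bsub>b.U\<^esub> \<psi>"
      unfolding \<psi>_def
      using a.act_T_zero_scalar[OF yP D0] \<theta>_act[OF yP T0] \<theta>_smult[OF T0] by simp
    then have "?\<zeta> (act b.U y \<psi>) = ?c * ?\<zeta> \<psi>" using \<zeta> \<psi> by (simp add: linear_form_def)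
    moreover have "?\<zeta> (act b.U y \<psi>) = ?c' * ?\<zeta> \<psi>"
    proof (rule linear_forms_agree[OF b.U_linear _ linear_form_act[OF b.U_linear \<zeta> yP] \<zeta>])
      show "b.T ` b.R \<subseteq> carrier b.U" using b.T_carrier b.row_L by blast
      show "\<psi> \<in> lspan b.U (b.T ` b.R)" using \<psi> b.carrier_subset_lspan by blast
      fix u assume "u \<in> b.T ` b.R"
      then obtain r where r: "r \<in> b.R" and u: "u = b.T r" by blast
      show "?\<zeta> (act b.U y u) = ?c' * ?\<zeta> u"
        unfolding u b.act_act_T[OF iz yP] inv \<Xi>(2)[OF r qP] \<Xi>(2)[OF r z(1)]
        by (rule b.weight_shift[OF r q D'0])
    qed
    ultimately show "?c = ?c'" using z(2) by simp
  qed
qed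

text \<open>The unknowns are the entries of row \<kappa>. As \<open>z\<close> is strictly upper
  triangular, the equation for column \<open>b\<close> involves the unknowns up to \<open>b\<close>
  only and has coefficient 1 at the unknown of column \<open>b\<close>, so the columns of
  \<open>B\<close> can be treated in increasing order.\<close>

lemma triangular_solution:
  fixes z :: "('l::linorder \<times> 'l) \<Rightarrow>\<^sub>0 'r::ring_1"
  assumes "finite B" "\<beta> \<notin> B" and z: "z \<in> supported Phi"
  shows "\<exists>y. y \<in> supported ({\<kappa>} \<times> {\<beta>..}) \<and> Poly_Mapping.lookup y (\<kappa>, \<beta>) = s \<and>
    (\<forall>b\<in>B. Poly_Mapping.lookup (y + J_mult y z) (\<kappa>, b) = 0)"
  using assms(1,2)
proof (induction B rule: finite_linorder_max_induct)
  case empty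
  show ?case by (rule exI[of _ "Poly_Mapping.single (\<kappa>, \<beta>) s"]) (simp add: single_supported)
next
  case (insert b B)
  then obtain y where y: "y \<in> supported ({\<kappa>} \<times> {\<beta>..})" "Poly_Mapping.lookup y (\<kappa>, \<beta>) = s"
    "\<forall>b\<in>B. Poly_Mapping.lookup (y + J_mult y z) (\<kappa>, b) = 0" by auto
  have z0: "Poly_Mapping.lookup z (c, d) = 0" if "d \<le> c" for c d
    by (rule supported_lookup[OF z]) (use that in \<open>simp add: Phi_def\<close>)
  have y0: "Poly_Mapping.lookup y (\<kappa>, c) = 0" if "c < \<beta>" for c
    by (rule supported_lookup[OF y(1)]) (use that in simp)
  show ?case
  proof (cases "b < \<beta>")
    \<comment> \<open>Before column \<beta> the equation holds automatically, because
      \<open>y\<close> starts at \<beta>.\<close>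
    case True
    have "Poly_Mapping.lookup (J_mult y z) (\<kappa>, b) = 0"
    proof (rule lookup_J_mult_eq_0)
      fix c show "Poly_Mapping.lookup y (\<kappa>, c) = 0 \<or> Poly_Mapping.lookup z (c, b) = 0"
        using y0[of c] z0[of b c] True by (cases "c < \<beta>") auto
    qed
    with y y0[OF True] show ?thesis by (intro exI[of _ y]) (simp add: lookup_add)
  next
    case False
    then have b: "\<beta> < b" using insert.prems by auto
    \<comment> \<open>The defect at column \<open>b\<close>. Removing it at \<open>b\<close> changes
      no equation for a smaller column, nor the prescribed entry at \<beta>.\<close>
    define e where "e = Poly_Mapping.lookup (y + J_mult y z) (\<kappa>, b)"
    let ?s = "Poly_Mapping.single (\<kappa>, b) (- e)"
    have s: "Poly_Mapping.lookup (J_mult ?s z) (\<kappa>, c) = 0" if "c \<le> b" for c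
      by (subst lookup_J_mult_single[of b]) (simp_all add: lookup_single when_def z0[OF that])
    have "Poly_Mapping.lookup (y + ?s + J_mult (y + ?s) z) (\<kappa>, c) = 0" if "c \<in> insert b B" for c
    proof (cases "c = b")
      case True
      have "Poly_Mapping.lookup y (\<kappa>, b) + Poly_Mapping.lookup (J_mult y z) (\<kappa>, b) = e"
        by (simp add: e_def lookup_add)
      with True s[of b] show ?thesis by (simp add: lookup_add J_mult_add_left diff_add_eq)
    next
      case False
      then have "c \<in> B" "c < b" "b \<noteq> c" using that insert.hyps by auto
      then show ?thesis using y(3) s[of c] by (simp add: lookup_add J_mult_add_left lookup_single when_def)
    qed
    moreover have "y + ?s \<in> supported ({\<kappa>} \<times> {\<beta>..})"
      by (intro supported_add y(1) single_supported) (use b in simp)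
    moreover have "Poly_Mapping.lookup (y + ?s) (\<kappa>, \<beta>) = s"
      using y(2) b less_imp_neq[OF b] by (simp add: lookup_add lookup_single when_def)
    ultimately show ?thesis by blast
  qed
qed

text \<open>At the least row \<kappa> where the data disagree, a row \<open>y\<close> is chosen
  whose two products in \<open>rel\<close> differ. There are three cases: both sets have the same
  root in row \<kappa> with different characters, the root of \<open>D\<close> is not in
  \<open>D'\<close>, or \<open>D\<close> has no root in this row.\<close>

lemma basic_data_unique:
  fixes D D' :: "('l::linorder \<times> 'l) set" and f f' :: "'l \<times> 'l \<Rightarrow> 'r::ring_1 \<Rightarrow> 'f::field"
  assumes "basic_data D f" "basic_data D' f'" and z: "z \<in> supported Phi"
    and rel: "\<And>\<kappa> y. y \<in> supported ({\<kappa>} \<times> UNIV \<inter> Phi) \<Longrightarrow>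
      (\<And>i \<gamma>. i \<in> D \<Longrightarrow> \<gamma> < snd i \<Longrightarrow> Poly_Mapping.lookup y (fst i, \<gamma>) = 0) \<Longrightarrow>
      (\<And>j. j \<in> D' \<Longrightarrow> fst j < \<kappa> \<Longrightarrow> Poly_Mapping.lookup (y + J_mult y z) (\<kappa>, snd j) = 0) \<Longrightarrow>
      (\<Prod>i\<in>D. f i (Poly_Mapping.lookup y i)) = (\<Prod>j\<in>D'. f' j (Poly_Mapping.lookup (y + J_mult y z) j))"
  shows "D = D' \<and> (\<forall>i\<in>D. f i = f' i)"
proof -
  interpret a: basic_data D f by fact
  interpret b: basic_data D' f' by fact
  have injD: "i = j" if "i \<in> D" "j \<in> D" "fst i = fst j \<or> snd i = snd j" for i j
    using a.basic that by (auto simp: basic_def inj_on_def)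
  have injD': "i = j" if "i \<in> D'" "j \<in> D'" "fst i = fst j \<or> snd i = snd j" for i j
    using b.basic that by (auto simp: basic_def inj_on_def)
  have D_lt: "\<gamma> < \<delta>" if "(\<gamma>, \<delta>) \<in> D \<or> (\<gamma>, \<delta>) \<in> D'" for \<gamma> \<delta>
    using a.basic b.basic that by (auto simp: basic_def Phi_def)
  have nontrivial: "\<exists>s. \<mu> s \<noteq> 1" if "right_primitive \<mu>" for \<mu> :: "'r \<Rightarrow> 'f"
    using right_primitive_mult[OF that, of 1] by simp
  define agree where "agree \<kappa> \<longleftrightarrow>
    (\<forall>\<beta>. ((\<kappa>, \<beta>) \<in> D \<longleftrightarrow> (\<kappa>, \<beta>) \<in> D') \<and> ((\<kappa>, \<beta>) \<in> D \<longrightarrow> f (\<kappa>, \<beta>) = f' (\<kappa>, \<beta>)))" for \<kappa>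
  have "agree \<kappa>" for \<kappa>
  proof (rule ccontr)
    assume "\<not> agree \<kappa>"
    let ?bad = "{\<kappa>. \<not> agree \<kappa>}"
    have "?bad \<subseteq> fst ` (D \<union> D')" by (force simp: agree_def)
    then have fin: "finite ?bad" by (rule finite_subset) (simp add: a.finite_D b.finite_D)
    define \<kappa> where "\<kappa> = Min ?bad"
    have "\<kappa> \<in> ?bad" unfolding \<kappa>_def using fin \<open>\<not> agree _\<close> by (intro Min_in) auto
    then have bad: "\<not> agree \<kappa>" by simp
    have less: "agree \<gamma>" if "\<gamma> < \<kappa>" for \<gamma>
      by (rule ccontr) (use Min_le[OF fin, of \<gamma>] that in \<open>simp add: \<kappa>_def\<close>)
    \<comment> \<open>Here \<open>q\<close> is \<open>y + y z\<close>. It has the same entry as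
      \<open>y\<close> in column \<beta>, where \<open>y\<close> starts; the other columns to be
      cleared are collected in \<open>B\<close>. The condition on \<open>D\<close> makes
      \<open>y\<close> act on the cyclic generator by a scalar.\<close>
    have test: "\<exists>y q. y \<in> supported ({\<kappa>} \<times> UNIV) \<and> q \<in> supported ({\<kappa>} \<times> UNIV) \<and>
        Poly_Mapping.lookup y (\<kappa>, \<beta>) = s \<and> Poly_Mapping.lookup q (\<kappa>, \<beta>) = s \<and>
        (\<forall>b\<in>B. Poly_Mapping.lookup q (\<kappa>, b) = 0) \<and>
        (\<Prod>i\<in>D. f i (Poly_Mapping.lookup y i)) = (\<Prod>j\<in>D'. f' j (Poly_Mapping.lookup q j))"
      if B: "finite B" "\<beta> \<notin> B" and lt: "\<kappa> < \<beta>"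
        and le: "\<And>i. i \<in> D \<Longrightarrow> fst i = \<kappa> \<Longrightarrow> snd i \<le> \<beta>"
        and old: "\<And>j. j \<in> D' \<Longrightarrow> fst j < \<kappa> \<Longrightarrow> snd j \<in> B" for B \<beta> s
    proof -
      obtain y where y: "y \<in> supported ({\<kappa>} \<times> {\<beta>..})" "Poly_Mapping.lookup y (\<kappa>, \<beta>) = s"
        "\<forall>b\<in>B. Poly_Mapping.lookup (y + J_mult y z) (\<kappa>, b) = 0"
        using triangular_solution[OF B z] by blast
      have y\<kappa>: "y \<in> supported ({\<kappa>} \<times> UNIV)" by (rule supported_mono[OF y(1)]) auto
      have "Poly_Mapping.lookup (J_mult y z) (\<kappa>, \<beta>) = 0"
      proof (rule lookup_J_mult_eq_0)
        fix c
        show "Poly_Mapping.lookup y (\<kappa>, c) = 0 \<or> Poly_Mapping.lookup z (c, \<beta>) = 0"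
        proof (cases "c < \<beta>")
          case True
          then show ?thesis by (intro disjI1 supported_lookup[OF y(1)]) simp
        next
          case False
          then show ?thesis by (intro disjI2 supported_lookup[OF z]) (simp add: Phi_def)
        qed
      qed
      then have q: "Poly_Mapping.lookup (y + J_mult y z) (\<kappa>, \<beta>) = s" by (simp add: lookup_add y(2))
      have "(\<Prod>i\<in>D. f i (Poly_Mapping.lookup y i)) = (\<Prod>j\<in>D'. f' j (Poly_Mapping.lookup (y + J_mult y z) j))"
      proof (rule rel)
        show "y \<in> supported ({\<kappa>} \<times> UNIV \<inter> Phi)"
          by (rule supported_mono[OF y(1)]) (use lt in \<open>auto simp: Phi_def\<close>)
        show "Poly_Mapping.lookup y (fst i, \<gamma>) = 0" if "i \<in> D" "\<gamma> < snd i" for i \<gamma>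
          by (rule supported_lookup[OF y(1)]) (use that le[of i] in auto)
        show "Poly_Mapping.lookup (y + J_mult y z) (\<kappa>, snd j) = 0" if "j \<in> D'" "fst j < \<kappa>" for j
          using y(3) old[OF that] by blast
      qed
      with y y\<kappa> q J_mult_row_supported[OF y\<kappa>] show ?thesis
        by (intro exI[of _ y] exI[of _ "y + J_mult y z"]) (simp add: supported_add)
    qed
    show False
    proof (cases "\<exists>\<beta>. (\<kappa>, \<beta>) \<in> D")
      case True
      then obtain \<beta> where \<beta>: "(\<kappa>, \<beta>) \<in> D" by blast
      then have \<beta>lt: "\<kappa> < \<beta>" using D_lt by blast
      have le: "snd i \<le> \<beta>" if "i \<in> D" "fst i = \<kappa>" for i using injD[OF that(1) \<beta>] that by simp
      \<comment> \<open>Rows before \<kappa> agree, so earlier roots of \<open>D'\<close> belong to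
        \<open>D\<close>; as \<open>D\<close> is basic, none of them uses column \<beta>, which may
        then be prescribed freely.\<close>
      have old: "j \<in> D" if "j \<in> D'" "fst j < \<kappa>" for j
        using less[OF that(2)] that(1) by (cases j) (simp add: agree_def)
      have \<beta>old: "snd j \<noteq> \<beta>" if "j \<in> D'" "fst j < \<kappa>" for j
      proof
        assume "snd j = \<beta>"
        then have "j = (\<kappa>, \<beta>)" by (intro injD[OF old[OF that] \<beta>]) simp
        with that(2) show False by simp
      qed
      show False
      proof (cases "(\<kappa>, \<beta>) \<in> D'")
        case \<beta>': True
        have "f (\<kappa>, \<beta>) \<noteq> f' (\<kappa>, \<beta>)"
        proof
          assume eq: "f (\<kappa>, \<beta>) = f' (\<kappa>, \<beta>)"
          have uniq: "(\<kappa>, \<gamma>) \<in> D \<longleftrightarrow> \<gamma> = \<beta>" "(\<kappa>, \<gamma>) \<in> D' \<longleftrightarrow> \<gamma> = \<beta>" for \<gamma>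
            using injD[of "(\<kappa>, \<gamma>)", OF _ \<beta>] injD'[of "(\<kappa>, \<gamma>)", OF _ \<beta>'] \<beta> \<beta>' by auto
          have "agree \<kappa>" unfolding agree_def uniq by (simp add: eq)
          with bad show False by blast
        qed
        then obtain s where s: "f (\<kappa>, \<beta>) s \<noteq> f' (\<kappa>, \<beta>) s" by blast
        \<comment> \<open>Clearing just the columns of earlier roots leaves one factor on each side,
          with the same argument \<open>s\<close>.\<close>
        have "finite (snd ` {j \<in> D'. fst j < \<kappa>})" "\<beta> \<notin> snd ` {j \<in> D'. fst j < \<kappa>}"
          "\<And>j. j \<in> D' \<Longrightarrow> fst j < \<kappa> \<Longrightarrow> snd j \<in> snd ` {j \<in> D'. fst j < \<kappa>}"
          using b.finite_D \<beta>old by auto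
        from test[OF this(1,2) \<beta>lt le this(3)]
        obtain y q where "y \<in> supported ({\<kappa>} \<times> UNIV)" "q \<in> supported ({\<kappa>} \<times> UNIV)"
          "Poly_Mapping.lookup y (\<kappa>, \<beta>) = s" "Poly_Mapping.lookup q (\<kappa>, \<beta>) = s"
          "(\<Prod>i\<in>D. f i (Poly_Mapping.lookup y i)) = (\<Prod>j\<in>D'. f' j (Poly_Mapping.lookup q j))"
          by blast
        with s show False by (simp add: a.prod_row(1)[OF _ \<beta>] b.prod_row(1)[OF _ \<beta>'])
      next
        case False
        \<comment> \<open>Here the column of a possible root of \<open>D'\<close> in row \<kappa>
          itself is cleared as well, which makes the right-hand product 1. It differs from \<beta>
          since \<open>(\<kappa>, \<beta>)\<close> is not in \<open>D'\<close>.\<close>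
        obtain s where s: "f (\<kappa>, \<beta>) s \<noteq> 1" using nontrivial[OF a.prim[OF \<beta>]] by blast
        have "snd j \<noteq> \<beta>" if "j \<in> D'" "fst j \<le> \<kappa>" for j
          using \<beta>old[of j] that False by (cases j) (auto simp: le_less)
        then have "finite (snd ` {j \<in> D'. fst j \<le> \<kappa>})" "\<beta> \<notin> snd ` {j \<in> D'. fst j \<le> \<kappa>}"
          "\<And>j. j \<in> D' \<Longrightarrow> fst j < \<kappa> \<Longrightarrow> snd j \<in> snd ` {j \<in> D'. fst j \<le> \<kappa>}"
          using b.finite_D by auto
        from test[OF this(1,2) \<beta>lt le this(3)]
        obtain y q where *: "y \<in> supported ({\<kappa>} \<times> UNIV)" "q \<in> supported ({\<kappa>} \<times> UNIV)"
          "Poly_Mapping.lookup y (\<kappa>, \<beta>) = s" "\<forall>b\<in>snd ` {j \<in> D'. fst j \<le> \<kappa>}. Poly_Mapping.lookup q (\<kappa>, b) = 0"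
          "(\<Prod>i\<in>D. f i (Poly_Mapping.lookup y i)) = (\<Prod>j\<in>D'. f' j (Poly_Mapping.lookup q j))"
          by blast
        have "(\<Prod>j\<in>D'. f' j (Poly_Mapping.lookup q j)) = 1"
          by (rule b.prod_row(2)[OF *(2)]) (use *(4) in force)
        with * s show False by (simp add: a.prod_row(1)[OF _ \<beta>])
      qed
    next
      case False
      \<comment> \<open>Now the starting column comes from \<open>D'\<close>. No root of
        \<open>D\<close> lies in row \<kappa>, so the left-hand product is 1 and the bound on its
        column is vacuous.\<close>
      then obtain \<beta> where \<beta>: "(\<kappa>, \<beta>) \<in> D'" using bad by (auto simp: agree_def)
      obtain s where s: "f' (\<kappa>, \<beta>) s \<noteq> 1" using nontrivial[OF b.prim[OF \<beta>]] by blast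
      have "snd j \<noteq> \<beta>" if "j \<in> D'" "fst j < \<kappa>" for j
      proof
        assume "snd j = \<beta>"
        then have "j = (\<kappa>, \<beta>)" by (intro injD'[OF that(1) \<beta>]) simp
        with that(2) show False by simp
      qed
      then have "finite (snd ` {j \<in> D'. fst j < \<kappa>})" "\<beta> \<notin> snd ` {j \<in> D'. fst j < \<kappa>}"
        "\<And>j. j \<in> D' \<Longrightarrow> fst j < \<kappa> \<Longrightarrow> snd j \<in> snd ` {j \<in> D'. fst j < \<kappa>}"
        using b.finite_D by auto
      note old = this
      have new: "fst i \<noteq> \<kappa>" if "i \<in> D" for i using False that by (cases i) auto
      then have le: "snd i \<le> \<beta>" if "i \<in> D" "fst i = \<kappa>" for i using that by blast
      have "\<kappa> < \<beta>" using D_lt \<beta> by blast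
      from test[OF old(1,2) this le old(3)]
      obtain y q where *: "y \<in> supported ({\<kappa>} \<times> UNIV)" "q \<in> supported ({\<kappa>} \<times> UNIV)"
        "Poly_Mapping.lookup q (\<kappa>, \<beta>) = s"
        "(\<Prod>i\<in>D. f i (Poly_Mapping.lookup y i)) = (\<Prod>j\<in>D'. f' j (Poly_Mapping.lookup q j))"
        by blast
      have "(\<Prod>i\<in>D. f i (Poly_Mapping.lookup y i)) = 1"
        by (rule a.prod_row(2)[OF *(1)]) (use new in blast)
      with * s show False by (simp add: b.prod_row(1)[OF _ \<beta>])
    qed
  qed
  then show ?thesis by (auto simp: agree_def)
qed

theorem theorem5p2:
  fixes D D' :: "('l::linorder \<times> 'l) set"
    and f f' :: "'l \<times> 'l \<Rightarrow> 'r::ring_1 \<Rightarrow> 'f::field"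
  assumes "\<exists>\<mu> :: 'r \<Rightarrow> 'f. right_primitive \<mu>"
    and "basic D" and "f \<in> D \<rightarrow>\<^sub>E {\<mu>. right_primitive \<mu>}"
    and "basic D'" and "f' \<in> D' \<rightarrow>\<^sub>E {\<mu>. right_primitive \<mu>}"
    and "gmodule_hom McLain (basic_module D f) (basic_module D' f')
           \<noteq> {zero_hom (basic_module D f) (basic_module D' f')}"
  shows "D = D' \<and> f = f'"
proof -
  have bd: "basic_data D f" "basic_data D' f'"
    using assms(2-5) by (auto intro!: basic_data.intro)
  have "zero_hom (basic_module D f) (basic_module D' f') \<in>
      gmodule_hom McLain (basic_module D f) (basic_module D' f')"
    using bd[THEN basic_data.U_linear] by (intro zero_hom_mem) (simp_all add: McLain_carrier)
  with assms(6) obtain \<theta> where \<theta>: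
    "\<theta> \<in> gmodule_hom McLain (basic_module D f) (basic_module D' f')"
    "\<theta> \<noteq> zero_hom (basic_module D f) (basic_module D' f')" by blast
  have "D = D' \<and> (\<forall>i\<in>D. f i = f' i)"
    by (rule hom_relation[OF bd \<theta>]) (rule basic_data_unique[OF bd], assumption, blast)
  \<comment> \<open>Both functions are extensional on the common domain, so agreement on
    \<open>D\<close> suffices.\<close>
  moreover from this have "f = f'" using assms(3,5) by (auto intro: PiE_ext)
  ultimately show ?thesis by blast
qed

end
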